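(* For every category $\mathcal{L}$, the cocartesian monoidal category $(\mathsf{Set}[\mathcal{L}]_\star,0,+)$ is uniform traced; in particular $(\mathsf{Poly}_\star,0,+)$ is uniform traced. Moreover, for each functor $X\colon\mathcal{L}\to\mathsf{Set}$, the functor $\mathsf{Set}[\mathcal{L}]_\star\to\mathsf{Set}_\star$ sending $(1\to p)\mapsto(1\to \mathsf{Exp}_{\mathcal{L}}(p)(X))$ is a traced functor.
   Context: Write $\mathcal{L}\text{-}\mathsf{Set}=\mathsf{Fun}(\mathcal{L},\mathsf{Set})$. The category $\mathsf{Set}[\mathcal{L}]$ is the free coproduct completion of $(\mathcal{L}\text{-}\mathsf{Set})^{\mathrm{op}}$; its objects are formal coproducts $\sum_{i\in I}A_i$ with $A_i\in\mathcal{L}\text{-}\mathsf{Set}$. The functor $\mathsf{Exp}_{\mathcal{L}}\colon\mathsf{Set}[\mathcal{L}]\to\mathsf{Fun}(\mathcal{L}\text{-}\mathsf{Set},\mathsf{Set})$ is the fully faithful coproduct-preserving functor sending $\sum_{i\in I}A_i$ to $\sum_{i\in I}\mathcal{L}\text{-}\mathsf{Set}(A_i,-)$. When $\mathcal{L}=0$ is empty this gives $\mathsf{Set}$, and when $\mathcal{L}$ is the terminal category it gives $\mathsf{Poly}$, the category of polynomial functors $\sum_{i\in I}\mathsf{Set}(A_i,-)\colon\mathsf{Set}\to\mathsf{Set}$ (coproducts of representables) and natural transformations. For $\mathcal{C}=\mathsf{Set}[\mathcal{L}]$ (in particular $\mathsf{Set}$, $\mathsf{Poly}$), $\mathcal{C}_\star$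 denotes the Kleisli category of the monad $c\mapsto c+1$; equivalently, it is identified with the coslice $1/\mathcal{C}$ of objects equipped with a map from the terminal object (an object $c$ of the Kleisli category corresponds to $1\to c+1$). Its monoidal structure $(0,+)$ is given by coproducts of the Kleisli category. $\mathsf{Set}_\star$ is the category of sets and partial functions, with $(0,+)$ given by disjoint union. A traced category is a symmetric monoidal category $(\mathcal{T},I,\otimes)$ (associators and unitors suppressed, braiding $\sigma$) with functions $\mathrm{Tr}^U_{A,B}\colon\mathcal{T}(A\otimes U,B\otimes U)\to\mathcal{T}(A,B)$ for all objects $A,B,U$ such that: (naturality) $\mathrm{Tr}^U_{A',B'}((g\otimes U)\circ k\circ(f\otimes U))=g\circ\mathrm{Tr}^U_{A,B}(k)\circ f$ for $f\colon A'\to A$, $g\colon B\to B'$, $k\colon A\otimes U\to B\otimes U$; (dinaturality) $\mathrm{Tr}^V_{A,B}((B\otimes h)\circ k)=\mathrm{Tr}^U_{A,B}(k\circ(A\otimes h))$ for $h\colon U\to V$, $k\colon A\otimes V\to B\otimes U$; (monoidality) $\mathrm{Tr}^I_{A,B}$ is the canonical identification and $\mathrm{Tr}^{U\otimes V}_{A,B}=\mathrm{Tr}^U_{A,B}\circ\mathrm{Tr}^V_{A\otimes U,B\otimes U}$; (superposing) $\mathrm{Tr}^U_{A'\otimes A,B'\otimes B}(h\otimes k)=h\otimes\mathrm{Tr}^U_{A,B}(k)$ for $h\colon A'\to B'$; (yanking) $\mathrm{Tr}^U_{U,U}(\sigma_{U,U})=\mathrm{id}_U$. A morphism $s\colon U\to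 V$ is strict if for all $A,B$, $f\colon A\otimes U\to B\otimes U$, $g\colon A\otimes V\to B\otimes V$ with $(B\otimes s)\circ f=g\circ(A\otimes s)$ one has $\mathrm{Tr}^U_{A,B}(f)=\mathrm{Tr}^V_{A,B}(g)$. A traced category is uniform if every morphism is strict. A traced functor is a strong symmetric monoidal functor preserving the trace (modulo its structure isomorphisms). The trace on $(\mathsf{Set}_\star,0,+)$: for a partial function $f\colon A+U\rightharpoonup B+U$, $\mathrm{Tr}^U_{A,B}(f)\colon A\rightharpoonup B$ sends $a$ to the element of $B$ obtained by applying $f$ to $a$ and repeatedly feeding outputs lying in $U$ back into $f$, if this process reaches $B$ after finitely many steps; it is undefined at $a$ otherwise. *)

theory Defs
  imports Main "HOL-Library.FuncSet"
begin

section \<open>Categories and functors\<close>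

record ('o, 'm) category =
  Obj :: "'o set"
  Mor :: "'m set"
  Dom :: "'m \<Rightarrow> 'o"
  Cod :: "'m \<Rightarrow> 'o"
  Id :: "'o \<Rightarrow> 'm"
  Comp :: "'m \<Rightarrow> 'm \<Rightarrow> 'm"  (infixl "\<cdot>\<index>" 75)

definition Hom :: "('o, 'm, 'e) category_scheme \<Rightarrow> 'o \<Rightarrow> 'o \<Rightarrow> 'm set"
  where "Hom C A B = {f \<in> Mor C. Dom C f = A \<and> Cod C f = B}"

locale category =
  fixes C :: "('o, 'm, 'e) category_scheme" (structure)
  assumes dom_obj: "f \<in> Mor C \<Longrightarrow> Dom C f \<in> Obj C"
    and cod_obj: "f \<in> Mor C \<Longrightarrow> Cod C f \<in> Obj C"
    and id_hom: "A \<in> Obj C \<Longrightarrow> Id C A \<in> Hom C A A"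
    and comp_hom: "\<lbrakk>f \<in> Hom C A B; g \<in> Hom C B D\<rbrakk> \<Longrightarrow> g \<cdot> f \<in> Hom C A D"
    and comp_id_right: "f \<in> Hom C A B \<Longrightarrow> f \<cdot> Id C A = f"
    and comp_id_left: "f \<in> Hom C A B \<Longrightarrow> Id C B \<cdot> f = f"
    and comp_assoc: "\<lbrakk>f \<in> Hom C A B; g \<in> Hom C B D; h \<in> Hom C D E\<rbrakk>
      \<Longrightarrow> (h \<cdot> g) \<cdot> f = h \<cdot> (g \<cdot> f)"

definition inverse_pair :: "('o, 'm, 'e) category_scheme \<Rightarrow> 'm \<Rightarrow> 'm \<Rightarrow> bool"
  where "inverse_pair C f g \<longleftrightarrow> f \<in> Mor C \<and> g \<in> Hom C (Cod C f) (Dom C f)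
    \<and> Comp C g f = Id C (Dom C f) \<and> Comp C f g = Id C (Cod C f)"

definition iso :: "('o, 'm, 'e) category_scheme \<Rightarrow> 'm \<Rightarrow> bool"
  where "iso C f \<longleftrightarrow> (\<exists>g. inverse_pair C f g)"

definition inv_mor :: "('o, 'm, 'e) category_scheme \<Rightarrow> 'm \<Rightarrow> 'm"
  where "inv_mor C f = (THE g. inverse_pair C f g)"

definition terminal :: "('o, 'm, 'e) category_scheme \<Rightarrow> 'o \<Rightarrow> bool"
  where "terminal C t \<longleftrightarrow> t \<in> Obj C \<and> (\<forall>A \<in> Obj C. \<exists>!f. f \<in> Hom C A t)"

definition opp :: "('o, 'm) category \<Rightarrow> ('o, 'm) category"
  where "opp C = \<lparr>Obj = Obj C, Mor = Mor C, Dom = Cod C, Cod = Dom C, Id = Id C,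
    Comp = (\<lambda>g f. Comp C f g)\<rparr>"

record ('o1, 'm1, 'o2, 'm2) cat_functor =
  FOb :: "'o1 \<Rightarrow> 'o2"
  FMor :: "'m1 \<Rightarrow> 'm2"

locale is_functor = source: category C + target: category D
  for C :: "('o1, 'm1, 'e1) category_scheme" and D :: "('o2, 'm2, 'e2) category_scheme" +
  fixes F :: "('o1, 'm1, 'o2, 'm2) cat_functor"
  assumes fob: "A \<in> Obj C \<Longrightarrow> FOb F A \<in> Obj D"
    and fmor: "f \<in> Hom C A B \<Longrightarrow> FMor F f \<in> Hom D (FOb F A) (FOb F B)"
    and fid: "A \<in> Obj C \<Longrightarrow> FMor F (Id C A) = Id D (FOb F A)"
    and fcomp: "\<lbrakk>f \<in> Hom C A B; g \<in> Hom C B E\<rbrakk>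
      \<Longrightarrow> FMor F (Comp C g f) = Comp D (FMor F g) (FMor F f)"

text \<open>Arrows of the concrete categories below carry their source and target.\<close>

datatype ('o, 'x) arr = Arr (src: 'o) (tgt: 'o) (the_map: 'x)

text \<open>In the functor category, functors and transformations are required to be
  \<open>undefined\<close> outside the source category, so that HOL equality is equality of functors and of
  transformations.\<close>

type_synonym ('o1, 'm1, 'o2, 'm2) nat_arr =
  "(('o1, 'm1, 'o2, 'm2) cat_functor, 'o1 \<Rightarrow> 'm2) arr"

definition fun_cat :: "('o1, 'm1) category \<Rightarrow> ('o2, 'm2) category
    \<Rightarrow> (('o1, 'm1, 'o2, 'm2) cat_functor, ('o1, 'm1, 'o2, 'm2) nat_arr) category"
  where "fun_cat C D =
   (let functors = {F. is_functor C D F \<and> FOb F \<in> extensional (Obj C)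
                      \<and> FMor F \<in> extensional (Mor C)}
    in \<lparr>Obj = functors,
        Mor = {Arr F G \<eta> | F G \<eta>. F \<in> functors \<and> G \<in> functors \<and> \<eta> \<in> extensional (Obj C)
          \<and> (\<forall>A \<in> Obj C. \<eta> A \<in> Hom D (FOb F A) (FOb G A))
          \<and> (\<forall>f \<in> Mor C. Comp D (\<eta> (Cod C f)) (FMor F f) = Comp D (FMor G f) (\<eta> (Dom C f)))},
        Dom = src, Cod = tgt,
        Id = (\<lambda>F. Arr F F (\<lambda>A \<in> Obj C. Id D (FOb F A))),
        Comp = (\<lambda>\<epsilon> \<eta>. Arr (src \<eta>) (tgt \<epsilon>) (\<lambda>A \<in> Obj C. Comp D (the_map \<epsilon> A) (the_map \<eta> A)))\<rparr>)"


section \<open>Finite coproducts and the cocartesian monoidal structure\<close>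

record ('o, 'm) coproducts =
  Zero :: 'o
  Sum :: "'o \<Rightarrow> 'o \<Rightarrow> 'o"
  Inj1 :: "'o \<Rightarrow> 'o \<Rightarrow> 'm"
  Inj2 :: "'o \<Rightarrow> 'o \<Rightarrow> 'm"

locale has_coproducts = category C
  for C :: "('o, 'm, 'e) category_scheme" (structure) +
  fixes K :: "('o, 'm) coproducts"
  assumes zero_obj: "Zero K \<in> Obj C"
    and zero_initial: "A \<in> Obj C \<Longrightarrow> \<exists>!f. f \<in> Hom C (Zero K) A"
    and sum_obj: "\<lbrakk>A \<in> Obj C; B \<in> Obj C\<rbrakk> \<Longrightarrow> Sum K A B \<in> Obj C"
    and inj1_hom: "\<lbrakk>A \<in> Obj C; B \<in> Obj C\<rbrakk> \<Longrightarrow> Inj1 K A B \<in> Hom C A (Sum K A B)"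
    and inj2_hom: "\<lbrakk>A \<in> Obj C; B \<in> Obj C\<rbrakk> \<Longrightarrow> Inj2 K A B \<in> Hom C B (Sum K A B)"
    and sum_universal: "\<lbrakk>f \<in> Hom C A X; g \<in> Hom C B X\<rbrakk>
      \<Longrightarrow> \<exists>!h. h \<in> Hom C (Sum K A B) X \<and> h \<cdot> Inj1 K A B = f \<and> h \<cdot> Inj2 K A B = g"

definition initial_map :: "('o, 'm, 'e) category_scheme \<Rightarrow> ('o, 'm) coproducts \<Rightarrow> 'o \<Rightarrow> 'm"
  where "initial_map C K A = (THE f. f \<in> Hom C (Zero K) A)"

definition copair ::
    "('o, 'm, 'e) category_scheme \<Rightarrow> ('o, 'm) coproducts \<Rightarrow> 'm \<Rightarrow> 'm \<Rightarrow> 'm"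
  where "copair C K f g = (THE h. h \<in> Hom C (Sum K (Dom C f) (Dom C g)) (Cod C f)
    \<and> Comp C h (Inj1 K (Dom C f) (Dom C g)) = f \<and> Comp C h (Inj2 K (Dom C f) (Dom C g)) = g)"

text \<open>For a functor \<open>F\<close> between categories with finite coproducts, the canonical maps
  \<open>F A + F B \<rightarrow> F (A + B)\<close> and \<open>0 \<rightarrow> F 0\<close>.\<close>

definition sum_comparison :: "('o1, 'm1) coproducts \<Rightarrow> ('o2, 'm2) category
    \<Rightarrow> ('o2, 'm2) coproducts \<Rightarrow> ('o1, 'm1, 'o2, 'm2) cat_functor \<Rightarrow> 'o1 \<Rightarrow> 'o1 \<Rightarrow> 'm2"
  where "sum_comparison K D K' F A B = copair D K' (FMor F (Inj1 K A B)) (FMor F (Inj2 K A B))"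

definition zero_comparison :: "('o1, 'm1) coproducts \<Rightarrow> ('o2, 'm2) category
    \<Rightarrow> ('o2, 'm2) coproducts \<Rightarrow> ('o1, 'm1, 'o2, 'm2) cat_functor \<Rightarrow> 'm2"
  where "zero_comparison K D K' F = initial_map D K' (FOb F (Zero K))"

record ('o, 'm) monoidal_category = "('o, 'm) category" +
  TUnit :: 'o
  TOb :: "'o \<Rightarrow> 'o \<Rightarrow> 'o"  (infixr "\<otimes>\<index>" 80)
  TMor :: "'m \<Rightarrow> 'm \<Rightarrow> 'm"  (infixr "\<boxtimes>\<index>" 80)
  Assoc :: "'o \<Rightarrow> 'o \<Rightarrow> 'o \<Rightarrow> 'm"
  LUnit :: "'o \<Rightarrow> 'm"
  RUnit :: "'o \<Rightarrow> 'm"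
  Braid :: "'o \<Rightarrow> 'o \<Rightarrow> 'm"

definition cocartesian ::
    "('o, 'm) category \<Rightarrow> ('o, 'm) coproducts \<Rightarrow> ('o, 'm) monoidal_category"
  where "cocartesian C K =
    \<lparr>Obj = Obj C, Mor = Mor C, Dom = Dom C, Cod = Cod C, Id = Id C, Comp = Comp C,
     TUnit = Zero K,
     TOb = Sum K,
     TMor = (\<lambda>f g. copair C K (Comp C (Inj1 K (Cod C f) (Cod C g)) f)
                              (Comp C (Inj2 K (Cod C f) (Cod C g)) g)),
     Assoc = (\<lambda>A B E. copair C K
        (copair C K (Inj1 K A (Sum K B E)) (Comp C (Inj2 K A (Sum K B E)) (Inj1 K B E)))
        (Comp C (Inj2 K A (Sum K B E)) (Inj2 K B E))),
     LUnit = (\<lambda>A. copair C K (initial_map C K A) (Id C A)),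
     RUnit = (\<lambda>A. copair C K (Id C A) (initial_map C K A)),
     Braid = (\<lambda>A B. copair C K (Inj2 K B A) (Inj1 K B A))\<rparr>"


section \<open>Traced categories\<close>

text \<open>Structure maps: \<open>Assoc M A B E : (A \<otimes> B) \<otimes> E \<rightarrow> A \<otimes> (B \<otimes> E)\<close>,
  \<open>LUnit M A : I \<otimes> A \<rightarrow> A\<close>, \<open>RUnit M A : A \<otimes> I \<rightarrow> A\<close>, \<open>Braid M A B : A \<otimes> B \<rightarrow> B \<otimes> A\<close>.\<close>

locale symmetric_monoidal = category M
  for M :: "('o, 'm, 'e) monoidal_category_scheme" (structure) +
  assumes unit_obj: "TUnit M \<in> Obj M"
    and tensor_obj: "\<lbrakk>A \<in> Obj M; B \<in> Obj M\<rbrakk> \<Longrightarrow> A \<otimes> B \<in> Obj M"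
    and tensor_hom: "\<lbrakk>f \<in> Hom M A A'; g \<in> Hom M B B'\<rbrakk>
      \<Longrightarrow> f \<boxtimes> g \<in> Hom M (A \<otimes> B) (A' \<otimes> B')"
    and tensor_id: "\<lbrakk>A \<in> Obj M; B \<in> Obj M\<rbrakk> \<Longrightarrow> Id M A \<boxtimes> Id M B = Id M (A \<otimes> B)"
    and tensor_comp: "\<lbrakk>f \<in> Hom M A A'; f' \<in> Hom M A' A''; g \<in> Hom M B B'; g' \<in> Hom M B' B''\<rbrakk>
      \<Longrightarrow> (f' \<cdot> f) \<boxtimes> (g' \<cdot> g) = (f' \<boxtimes> g') \<cdot> (f \<boxtimes> g)"
    and assoc_hom: "\<lbrakk>A \<in> Obj M; B \<in> Obj M; E \<in> Obj M\<rbrakk>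
      \<Longrightarrow> Assoc M A B E \<in> Hom M ((A \<otimes> B) \<otimes> E) (A \<otimes> (B \<otimes> E))"
    and assoc_iso: "\<lbrakk>A \<in> Obj M; B \<in> Obj M; E \<in> Obj M\<rbrakk> \<Longrightarrow> iso M (Assoc M A B E)"
    and assoc_natural: "\<lbrakk>f \<in> Hom M A A'; g \<in> Hom M B B'; h \<in> Hom M E E'\<rbrakk>
      \<Longrightarrow> Assoc M A' B' E' \<cdot> ((f \<boxtimes> g) \<boxtimes> h) = (f \<boxtimes> (g \<boxtimes> h)) \<cdot> Assoc M A B E"
    and lunit_hom: "A \<in> Obj M \<Longrightarrow> LUnit M A \<in> Hom M (TUnit M \<otimes> A) A"
    and lunit_iso: "A \<in> Obj M \<Longrightarrow> iso M (LUnit M A)"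
    and lunit_natural: "f \<in> Hom M A B \<Longrightarrow> LUnit M B \<cdot> (Id M (TUnit M) \<boxtimes> f) = f \<cdot> LUnit M A"
    and runit_hom: "A \<in> Obj M \<Longrightarrow> RUnit M A \<in> Hom M (A \<otimes> TUnit M) A"
    and runit_iso: "A \<in> Obj M \<Longrightarrow> iso M (RUnit M A)"
    and runit_natural: "f \<in> Hom M A B \<Longrightarrow> RUnit M B \<cdot> (f \<boxtimes> Id M (TUnit M)) = f \<cdot> RUnit M A"
    and braid_hom: "\<lbrakk>A \<in> Obj M; B \<in> Obj M\<rbrakk> \<Longrightarrow> Braid M A B \<in> Hom M (A \<otimes> B) (B \<otimes> A)"
    and braid_natural: "\<lbrakk>f \<in> Hom M A A'; g \<in> Hom M B B'\<rbrakk>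
      \<Longrightarrow> Braid M A' B' \<cdot> (f \<boxtimes> g) = (g \<boxtimes> f) \<cdot> Braid M A B"
    and braid_symmetric: "\<lbrakk>A \<in> Obj M; B \<in> Obj M\<rbrakk>
      \<Longrightarrow> Braid M B A \<cdot> Braid M A B = Id M (A \<otimes> B)"
    and pentagon: "\<lbrakk>A \<in> Obj M; B \<in> Obj M; D \<in> Obj M; E \<in> Obj M\<rbrakk>
      \<Longrightarrow> Assoc M A B (D \<otimes> E) \<cdot> Assoc M (A \<otimes> B) D E
        = (Id M A \<boxtimes> Assoc M B D E) \<cdot> Assoc M A (B \<otimes> D) E \<cdot> (Assoc M A B D \<boxtimes> Id M E)"
    and triangle: "\<lbrakk>A \<in> Obj M; B \<in> Obj M\<rbrakk>
      \<Longrightarrow> (Id M A \<boxtimes> LUnit M B) \<cdot> Assoc M A (TUnit M) B = RUnit M A \<boxtimes> Id M B"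
    and hexagon: "\<lbrakk>A \<in> Obj M; B \<in> Obj M; E \<in> Obj M\<rbrakk>
      \<Longrightarrow> Assoc M B E A \<cdot> Braid M A (B \<otimes> E) \<cdot> Assoc M A B E
        = (Id M B \<boxtimes> Braid M A E) \<cdot> Assoc M B A E \<cdot> (Braid M A B \<boxtimes> Id M E)"

text \<open>\<open>Tr A B U f : A \<rightarrow> B\<close> is the trace of \<open>f : A \<otimes> U \<rightarrow> B \<otimes> U\<close>; the values of \<open>Tr\<close> at other
  arguments are irrelevant.  The associators and right unitors are written out.\<close>

locale traced_category = symmetric_monoidal M
  for M :: "('o, 'm, 'e) monoidal_category_scheme" (structure) +
  fixes Tr :: "'o \<Rightarrow> 'o \<Rightarrow> 'o \<Rightarrow> 'm \<Rightarrow> 'm"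
  assumes trace_hom: "\<lbrakk>A \<in> Obj M; B \<in> Obj M; U \<in> Obj M; f \<in> Hom M (A \<otimes> U) (B \<otimes> U)\<rbrakk>
      \<Longrightarrow> Tr A B U f \<in> Hom M A B"
    and trace_natural: "\<lbrakk>U \<in> Obj M; f \<in> Hom M A' A; g \<in> Hom M B B'; k \<in> Hom M (A \<otimes> U) (B \<otimes> U)\<rbrakk>
      \<Longrightarrow> Tr A' B' U ((g \<boxtimes> Id M U) \<cdot> k \<cdot> (f \<boxtimes> Id M U)) = g \<cdot> Tr A B U k \<cdot> f"
    and trace_dinatural: "\<lbrakk>A \<in> Obj M; B \<in> Obj M; h \<in> Hom M U V; k \<in> Hom M (A \<otimes> V) (B \<otimes> U)\<rbrakk>
      \<Longrightarrow> Tr A B V ((Id M B \<boxtimes> h) \<cdot> k) = Tr A B U (k \<cdot> (Id M A \<boxtimes> h))"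
    and trace_unit: "\<lbrakk>A \<in> Obj M; B \<in> Obj M; f \<in> Hom M (A \<otimes> TUnit M) (B \<otimes> TUnit M)\<rbrakk>
      \<Longrightarrow> Tr A B (TUnit M) f = RUnit M B \<cdot> f \<cdot> inv_mor M (RUnit M A)"
    and trace_tensor: "\<lbrakk>A \<in> Obj M; B \<in> Obj M; U \<in> Obj M; V \<in> Obj M;
        f \<in> Hom M (A \<otimes> (U \<otimes> V)) (B \<otimes> (U \<otimes> V))\<rbrakk>
      \<Longrightarrow> Tr A B (U \<otimes> V) f
        = Tr A B U (Tr (A \<otimes> U) (B \<otimes> U) V (inv_mor M (Assoc M B U V) \<cdot> f \<cdot> Assoc M A U V))"
    and superposing: "\<lbrakk>A \<in> Obj M; B \<in> Obj M; U \<in> Obj M; h \<in> Hom M A' B';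
        k \<in> Hom M (A \<otimes> U) (B \<otimes> U)\<rbrakk>
      \<Longrightarrow> Tr (A' \<otimes> A) (B' \<otimes> B) U (inv_mor M (Assoc M B' B U) \<cdot> (h \<boxtimes> k) \<cdot> Assoc M A' A U)
        = h \<boxtimes> Tr A B U k"
    and yanking: "U \<in> Obj M \<Longrightarrow> Tr U U U (Braid M U U) = Id M U"

definition strict_morphism :: "('o, 'm, 'e) monoidal_category_scheme
    \<Rightarrow> ('o \<Rightarrow> 'o \<Rightarrow> 'o \<Rightarrow> 'm \<Rightarrow> 'm) \<Rightarrow> 'm \<Rightarrow> bool"
  where "strict_morphism M Tr s \<longleftrightarrow>
    (let U = Dom M s; V = Cod M s in
      \<forall>A \<in> Obj M. \<forall>B \<in> Obj M.
      \<forall>f \<in> Hom M (TOb M A U) (TOb M B U). \<forall>g \<in> Hom M (TOb M A V) (TOb M B V).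
        Comp M (TMor M (Id M B) s) f = Comp M g (TMor M (Id M A) s)
        \<longrightarrow> Tr A B U f = Tr A B V g)"

locale uniform_traced_category = traced_category +
  assumes uniform: "s \<in> Mor M \<Longrightarrow> strict_morphism M Tr s"

text \<open>A strong symmetric monoidal functor \<open>F\<close> with structure isomorphisms
  \<open>\<phi> A B : F A \<otimes> F B \<rightarrow> F (A \<otimes> B)\<close> and \<open>\<phi>0 : I \<rightarrow> F I\<close> that preserves the trace.\<close>

locale traced_functor =
  source: traced_category M Tr + target: traced_category N Tr' + is_functor M N F
  for M :: "('o1, 'm1, 'e1) monoidal_category_scheme" and Tr
    and N :: "('o2, 'm2, 'e2) monoidal_category_scheme" and Tr'
    and F :: "('o1, 'm1, 'o2, 'm2) cat_functor" +
  fixes \<phi> :: "'o1 \<Rightarrow> 'o1 \<Rightarrow> 'm2" and \<phi>0 :: 'm2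
  assumes \<phi>_hom: "\<lbrakk>A \<in> Obj M; B \<in> Obj M\<rbrakk>
      \<Longrightarrow> \<phi> A B \<in> Hom N (TOb N (FOb F A) (FOb F B)) (FOb F (TOb M A B))"
    and \<phi>_iso: "\<lbrakk>A \<in> Obj M; B \<in> Obj M\<rbrakk> \<Longrightarrow> iso N (\<phi> A B)"
    and \<phi>_natural: "\<lbrakk>f \<in> Hom M A A'; g \<in> Hom M B B'\<rbrakk>
      \<Longrightarrow> Comp N (\<phi> A' B') (TMor N (FMor F f) (FMor F g))
        = Comp N (FMor F (TMor M f g)) (\<phi> A B)"
    and \<phi>0_hom: "\<phi>0 \<in> Hom N (TUnit N) (FOb F (TUnit M))"
    and \<phi>0_iso: "iso N \<phi>0"
    and \<phi>_assoc: "\<lbrakk>A \<in> Obj M; B \<in> Obj M; E \<in> Obj M\<rbrakk>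
      \<Longrightarrow> Comp N (FMor F (Assoc M A B E))
            (Comp N (\<phi> (TOb M A B) E) (TMor N (\<phi> A B) (Id N (FOb F E))))
        = Comp N (\<phi> A (TOb M B E))
            (Comp N (TMor N (Id N (FOb F A)) (\<phi> B E)) (Assoc N (FOb F A) (FOb F B) (FOb F E)))"
    and \<phi>_lunit: "A \<in> Obj M
      \<Longrightarrow> Comp N (FMor F (LUnit M A)) (Comp N (\<phi> (TUnit M) A) (TMor N \<phi>0 (Id N (FOb F A))))
        = LUnit N (FOb F A)"
    and \<phi>_runit: "A \<in> Obj M
      \<Longrightarrow> Comp N (FMor F (RUnit M A)) (Comp N (\<phi> A (TUnit M)) (TMor N (Id N (FOb F A)) \<phi>0))
        = RUnit N (FOb F A)"
    and \<phi>_braid: "\<lbrakk>A \<in> Obj M; B \<in> Obj M\<rbrakk>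
      \<Longrightarrow> Comp N (FMor F (Braid M A B)) (\<phi> A B)
        = Comp N (\<phi> B A) (Braid N (FOb F A) (FOb F B))"
    and preserves_trace: "\<lbrakk>A \<in> Obj M; B \<in> Obj M; U \<in> Obj M; f \<in> Hom M (TOb M A U) (TOb M B U)\<rbrakk>
      \<Longrightarrow> FMor F (Tr A B U f)
        = Tr' (FOb F A) (FOb F B) (FOb F U) (Comp N (inv_mor N (\<phi> B U)) (Comp N (FMor F f) (\<phi> A U)))"


section \<open>The Kleisli category of \<open>c \<mapsto> c + 1\<close>\<close>

text \<open>\<open>t\<close> is the terminal object.  The unit of the monad is \<open>Inj1 K c t\<close>.\<close>

definition maybe_map :: "('o, 'm) category \<Rightarrow> ('o, 'm) coproducts \<Rightarrow> 'o \<Rightarrow> 'm \<Rightarrow> 'm"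
  where "maybe_map C K t f =
    copair C K (Comp C (Inj1 K (Cod C f) t) f) (Inj2 K (Cod C f) t)"

definition maybe_mult :: "('o, 'm) category \<Rightarrow> ('o, 'm) coproducts \<Rightarrow> 'o \<Rightarrow> 'o \<Rightarrow> 'm"
  where "maybe_mult C K t c = copair C K (Id C (Sum K c t)) (Inj2 K c t)"

definition star ::
    "('o, 'm) category \<Rightarrow> ('o, 'm) coproducts \<Rightarrow> 'o \<Rightarrow> ('o, ('o, 'm) arr) category"
  where "star C K t =
    \<lparr>Obj = Obj C,
     Mor = {Arr c d f | c d f. c \<in> Obj C \<and> d \<in> Obj C \<and> f \<in> Hom C c (Sum K d t)},
     Dom = src, Cod = tgt,
     Id = (\<lambda>c. Arr c c (Inj1 K c t)),
     Comp = (\<lambda>g f. Arr (src f) (tgt g)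
       (Comp C (maybe_mult C K t (tgt g)) (Comp C (maybe_map C K t (the_map g)) (the_map f))))\<rparr>"

text \<open>Coproducts in the Kleisli category are those of \<open>C\<close>, with the injections composed with the
  unit of the monad.\<close>

definition star_coproducts ::
    "('o, 'm) category \<Rightarrow> ('o, 'm) coproducts \<Rightarrow> 'o \<Rightarrow> ('o, ('o, 'm) arr) coproducts"
  where "star_coproducts C K t =
    \<lparr>Zero = Zero K, Sum = Sum K,
     Inj1 = (\<lambda>c d. Arr c (Sum K c d) (Comp C (Inj1 K (Sum K c d) t) (Inj1 K c d))),
     Inj2 = (\<lambda>c d. Arr d (Sum K c d) (Comp C (Inj1 K (Sum K c d) t) (Inj2 K c d)))\<rparr>"

definition star_monoidal ::
    "('o, 'm) category \<Rightarrow> ('o, 'm) coproducts \<Rightarrow> 'o \<Rightarrow> ('o, ('o, 'm) arr) monoidal_category"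
  where "star_monoidal C K t = cocartesian (star C K t) (star_coproducts C K t)"

text \<open>The last conjunct is the actual assertion; the others state that \<open>K\<close>, \<open>t\<close> and
  \<open>star_coproducts C K t\<close> deserve their names.\<close>

definition star_uniform_traced ::
    "('o, 'm) category \<Rightarrow> ('o, 'm) coproducts \<Rightarrow> 'o
      \<Rightarrow> ('o \<Rightarrow> 'o \<Rightarrow> 'o \<Rightarrow> ('o, 'm) arr \<Rightarrow> ('o, 'm) arr) \<Rightarrow> bool"
  where "star_uniform_traced C K t Tr \<longleftrightarrow>
    has_coproducts C K \<and> terminal C t \<and>
    has_coproducts (star C K t) (star_coproducts C K t) \<and>
    uniform_traced_category (star_monoidal C K t) Tr"


section \<open>Sets and partial functions\<close>

text \<open>\<open>U\<close> is the collection of (small) sets, all of them sets of elements of one type.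
  Disjoint unions are coded by two injections \<open>l\<close> and \<open>r\<close> with disjoint ranges.  Only what is
  needed to form finite coproducts is required, so both a Grothendieck universe and, for an
  infinite type \<open>'u\<close>, the collection \<open>U = UNIV\<close> of all sets over \<open>'u\<close> are covered.\<close>

locale set_universe =
  fixes U :: "'u set set" and l r :: "'u \<Rightarrow> 'u"
  assumes inj_l: "inj l" and inj_r: "inj r" and disjoint_ranges: "range l \<inter> range r = {}"
    and empty_small: "{} \<in> U" and singleton_small: "{x} \<in> U"
    and sum_small: "\<lbrakk>A \<in> U; B \<in> U\<rbrakk> \<Longrightarrow> l ` A \<union> r ` B \<in> U"

type_synonym 'u set_arr = "('u set, 'u \<Rightarrow> 'u) arr"

definition set_cat :: "'u set set \<Rightarrow> ('u set, 'u set_arr) category"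
  where "set_cat U =
    \<lparr>Obj = U,
     Mor = {Arr A B f | A B f. A \<in> U \<and> B \<in> U \<and> f \<in> A \<rightarrow>\<^sub>E B},
     Dom = src, Cod = tgt,
     Id = (\<lambda>A. Arr A A (\<lambda>x \<in> A. x)),
     Comp = (\<lambda>g f. Arr (src f) (tgt g) (compose (src f) (the_map g) (the_map f)))\<rparr>"

type_synonym 'u pset_arr = "('u set, 'u \<Rightarrow> 'u option) arr"

text \<open>\<open>Set_\<star>\<close>: sets and partial functions.\<close>

definition pset_cat :: "'u set set \<Rightarrow> ('u set, 'u pset_arr) category"
  where "pset_cat U =
    \<lparr>Obj = U,
     Mor = {Arr A B f | A B f. A \<in> U \<and> B \<in> U \<and> dom f \<subseteq> A \<and> ran f \<subseteq> B},
     Dom = src, Cod = tgt,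
     Id = (\<lambda>A. Arr A A (Some |` A)),
     Comp = (\<lambda>g f. Arr (src f) (tgt g) (the_map g \<circ>\<^sub>m the_map f))\<rparr>"

definition pset_coproducts ::
    "('u \<Rightarrow> 'u) \<Rightarrow> ('u \<Rightarrow> 'u) \<Rightarrow> ('u set, 'u pset_arr) coproducts"
  where "pset_coproducts l r =
    \<lparr>Zero = {}, Sum = (\<lambda>A B. l ` A \<union> r ` B),
     Inj1 = (\<lambda>A B. Arr A (l ` A \<union> r ` B) ((Some \<circ> l) |` A)),
     Inj2 = (\<lambda>A B. Arr B (l ` A \<union> r ` B) ((Some \<circ> r) |` B))\<rparr>"

text \<open>\<open>reaches l r f z y\<close>: applying \<open>f\<close> to \<open>z\<close>, and then repeatedly to the outputs that lie in the
  right-hand summand, produces the element \<open>y\<close> of the left-hand summand after finitely many steps.\<close>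

inductive reaches :: "('u \<Rightarrow> 'u) \<Rightarrow> ('u \<Rightarrow> 'u) \<Rightarrow> ('u \<Rightarrow> 'u option) \<Rightarrow> 'u \<Rightarrow> 'u \<Rightarrow> bool"
  for l r f where
  exit: "f z = Some (l y) \<Longrightarrow> reaches l r f z y"
| loop: "\<lbrakk>f z = Some (r u); reaches l r f (r u) y\<rbrakk> \<Longrightarrow> reaches l r f z y"

definition pset_trace :: "('u \<Rightarrow> 'u) \<Rightarrow> ('u \<Rightarrow> 'u)
    \<Rightarrow> 'u set \<Rightarrow> 'u set \<Rightarrow> 'u set \<Rightarrow> 'u pset_arr \<Rightarrow> 'u pset_arr"
  where "pset_trace l r A B W f = Arr A B
    (\<lambda>a. if a \<in> A \<and> (\<exists>b. reaches l r (the_map f) (l a) b)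
         then Some (THE b. reaches l r (the_map f) (l a) b) else None)"


section \<open>Free coproduct completions and the functor \<open>Exp\<close>\<close>

text \<open>A formal coproduct \<open>\<Sum>i\<in>I. A i\<close> is the pair \<open>(I, A)\<close>; a morphism
  \<open>\<Sum>i\<in>I. A i \<rightarrow> \<Sum>j\<in>J. B j\<close> consists of \<open>f : I \<rightarrow> J\<close> and morphisms \<open>\<phi> i : A i \<rightarrow> B (f i)\<close> of
  \<open>C\<close>.\<close>

type_synonym ('u, 'o) fam = "'u set \<times> ('u \<Rightarrow> 'o)"
type_synonym ('u, 'o, 'm) fam_arr = "(('u, 'o) fam, ('u \<Rightarrow> 'u) \<times> ('u \<Rightarrow> 'm)) arr"

definition fam_cat ::
    "'u set set \<Rightarrow> ('o, 'm) category \<Rightarrow> (('u, 'o) fam, ('u, 'o, 'm) fam_arr) category"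
  where "fam_cat U C =
   (let objects = {(I, A) | I A. I \<in> U \<and> A \<in> I \<rightarrow>\<^sub>E Obj C}
    in \<lparr>Obj = objects,
        Mor = {Arr (I, A) (J, B) (f, \<phi>) | I A J B f \<phi>. (I, A) \<in> objects \<and> (J, B) \<in> objects
          \<and> f \<in> I \<rightarrow>\<^sub>E J \<and> \<phi> \<in> extensional I \<and> (\<forall>i \<in> I. \<phi> i \<in> Hom C (A i) (B (f i)))},
        Dom = src, Cod = tgt,
        Id = (\<lambda>(I, A). Arr (I, A) (I, A) (\<lambda>i \<in> I. i, \<lambda>i \<in> I. Id C (A i))),
        Comp = (\<lambda>a b. let I = fst (src b); (g, \<psi>) = the_map a; (f, \<phi>) = the_map b
          in Arr (src b) (tgt a) (\<lambda>i \<in> I. g (f i), \<lambda>i \<in> I. Comp C (\<psi> (f i)) (\<phi> i)))\<rparr>)"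

definition fam_sum ::
    "('u \<Rightarrow> 'u) \<Rightarrow> ('u \<Rightarrow> 'u) \<Rightarrow> ('u, 'o) fam \<Rightarrow> ('u, 'o) fam \<Rightarrow> ('u, 'o) fam"
  where "fam_sum l r p q = (case (p, q) of ((I, A), (J, B)) \<Rightarrow>
    (l ` I \<union> r ` J,
     \<lambda>k \<in> l ` I \<union> r ` J. if k \<in> l ` I then A (the_inv l k) else B (the_inv r k)))"

definition fam_coproducts :: "('u \<Rightarrow> 'u) \<Rightarrow> ('u \<Rightarrow> 'u) \<Rightarrow> ('o, 'm) category
    \<Rightarrow> (('u, 'o) fam, ('u, 'o, 'm) fam_arr) coproducts"
  where "fam_coproducts l r C =
    \<lparr>Zero = ({}, \<lambda>i \<in> {}. undefined),
     Sum = fam_sum l r,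
     Inj1 = (\<lambda>p q. case p of (I, A) \<Rightarrow>
       Arr p (fam_sum l r p q) (\<lambda>i \<in> I. l i, \<lambda>i \<in> I. Id C (A i))),
     Inj2 = (\<lambda>p q. case q of (J, B) \<Rightarrow>
       Arr q (fam_sum l r p q) (\<lambda>j \<in> J. r j, \<lambda>j \<in> J. Id C (B j)))\<rparr>"

definition singleton_fam :: "'o \<Rightarrow> ('u, 'o) fam"
  where "singleton_fam A = ({undefined}, \<lambda>i \<in> {undefined}. A)"

text \<open>For any category \<open>D\<close>, \<open>Exp D\<close> sends \<open>\<Sum>i\<in>I. A i\<close> in the free coproduct completion of
  \<open>opp D\<close> to the functor \<open>\<Sum>i\<in>I. D(A i, -)\<close> on \<open>D\<close>.  The elements of \<open>\<Sum>i\<in>I. D(A i, X)\<close> are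
  the pairs \<open>(i, \<alpha>)\<close>, so \<open>Exp D\<close> takes values in sets over another type than that of the index
  sets.  The component \<open>\<phi> i : A i \<rightarrow> B (f i)\<close> of a morphism in \<open>opp D\<close> is a
  morphism \<open>B (f i) \<rightarrow> A i\<close> of \<open>D\<close>.\<close>

definition exp_set :: "('o, 'm) category \<Rightarrow> ('u, 'o) fam \<Rightarrow> 'o \<Rightarrow> ('u \<times> 'm) set"
  where "exp_set D p X = (case p of (I, A) \<Rightarrow> {(i, \<alpha>). i \<in> I \<and> \<alpha> \<in> Hom D (A i) X})"

definition exp_ob :: "('o, 'm) category \<Rightarrow> ('u, 'o) fam
    \<Rightarrow> ('o, 'm, ('u \<times> 'm) set, ('u \<times> 'm) set_arr) cat_functor"
  where "exp_ob D p =
    \<lparr>FOb = (\<lambda>X \<in> Obj D. exp_set D p X),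
     FMor = (\<lambda>h \<in> Mor D. Arr (exp_set D p (Dom D h)) (exp_set D p (Cod D h))
       (\<lambda>(i, \<alpha>) \<in> exp_set D p (Dom D h). (i, Comp D h \<alpha>)))\<rparr>"

definition exp_mor :: "('o, 'm) category \<Rightarrow> ('u, 'o, 'm) fam_arr
    \<Rightarrow> ('o, 'm, ('u \<times> 'm) set, ('u \<times> 'm) set_arr) nat_arr"
  where "exp_mor D a = (case the_map a of (f, \<phi>) \<Rightarrow>
    Arr (exp_ob D (src a)) (exp_ob D (tgt a))
      (\<lambda>X \<in> Obj D. Arr (exp_set D (src a) X) (exp_set D (tgt a) X)
        (\<lambda>(i, \<alpha>) \<in> exp_set D (src a) X. (f i, Comp D \<alpha> (\<phi> i)))))"


section \<open>\<open>Set[\<L>]\<close>, evaluation functors, and \<open>Poly\<close>\<close>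

type_synonym ('o, 'm, 'u) lset = "('o, 'm, 'u set, 'u set_arr) cat_functor"
type_synonym ('o, 'm, 'u) lset_arr = "('o, 'm, 'u set, 'u set_arr) nat_arr"

type_synonym ('o, 'm, 'u) setL = "('u, ('o, 'm, 'u) lset) fam"
type_synonym ('o, 'm, 'u) setL_arr = "('u, ('o, 'm, 'u) lset, ('o, 'm, 'u) lset_arr) fam_arr"

definition LSet :: "'u set set \<Rightarrow> ('o, 'm) category
    \<Rightarrow> (('o, 'm, 'u) lset, ('o, 'm, 'u) lset_arr) category"
  where "LSet U L = fun_cat L (set_cat U)"

definition SetL :: "'u set set \<Rightarrow> ('o, 'm) category
    \<Rightarrow> (('o, 'm, 'u) setL, ('o, 'm, 'u) setL_arr) category"
  where "SetL U L = fam_cat U (opp (LSet U L))"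

definition SetL_coproducts :: "'u set set \<Rightarrow> ('u \<Rightarrow> 'u) \<Rightarrow> ('u \<Rightarrow> 'u) \<Rightarrow> ('o, 'm) category
    \<Rightarrow> (('o, 'm, 'u) setL, ('o, 'm, 'u) setL_arr) coproducts"
  where "SetL_coproducts U l r L = fam_coproducts l r (opp (LSet U L))"

definition empty_lset :: "('o, 'm) category \<Rightarrow> ('o, 'm, 'u) lset"
  where "empty_lset L =
    \<lparr>FOb = (\<lambda>A \<in> Obj L. {}), FMor = (\<lambda>f \<in> Mor L. Arr {} {} (\<lambda>x \<in> {}. x))\<rparr>"

text \<open>The empty \<open>\<L>\<close>-set is initial in \<open>\<L>-Set\<close>, so the terminal object of \<open>Set[\<L>]\<close> is
  the formal coproduct whose only summand is the empty \<open>\<L>\<close>-set.\<close>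

definition SetL_one :: "('o, 'm) category \<Rightarrow> ('o, 'm, 'u) setL"
  where "SetL_one L = singleton_fam (empty_lset L)"

text \<open>Evaluation at \<open>X\<close>: a Kleisli morphism \<open>f : p \<rightarrow> q + 1\<close> induces
  \<open>Exp(p)(X) \<rightarrow> Exp(q + 1)(X) = Exp(q)(X) + 1\<close>.  The elements of \<open>Exp(q + 1)(X)\<close> coming from
  \<open>Exp(q)(X)\<close> are the values of the induced partial function; at the remaining element it is
  undefined.\<close>

definition eval_star :: "'u set set \<Rightarrow> ('u \<Rightarrow> 'u) \<Rightarrow> ('u \<Rightarrow> 'u) \<Rightarrow> ('o, 'm) category
    \<Rightarrow> ('o, 'm, 'u) lset
    \<Rightarrow> (('o, 'm, 'u) setL, (('o, 'm, 'u) setL, ('o, 'm, 'u) setL_arr) arr,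
        ('u \<times> ('o, 'm, 'u) lset_arr) set, ('u \<times> ('o, 'm, 'u) lset_arr) pset_arr) cat_functor"
  where "eval_star U l r L X =
   (let D = LSet U L;
        E = (\<lambda>p. FOb (exp_ob D p) X);
        Em = (\<lambda>a. the_map (the_map (exp_mor D a) X))
    in \<lparr>FOb = E,
        FMor = (\<lambda>k.
          let p = src k; q = tgt k; g = Em (the_map k);
              \<iota> = Em (Inj1 (SetL_coproducts U l r L) q (SetL_one L))
          in Arr (E p) (E q)
            (\<lambda>x. if x \<in> E p \<and> (\<exists>y \<in> E q. \<iota> y = g x)
                 then Some (THE y. y \<in> E q \<and> \<iota> y = g x) else None))\<rparr>)"

text \<open>\<open>Poly\<close>: the objects are the polynomial functors \<open>\<Sum>i\<in>I. Set(A i, -)\<close>, given by the formal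
  sum \<open>p = (I, A)\<close> of sets, and the morphisms \<open>p \<rightarrow> q\<close> are the natural transformations
  \<open>exp_ob (set_cat U) p \<rightarrow> exp_ob (set_cat U) q\<close>.  The elements of the values of these functors
  are pairs, so the functors take values in the category of sets over another type.\<close>

type_synonym 'u poly_ob = "('u, 'u set) fam"
type_synonym 'u poly_arr = "('u poly_ob,
  ('u set, 'u set_arr, ('u \<times> 'u set_arr) set, ('u \<times> 'u set_arr) set_arr) nat_arr) arr"

definition poly_cat :: "'u set set \<Rightarrow> ('u poly_ob, 'u poly_arr) category"
  where "poly_cat U =
   (let P = fam_cat U (opp (set_cat U)); P_of = exp_ob (set_cat U);
        E = fun_cat (set_cat U) (set_cat UNIV)
    in \<lparr>Obj = Obj P,
        Mor = {Arr p q \<eta> | p q \<eta>. p \<in> Obj P \<and> q \<in> Obj P \<and> \<eta> \<in> Hom E (P_of p) (P_of q)},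
        Dom = src, Cod = tgt,
        Id = (\<lambda>p. Arr p p (Id E (P_of p))),
        Comp = (\<lambda>\<epsilon> \<eta>. Arr (src \<eta>) (tgt \<epsilon>) (Comp E (the_map \<epsilon>) (the_map \<eta>)))\<rparr>)"

definition poly_coproducts :: "'u set set \<Rightarrow> ('u \<Rightarrow> 'u) \<Rightarrow> ('u \<Rightarrow> 'u)
    \<Rightarrow> ('u poly_ob, 'u poly_arr) coproducts"
  where "poly_coproducts U l r =
   (let K = fam_coproducts l r (opp (set_cat U))
    in \<lparr>Zero = Zero K, Sum = Sum K,
        Inj1 = (\<lambda>p q. Arr p (Sum K p q) (exp_mor (set_cat U) (Inj1 K p q))),
        Inj2 = (\<lambda>p q. Arr q (Sum K p q) (exp_mor (set_cat U) (Inj2 K p q)))\<rparr>)"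

text \<open>The terminal polynomial functor \<open>Set(\<emptyset>, -)\<close>.\<close>

definition poly_one :: "'u poly_ob"
  where "poly_one = singleton_fam {}"

end

theory Submission
  imports Defs
begin

text \<open>
  The idea is that a Kleisli morphism of a free coproduct completion is a partial function with
  labels.  Let \<open>Fam(E)\<close> be the free coproduct completion of a category \<open>E\<close> with a terminal object
  \<open>t\<close>; its terminal object is the one-term family \<open>t\<close>.  A morphism \<open>\<Sum>i. A i \<rightarrow> (\<Sum>j. B j) + 1\<close>
  sends each index \<open>i\<close> either to an index \<open>j\<close>, with a label \<open>A i \<rightarrow> B j\<close>, or to the extra index,
  where the label \<open>A i \<rightarrow> t\<close> carries no information and the morphism may be called undefined.
  Composition composes the partial functions and multiplies the labels.  The trace must then be
  the familiar one: follow the partial function through the feedback object until it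
  leaves, and compose the labels met on the way (inductive predicate \<open>exits\<close>).  The three categories of the theorem are all of this
  kind (locale \<open>labelled_partial_category\<close>): \<open>Set[\<L>]\<^sub>\<star>\<close> with \<open>E = (\<L>-Set)\<^sup>o\<^sup>p\<close> and \<open>t\<close> the empty
  \<open>\<L>\<close>-set, \<open>Poly\<^sub>\<star>\<close> with \<open>E = Set\<^sup>o\<^sup>p\<close> after the Yoneda lemma identifies natural transformations
  with morphisms of families (\<open>exp_mor_bij\<close>), and \<open>Set\<^sub>\<star>\<close> with trivial labels.

  The trace axioms do not have to be checked on paths one by one.  Order parallel morphisms by
  extension of partial functions, and for \<open>f : U \<rightarrow> B + U\<close> let \<open>f\<^sup>\<dagger> : U \<rightarrow> B\<close> be its iterate.  Two
  facts about paths suffice.  First, \<open>f\<^sup>\<dagger>\<close> is a fixed point: \<open>[id, f\<^sup>\<dagger>] f = f\<^sup>\<dagger>\<close>.  Second, there is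
  an induction principle (\<open>iter_induct\<close>): if \<open>(B + s) f = g s\<close> and \<open>[h, x] f \<sqsubseteq> x\<close>, then
  \<open>h g\<^sup>\<dagger> s \<sqsubseteq> x\<close>.  It holds because a path of \<open>g\<close> that starts at \<open>s u\<close> is the image of a path of \<open>f\<close>
  that starts at \<open>u\<close>, and such paths are finite, so that one can induct on their length.  Putting
  \<open>s = id\<close> gives leastness, even after composition with \<open>h\<close>, hence naturality of the iterate in \<open>B\<close>;
  putting \<open>h = id\<close> gives \<open>f\<^sup>\<dagger> = g\<^sup>\<dagger> s\<close>, that is, uniformity for every \<open>s\<close>; and leastness gives the
  formula for iterating over \<open>U + V\<close> in two stages (\<open>iter_pairing\<close>).  With
  \<open>Tr f = [id, f\<^sub>U\<^sup>\<dagger>] f\<^sub>A\<close> for \<open>f = [f\<^sub>A, f\<^sub>U]\<close>, the axioms of a uniform trace follow by calculating with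
  copairs (locale \<open>iteration_trace\<close>).

  Evaluation at \<open>X\<close> sends \<open>(i, \<alpha> : A i \<rightarrow> X)\<close> to the value of the partial function at \<open>i\<close> together with
  \<open>\<alpha>\<close> composed with the label.  Thus it carries labelled paths to paths, and so it preserves iterates;
  a functor that preserves coproducts and iterates is a traced functor
  (locale \<open>iteration_functor\<close>).
\<close>

section \<open>Calculus of composites and copairs\<close>

context category
begin

lemma comp_Mor [simp]: "\<lbrakk>f \<in> Mor C; g \<in> Mor C; Dom C g = Cod C f\<rbrakk> \<Longrightarrow> g \<cdot> f \<in> Mor C"
  and Dom_comp [simp]: "\<lbrakk>f \<in> Mor C; g \<in> Mor C; Dom C g = Cod C f\<rbrakk> \<Longrightarrow> Dom C (g \<cdot> f) = Dom C f"
  and Cod_comp [simp]: "\<lbrakk>f \<in> Mor C; g \<in> Mor C; Dom C g = Cod C f\<rbrakk> \<Longrightarrow> Cod C (g \<cdot> f) = Cod C g"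
  using comp_hom[of f "Dom C f" "Cod C f" g "Cod C g"] by (auto simp: Hom_def)

lemma assoc [simp]:
  "\<lbrakk>f \<in> Mor C; g \<in> Mor C; h \<in> Mor C; Dom C g = Cod C f; Dom C h = Cod C g\<rbrakk>
    \<Longrightarrow> (h \<cdot> g) \<cdot> f = h \<cdot> (g \<cdot> f)"
  using comp_assoc[of f "Dom C f" "Cod C f" g "Cod C g" h "Cod C h"] by (auto simp: Hom_def)

lemma Id_Mor [simp]: "A \<in> Obj C \<Longrightarrow> Id C A \<in> Mor C"
  and Dom_Id [simp]: "A \<in> Obj C \<Longrightarrow> Dom C (Id C A) = A"
  and Cod_Id [simp]: "A \<in> Obj C \<Longrightarrow> Cod C (Id C A) = A"
  using id_hom[of A] by (auto simp: Hom_def)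

lemma Id_right [simp]: "\<lbrakk>f \<in> Mor C; Dom C f = A\<rbrakk> \<Longrightarrow> f \<cdot> Id C A = f"
  and Id_left [simp]: "\<lbrakk>f \<in> Mor C; Cod C f = A\<rbrakk> \<Longrightarrow> Id C A \<cdot> f = f"
  using comp_id_right comp_id_left by (auto simp: Hom_def)

lemma Hom_Obj: "f \<in> Hom C A B \<Longrightarrow> A \<in> Obj C \<and> B \<in> Obj C"
  using dom_obj cod_obj by (auto simp: Hom_def)

lemma inv_mor_eq:
  assumes "inverse_pair C f g"
  shows "inv_mor C f = g"
  unfolding inv_mor_def
proof (rule the_equality)
  fix g' assume g': "inverse_pair C f g'"
  have "g' = g' \<cdot> (f \<cdot> g)"
    using assms g' by (auto simp: inverse_pair_def Hom_def)
  also have "\<dots> = (g' \<cdot> f) \<cdot> g"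
    using assms g' by (subst assoc) (auto simp: inverse_pair_def Hom_def)
  also have "\<dots> = g"
    using assms g' by (auto simp: inverse_pair_def Hom_def)
  finally show "g' = g" .
qed (fact assms)

lemma iso_inv_mor: "iso C f \<Longrightarrow> inverse_pair C f (inv_mor C f)"
  using inv_mor_eq by (metis iso_def)

end

text \<open>The rewrite rules below bring composites of copairs and injections into a normal form: composites
  are associated to the right and copairs are moved outwards, so that an equation between maps out
  of an iterated coproduct is decided summand by summand.\<close>

context has_coproducts
begin

abbreviation copairing :: "'m \<Rightarrow> 'm \<Rightarrow> 'm"  (\<open>\<langle>_, _\<rangle>\<close>)
  where "\<langle>f, g\<rangle> \<equiv> copair C K f g"

declare dom_obj [simp] cod_obj [simp] zero_obj [simp] sum_obj [simp]

lemma Inj1_Mor [simp]: "\<lbrakk>A \<in> Obj C; B \<in> Obj C\<rbrakk> \<Longrightarrow> Inj1 K A B \<in> Mor C"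
  and Dom_Inj1 [simp]: "\<lbrakk>A \<in> Obj C; B \<in> Obj C\<rbrakk> \<Longrightarrow> Dom C (Inj1 K A B) = A"
  and Cod_Inj1 [simp]: "\<lbrakk>A \<in> Obj C; B \<in> Obj C\<rbrakk> \<Longrightarrow> Cod C (Inj1 K A B) = Sum K A B"
  using inj1_hom[of A B] by (auto simp: Hom_def)

lemma Inj2_Mor [simp]: "\<lbrakk>A \<in> Obj C; B \<in> Obj C\<rbrakk> \<Longrightarrow> Inj2 K A B \<in> Mor C"
  and Dom_Inj2 [simp]: "\<lbrakk>A \<in> Obj C; B \<in> Obj C\<rbrakk> \<Longrightarrow> Dom C (Inj2 K A B) = B"
  and Cod_Inj2 [simp]: "\<lbrakk>A \<in> Obj C; B \<in> Obj C\<rbrakk> \<Longrightarrow> Cod C (Inj2 K A B) = Sum K A B"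
  using inj2_hom[of A B] by (auto simp: Hom_def)

lemma copair_universal:
  assumes "f \<in> Mor C" "g \<in> Mor C" "Cod C f = Cod C g"
  shows "\<langle>f, g\<rangle> \<in> Hom C (Sum K (Dom C f) (Dom C g)) (Cod C f)
    \<and> \<langle>f, g\<rangle> \<cdot> Inj1 K (Dom C f) (Dom C g) = f \<and> \<langle>f, g\<rangle> \<cdot> Inj2 K (Dom C f) (Dom C g) = g"
  unfolding copair_def
  by (rule theI', rule sum_universal) (use assms in \<open>auto simp: Hom_def\<close>)

lemma copair_Mor [simp]:
    "\<lbrakk>f \<in> Mor C; g \<in> Mor C; Cod C f = Cod C g\<rbrakk> \<Longrightarrow> \<langle>f, g\<rangle> \<in> Mor C"
  and Dom_copair [simp]: "\<lbrakk>f \<in> Mor C; g \<in> Mor C; Cod C f = Cod C g\<rbrakk>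
    \<Longrightarrow> Dom C \<langle>f, g\<rangle> = Sum K (Dom C f) (Dom C g)"
  and Cod_copair [simp]: "\<lbrakk>f \<in> Mor C; g \<in> Mor C; Cod C f = Cod C g\<rbrakk>
    \<Longrightarrow> Cod C \<langle>f, g\<rangle> = Cod C g"
  using copair_universal[of f g] by (auto simp: Hom_def)

lemma copair_hom:
  "\<lbrakk>f \<in> Hom C A X; g \<in> Hom C B X\<rbrakk> \<Longrightarrow> \<langle>f, g\<rangle> \<in> Hom C (Sum K A B) X"
  by (auto simp: Hom_def)

lemma copair_Inj1 [simp]:
    "\<lbrakk>f \<in> Mor C; g \<in> Mor C; Cod C f = Cod C g; Dom C f = A; Dom C g = B\<rbrakk>
      \<Longrightarrow> \<langle>f, g\<rangle> \<cdot> Inj1 K A B = f"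
  and copair_Inj2 [simp]:
    "\<lbrakk>f \<in> Mor C; g \<in> Mor C; Cod C f = Cod C g; Dom C f = A; Dom C g = B\<rbrakk>
      \<Longrightarrow> \<langle>f, g\<rangle> \<cdot> Inj2 K A B = g"
  using copair_universal[of f g] by (auto simp: Hom_def)

lemma copair_Inj1_comp [simp]:
    "\<lbrakk>f \<in> Mor C; g \<in> Mor C; Cod C f = Cod C g; Dom C f = A; Dom C g = B; h \<in> Mor C; Cod C h = A\<rbrakk>
      \<Longrightarrow> \<langle>f, g\<rangle> \<cdot> (Inj1 K A B \<cdot> h) = f \<cdot> h"
  and copair_Inj2_comp [simp]:
    "\<lbrakk>f \<in> Mor C; g \<in> Mor C; Cod C f = Cod C g; Dom C f = A; Dom C g = B; h \<in> Mor C; Cod C h = B\<rbrakk>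
      \<Longrightarrow> \<langle>f, g\<rangle> \<cdot> (Inj2 K A B \<cdot> h) = g \<cdot> h"
proof -
  assume *: "f \<in> Mor C" "g \<in> Mor C" "Cod C f = Cod C g" "Dom C f = A" "Dom C g = B" "h \<in> Mor C"
  then have "A \<in> Obj C" "B \<in> Obj C"
    using dom_obj by auto
  then show "Cod C h = A \<Longrightarrow> \<langle>f, g\<rangle> \<cdot> (Inj1 K A B \<cdot> h) = f \<cdot> h"
    and "Cod C h = B \<Longrightarrow> \<langle>f, g\<rangle> \<cdot> (Inj2 K A B \<cdot> h) = g \<cdot> h"
    using * by (simp_all del: assoc flip: assoc)
qed

lemma coproduct_ext:
  assumes "f \<in> Mor C" "g \<in> Mor C" "Dom C f = Sum K A B" "Dom C g = Sum K A B" "Cod C f = Cod C g"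
    and "A \<in> Obj C" "B \<in> Obj C"
    and "f \<cdot> Inj1 K A B = g \<cdot> Inj1 K A B" "f \<cdot> Inj2 K A B = g \<cdot> Inj2 K A B"
  shows "f = g"
proof -
  have "\<exists>!h. h \<in> Hom C (Sum K A B) (Cod C g)
      \<and> h \<cdot> Inj1 K A B = g \<cdot> Inj1 K A B \<and> h \<cdot> Inj2 K A B = g \<cdot> Inj2 K A B"
    using assms by (intro sum_universal) (auto simp: Hom_def)
  then show ?thesis
    using assms by (auto simp: Hom_def)
qed

lemma comp_copair [simp]:
  assumes "f \<in> Mor C" "g \<in> Mor C" "h \<in> Mor C" "Cod C f = Cod C g" "Dom C h = Cod C g"
  shows "h \<cdot> \<langle>f, g\<rangle> = \<langle>h \<cdot> f, h \<cdot> g\<rangle>"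
  by (rule coproduct_ext[where A = "Dom C f" and B = "Dom C g"]) (use assms in auto)

lemma copair_injections [simp]:
  "\<lbrakk>A \<in> Obj C; B \<in> Obj C\<rbrakk> \<Longrightarrow> \<langle>Inj1 K A B, Inj2 K A B\<rangle> = Id C (Sum K A B)"
  by (rule coproduct_ext[where A = A and B = B]) auto

lemma copair_comp_injections [simp]:
  assumes "f \<in> Mor C" "Dom C f = Sum K A B" "A \<in> Obj C" "B \<in> Obj C"
  shows "\<langle>f \<cdot> Inj1 K A B, f \<cdot> Inj2 K A B\<rangle> = f"
  by (rule coproduct_ext[where A = A and B = B]) (use assms in auto)

lemma initial_map_hom: "A \<in> Obj C \<Longrightarrow> initial_map C K A \<in> Hom C (Zero K) A"
  unfolding initial_map_def by (rule theI', rule zero_initial)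

lemma initial_map_Mor [simp]: "A \<in> Obj C \<Longrightarrow> initial_map C K A \<in> Mor C"
  and Dom_initial_map [simp]: "A \<in> Obj C \<Longrightarrow> Dom C (initial_map C K A) = Zero K"
  and Cod_initial_map [simp]: "A \<in> Obj C \<Longrightarrow> Cod C (initial_map C K A) = A"
  using initial_map_hom[of A] by (auto simp: Hom_def)

lemma initial_ext:
  assumes "f \<in> Mor C" "g \<in> Mor C" "Dom C f = Zero K" "Dom C g = Zero K" "Cod C f = Cod C g"
  shows "f = g"
  using assms zero_initial[of "Cod C g"] cod_obj[of g] by (auto simp: Hom_def)

lemma initial_map_unique: "\<lbrakk>f \<in> Mor C; Dom C f = Zero K; Cod C f = A\<rbrakk> \<Longrightarrow> f = initial_map C K A"
  by (rule initial_ext) (auto dest: cod_obj)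

lemma comp_initial_map [simp]:
  "\<lbrakk>f \<in> Mor C; Dom C f = A\<rbrakk> \<Longrightarrow> f \<cdot> initial_map C K A = initial_map C K (Cod C f)"
  by (rule initial_map_unique) auto

end


section \<open>The cocartesian monoidal structure\<close>

lemma cocartesian_simps [simp]:
  "Obj (cocartesian C K) = Obj C" "Mor (cocartesian C K) = Mor C" "Dom (cocartesian C K) = Dom C"
  "Cod (cocartesian C K) = Cod C" "Id (cocartesian C K) = Id C" "Comp (cocartesian C K) = Comp C"
  "TUnit (cocartesian C K) = Zero K" "TOb (cocartesian C K) = Sum K"
  "Hom (cocartesian C K) = Hom C" "inv_mor (cocartesian C K) = inv_mor C"
  "inverse_pair (cocartesian C K) = inverse_pair C"
  "iso (cocartesian C K) = iso C"
  by (auto simp: cocartesian_def fun_eq_iff Hom_def inv_mor_def inverse_pair_def iso_def)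

locale cocartesian_category = has_coproducts C K
  for C :: "('o, 'm) category" (structure) and K :: "('o, 'm) coproducts"
begin

abbreviation "M \<equiv> cocartesian C K"

lemma tensor_eq: "TMor M f g = \<langle>Inj1 K (Cod C f) (Cod C g) \<cdot> f, Inj2 K (Cod C f) (Cod C g) \<cdot> g\<rangle>"
  by (simp add: cocartesian_def)

lemma assoc_eq: "Assoc M A B E = \<langle>\<langle>Inj1 K A (Sum K B E), Inj2 K A (Sum K B E) \<cdot> Inj1 K B E\<rangle>,
      Inj2 K A (Sum K B E) \<cdot> Inj2 K B E\<rangle>"
  by (simp add: cocartesian_def)

lemma lunit_eq: "LUnit M A = \<langle>initial_map C K A, Id C A\<rangle>"
  by (simp add: cocartesian_def)

lemma runit_eq: "RUnit M A = \<langle>Id C A, initial_map C K A\<rangle>"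
  by (simp add: cocartesian_def)

lemma braid_eq: "Braid M A B = \<langle>Inj2 K B A, Inj1 K B A\<rangle>"
  by (simp add: cocartesian_def)

lemmas monoidal_eqs = tensor_eq assoc_eq lunit_eq runit_eq braid_eq

lemma assoc_inverse:
  assumes "A \<in> Obj C" "B \<in> Obj C" "E \<in> Obj C"
  shows "inverse_pair C (Assoc M A B E)
    \<langle>Inj1 K (Sum K A B) E \<cdot> Inj1 K A B, \<langle>Inj1 K (Sum K A B) E \<cdot> Inj2 K A B, Inj2 K (Sum K A B) E\<rangle>\<rangle>"
  using assms by (auto simp: inverse_pair_def Hom_def assoc_eq)

lemma lunit_inverse:
  assumes "A \<in> Obj C"
  shows "inverse_pair C (LUnit M A) (Inj2 K (Zero K) A)"
proof -
  have "Inj2 K (Zero K) A \<cdot> LUnit M A = Id C (Sum K (Zero K) A)"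
    using assms initial_ext[of "initial_map C K (Sum K (Zero K) A)" "Inj1 K (Zero K) A"]
    by (simp add: lunit_eq)
  then show ?thesis
    using assms by (simp add: inverse_pair_def Hom_def lunit_eq)
qed

lemma runit_inverse:
  assumes "A \<in> Obj C"
  shows "inverse_pair C (RUnit M A) (Inj1 K A (Zero K))"
proof -
  have "Inj1 K A (Zero K) \<cdot> RUnit M A = Id C (Sum K A (Zero K))"
    using assms initial_ext[of "initial_map C K (Sum K A (Zero K))" "Inj2 K A (Zero K)"]
    by (simp add: runit_eq)
  then show ?thesis
    using assms by (simp add: inverse_pair_def Hom_def runit_eq)
qed

lemma category_M: "category M"
  using category_axioms unfolding category_def by simp

text \<open>Every axiom equates two maps out of an iterated coproduct, and both sides have the same normal
  form; only invertibility of the structure maps needs explicit inverses.\<close>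

lemma symmetric_monoidal_M: "symmetric_monoidal M"
proof -
  interpret M: category M
    by (rule category_M)
  show ?thesis
    apply unfold_locales
    subgoal by simp
    subgoal by simp
    subgoal by (auto simp: Hom_def tensor_eq)
    subgoal by (auto simp: tensor_eq)
    subgoal by (auto simp: Hom_def tensor_eq)
    subgoal by (auto simp: Hom_def assoc_eq)
    subgoal using assoc_inverse by (auto simp: iso_def)
    subgoal by (auto simp: Hom_def monoidal_eqs)
    subgoal by (auto simp: Hom_def monoidal_eqs)
    subgoal using lunit_inverse by (auto simp: iso_def)
    subgoal by (auto simp: Hom_def monoidal_eqs)
    subgoal by (auto simp: Hom_def monoidal_eqs)
    subgoal using runit_inverse by (auto simp: iso_def)
    by (auto simp: Hom_def monoidal_eqs)
qed

end

section \<open>Traces from least iterates\<close>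

text \<open>The order is only required to make sense on parallel morphisms.  The induction principle
  \<open>iter_induct\<close> says that \<open>h g\<^sup>\<dagger> s\<close> lies below every \<open>x\<close> that is a prefixed point for
  \<open>f\<close>, whenever \<open>s\<close> intertwines \<open>f\<close> with \<open>g\<close>.  Leastness of the iterate alone would yield
  neither uniformity nor naturality, since nothing says that composition with \<open>s\<close> or \<open>h\<close> preserves
  least prefixed points; the two parameters supply exactly this.\<close>

locale iteration_category = cocartesian_category C K
  for C :: "('o, 'm) category" (structure) and K :: "('o, 'm) coproducts" +
  fixes le :: "'m \<Rightarrow> 'm \<Rightarrow> bool"  (infix \<open>\<sqsubseteq>\<close> 50)
    and iter :: "'m \<Rightarrow> 'm"  (\<open>(_\<^sup>\<dagger>)\<close> [1000] 999)
  assumes le_refl: "f \<in> Mor C \<Longrightarrow> f \<sqsubseteq> f"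
    and le_trans: "\<lbrakk>f \<sqsubseteq> g; g \<sqsubseteq> h; f \<in> Hom C A B; g \<in> Hom C A B; h \<in> Hom C A B\<rbrakk> \<Longrightarrow> f \<sqsubseteq> h"
    and le_antisym: "\<lbrakk>f \<sqsubseteq> g; g \<sqsubseteq> f; f \<in> Hom C A B; g \<in> Hom C A B\<rbrakk> \<Longrightarrow> f = g"
    and copair_mono: "\<lbrakk>x \<sqsubseteq> y; x \<in> Hom C B X; y \<in> Hom C B X; h \<in> Hom C A X; k \<in> Hom C E (Sum K A B)\<rbrakk>
      \<Longrightarrow> \<langle>h, x\<rangle> \<cdot> k \<sqsubseteq> \<langle>h, y\<rangle> \<cdot> k"
    and copair_le: "\<lbrakk>f \<sqsubseteq> f'; g \<sqsubseteq> g'; f \<in> Hom C A X; f' \<in> Hom C A X; g \<in> Hom C B X; g' \<in> Hom C B X\<rbrakk>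
      \<Longrightarrow> \<langle>f, g\<rangle> \<sqsubseteq> \<langle>f', g'\<rangle>"
    and iter_hom: "\<lbrakk>f \<in> Hom C U (Sum K B U); B \<in> Obj C; U \<in> Obj C\<rbrakk> \<Longrightarrow> f\<^sup>\<dagger> \<in> Hom C U B"
    and iter_fixpoint: "\<lbrakk>f \<in> Hom C U (Sum K B U); B \<in> Obj C; U \<in> Obj C\<rbrakk>
      \<Longrightarrow> \<langle>Id C B, f\<^sup>\<dagger>\<rangle> \<cdot> f = f\<^sup>\<dagger>"
    and iter_induct: "\<lbrakk>f \<in> Hom C U (Sum K B U); g \<in> Hom C V (Sum K B V); s \<in> Hom C U V;
        h \<in> Hom C B X; x \<in> Hom C U X; TMor M (Id C B) s \<cdot> f = g \<cdot> s; \<langle>h, x\<rangle> \<cdot> f \<sqsubseteq> x\<rbrakk>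
      \<Longrightarrow> h \<cdot> (g\<^sup>\<dagger> \<cdot> s) \<sqsubseteq> x"
begin

lemma iter_Mor [simp]:
    "\<lbrakk>f \<in> Mor C; Dom C f = U; Cod C f = Sum K B U; B \<in> Obj C\<rbrakk> \<Longrightarrow> f\<^sup>\<dagger> \<in> Mor C"
  using iter_hom[of f U B] dom_obj[of f] by (auto simp: Hom_def)

lemma iter_least:
  assumes f: "f \<in> Hom C U (Sum K B U)" and h: "h \<in> Hom C B X" and x: "x \<in> Hom C U X"
    and le: "\<langle>h, x\<rangle> \<cdot> f \<sqsubseteq> x"
  shows "h \<cdot> f\<^sup>\<dagger> \<sqsubseteq> x"
proof -
  note B = Hom_Obj[OF h] and U = Hom_Obj[OF f]
  have "h \<cdot> (f\<^sup>\<dagger> \<cdot> Id C U) \<sqsubseteq> x"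
    by (rule iter_induct[OF f f _ h x _ le]) (use B U f in \<open>auto simp: tensor_eq Hom_def\<close>)
  then show ?thesis
    using iter_hom[OF f] B U by (simp add: Hom_def)
qed

text \<open>The two inequalities are leastness of the two iterates: \<open>h f\<^sup>\<dagger>\<close> is a fixed point for the
  composite with \<open>h + U\<close>, and the iterate of that composite is a fixed point for \<open>x \<mapsto> [h, x] f\<close>.\<close>

lemma iter_natural:
  assumes f: "f \<in> Hom C U (Sum K B U)" and h: "h \<in> Hom C B X"
  shows "(TMor M h (Id C U) \<cdot> f)\<^sup>\<dagger> = h \<cdot> f\<^sup>\<dagger>"
proof (rule le_antisym)
  note B = Hom_Obj[OF h] and U = Hom_Obj[OF f]
  let ?f = "TMor M h (Id C U) \<cdot> f"
  have hf: "?f \<in> Hom C U (Sum K X U)" "f\<^sup>\<dagger> \<in> Hom C U B"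
    using f h B U iter_hom[OF f] by (auto simp: Hom_def tensor_eq)
  then show *: "h \<cdot> f\<^sup>\<dagger> \<in> Hom C U X" "?f\<^sup>\<dagger> \<in> Hom C U X"
    using h B U iter_hom[of ?f U X] by (auto simp: Hom_def)
  have "\<langle>Id C X, h \<cdot> f\<^sup>\<dagger>\<rangle> \<cdot> ?f = \<langle>h, h \<cdot> f\<^sup>\<dagger>\<rangle> \<cdot> f"
    using f h B U hf by (simp add: Hom_def tensor_eq flip: assoc)
  also have "\<dots> = h \<cdot> (\<langle>Id C B, f\<^sup>\<dagger>\<rangle> \<cdot> f)"
    using f h B U hf by (simp add: Hom_def flip: assoc)
  also have "\<dots> = h \<cdot> f\<^sup>\<dagger>"
    using f B U by (simp add: iter_fixpoint)
  finally show "?f\<^sup>\<dagger> \<sqsubseteq> h \<cdot> f\<^sup>\<dagger>"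
    using iter_least[of ?f U X "Id C X" X "h \<cdot> f\<^sup>\<dagger>"] hf * B U by (simp add: Hom_def le_refl)
  have "\<langle>h, ?f\<^sup>\<dagger>\<rangle> \<cdot> f = \<langle>Id C X, ?f\<^sup>\<dagger>\<rangle> \<cdot> ?f"
    using f h B U hf * by (simp add: Hom_def tensor_eq flip: assoc)
  also have "\<dots> = ?f\<^sup>\<dagger>"
    using hf B U by (simp add: iter_fixpoint)
  finally show "h \<cdot> f\<^sup>\<dagger> \<sqsubseteq> ?f\<^sup>\<dagger>"
    using iter_least[OF f h] * by (simp add: Hom_def le_refl)
qed

text \<open>The inequality \<open>f\<^sup>\<dagger> \<sqsubseteq> g\<^sup>\<dagger> s\<close> holds because the right-hand side is a fixed point for \<open>f\<close>; the
  other one is the induction principle with \<open>x = f\<^sup>\<dagger>\<close>.\<close>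

lemma iter_uniform:
  assumes f: "f \<in> Hom C U (Sum K B U)" and g: "g \<in> Hom C V (Sum K B V)" and s: "s \<in> Hom C U V"
    and B: "B \<in> Obj C" and sq: "TMor M (Id C B) s \<cdot> f = g \<cdot> s"
  shows "f\<^sup>\<dagger> = g\<^sup>\<dagger> \<cdot> s"
proof (rule le_antisym)
  note UV = Hom_Obj[OF s]
  have f': "f\<^sup>\<dagger> \<in> Hom C U B" and g': "g\<^sup>\<dagger> \<in> Hom C V B"
    using iter_hom f g B UV by auto
  show *: "f\<^sup>\<dagger> \<in> Hom C U B" "g\<^sup>\<dagger> \<cdot> s \<in> Hom C U B"
    using f' g' s by (auto simp: Hom_def)
  have "\<langle>Id C B, g\<^sup>\<dagger> \<cdot> s\<rangle> \<cdot> f = \<langle>Id C B, g\<^sup>\<dagger>\<rangle> \<cdot> (TMor M (Id C B) s \<cdot> f)"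
    using f g s B UV f' g' by (simp add: Hom_def tensor_eq flip: assoc)
  also have "\<dots> = (\<langle>Id C B, g\<^sup>\<dagger>\<rangle> \<cdot> g) \<cdot> s"
    unfolding sq using f g s B UV f' g' by (simp add: Hom_def)
  also have "\<dots> = g\<^sup>\<dagger> \<cdot> s"
    using g B UV by (simp add: iter_fixpoint)
  finally show "f\<^sup>\<dagger> \<sqsubseteq> g\<^sup>\<dagger> \<cdot> s"
    using iter_least[of f U B "Id C B" B "g\<^sup>\<dagger> \<cdot> s"] f f' * B by (simp add: Hom_def le_refl)
  show "g\<^sup>\<dagger> \<cdot> s \<sqsubseteq> f\<^sup>\<dagger>"
    using iter_induct[OF f g s id_hom[OF B] f' sq] f g s B UV f' g'
    by (simp add: iter_fixpoint Hom_def le_refl)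
qed

text \<open>The identity of Bekic.  The pair on the right solves the joint fixed-point equation, so it lies
  above the joint iterate.  Conversely, let \<open>(y1, y2)\<close> be the joint iterate.  Leastness of \<open>w\<^sup>\<dagger>\<close> gives
  \<open>[id, y1] w\<^sup>\<dagger> \<sqsubseteq> y2\<close>; therefore \<open>y1\<close> is a prefixed point for \<open>g\<close>, so \<open>g\<^sup>\<dagger> \<sqsubseteq> y1\<close>, and the second
  component follows by monotonicity.\<close>

lemma iter_pairing:
  assumes B: "B \<in> Obj C" and V: "V \<in> Obj C"
    and f: "f \<in> Hom C U (Sum K (Sum K B U) V)" and w: "w \<in> Hom C V (Sum K (Sum K B U) V)"
  defines "\<alpha> \<equiv> Assoc M B U V"
    and "g \<equiv> \<langle>Id C (Sum K B U), w\<^sup>\<dagger>\<rangle> \<cdot> f"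
  shows "(\<alpha> \<cdot> \<langle>f, w\<rangle>)\<^sup>\<dagger> = \<langle>g\<^sup>\<dagger>, \<langle>Id C B, g\<^sup>\<dagger>\<rangle> \<cdot> w\<^sup>\<dagger>\<rangle>"
proof -
  let ?F = "\<alpha> \<cdot> \<langle>f, w\<rangle>" and ?x = "\<langle>g\<^sup>\<dagger>, \<langle>Id C B, g\<^sup>\<dagger>\<rangle> \<cdot> w\<^sup>\<dagger>\<rangle>"
  have U: "U \<in> Obj C"
    using Hom_Obj[OF f] by simp
  note obj = B U V
  have w': "w\<^sup>\<dagger> \<in> Hom C V (Sum K B U)"
    using iter_hom[OF w] obj by simp
  have g: "g \<in> Hom C U (Sum K B U)"
    using f w' obj by (simp add: g_def Hom_def)
  have g': "g\<^sup>\<dagger> \<in> Hom C U B"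
    using iter_hom[OF g] obj by simp
  have F: "?F \<in> Hom C (Sum K U V) (Sum K B (Sum K U V))"
    using obj f w by (simp add: \<alpha>_def assoc_eq Hom_def)
  have F': "?F\<^sup>\<dagger> \<in> Hom C (Sum K U V) B"
    using iter_hom[OF F] obj by simp
  have x: "?x \<in> Hom C (Sum K U V) B"
    using obj w' g' by (simp add: Hom_def)
  define y1 y2 where "y1 = ?F\<^sup>\<dagger> \<cdot> Inj1 K U V" and "y2 = ?F\<^sup>\<dagger> \<cdot> Inj2 K U V"
  have y: "y1 \<in> Hom C U B" "y2 \<in> Hom C V B" "?F\<^sup>\<dagger> = \<langle>y1, y2\<rangle>"
    using F' obj by (auto simp: y1_def y2_def Hom_def)
  have fold_F: "\<langle>Id C B, \<langle>a, b\<rangle>\<rangle> \<cdot> ?F = \<langle>\<langle>\<langle>Id C B, a\<rangle>, b\<rangle> \<cdot> f, \<langle>\<langle>Id C B, a\<rangle>, b\<rangle> \<cdot> w\<rangle>"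
    if "a \<in> Hom C U B" "b \<in> Hom C V B" for a b
    using that f w obj by (simp add: \<alpha>_def assoc_eq Hom_def flip: assoc)
  have absorb: "\<langle>\<langle>Id C B, z\<rangle>, \<langle>Id C B, z\<rangle> \<cdot> w\<^sup>\<dagger>\<rangle> \<cdot> k
      = \<langle>Id C B, z\<rangle> \<cdot> (\<langle>Id C (Sum K B U), w\<^sup>\<dagger>\<rangle> \<cdot> k)"
    if "z \<in> Hom C U B" "k \<in> Hom C E (Sum K (Sum K B U) V)" for z k E
    using that obj w' by (simp add: Hom_def flip: assoc)
  have "\<langle>Id C B, ?x\<rangle> \<cdot> ?F = ?x"
    using obj g' w' f w g absorb[OF g' f] absorb[OF g' w]
      iter_fixpoint[OF g B U] iter_fixpoint[OF w _ V]
    by (subst fold_F) (simp_all add: Hom_def flip: g_def)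
  then have "?F\<^sup>\<dagger> \<sqsubseteq> ?x"
    using iter_least[OF F id_hom[OF B] x] F' x by (simp add: le_refl Hom_def)
  moreover have "?x \<sqsubseteq> ?F\<^sup>\<dagger>"
  proof -
    have y_fix: "\<langle>\<langle>Id C B, y1\<rangle>, y2\<rangle> \<cdot> f = y1" "\<langle>\<langle>Id C B, y1\<rangle>, y2\<rangle> \<cdot> w = y2"
    proof -
      have "\<langle>\<langle>\<langle>Id C B, y1\<rangle>, y2\<rangle> \<cdot> f, \<langle>\<langle>Id C B, y1\<rangle>, y2\<rangle> \<cdot> w\<rangle> = \<langle>y1, y2\<rangle>" (is "?a = ?b")
        using fold_F[OF y(1,2)] iter_fixpoint[OF F B] obj y(3) by simp
      then have "?a \<cdot> Inj1 K U V = ?b \<cdot> Inj1 K U V" "?a \<cdot> Inj2 K U V = ?b \<cdot> Inj2 K U V"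
        by simp_all
      then show "\<langle>\<langle>Id C B, y1\<rangle>, y2\<rangle> \<cdot> f = y1" "\<langle>\<langle>Id C B, y1\<rangle>, y2\<rangle> \<cdot> w = y2"
        using obj f w y(1,2) by (simp_all add: Hom_def)
    qed
    let ?y = "\<langle>Id C B, y1\<rangle>" and ?z = "\<langle>Id C B, g\<^sup>\<dagger>\<rangle>"
    have y_hom: "?y \<in> Hom C (Sum K B U) B" "?z \<in> Hom C (Sum K B U) B"
      using obj y g' by (simp_all add: Hom_def)
    have 1: "?y \<cdot> w\<^sup>\<dagger> \<sqsubseteq> y2"
      using iter_least[OF w y_hom(1) y(2)] y(2) y_fix(2) by (simp add: le_refl Hom_def)
    have yw: "?y \<cdot> w\<^sup>\<dagger> \<in> Hom C V B" "?z \<cdot> w\<^sup>\<dagger> \<in> Hom C V B"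
      using y_hom w' by (simp_all add: Hom_def)
    have "\<langle>Id C B, y1\<rangle> \<cdot> g = \<langle>?y, ?y \<cdot> w\<^sup>\<dagger>\<rangle> \<cdot> f"
      using absorb[OF y(1) f] by (simp add: g_def)
    also have "\<dots> \<sqsubseteq> y1"
      using copair_mono[OF 1 yw(1) y(2) y_hom(1) f] y_fix(1) by simp
    finally have 2: "g\<^sup>\<dagger> \<sqsubseteq> y1"
      using iter_least[OF g id_hom[OF B] y(1)] g' by (simp add: Hom_def)
    have "?z \<cdot> w\<^sup>\<dagger> \<sqsubseteq> ?y \<cdot> w\<^sup>\<dagger>"
      using copair_mono[OF 2 g' y(1) id_hom[OF B] w'] by simp
    then have "?z \<cdot> w\<^sup>\<dagger> \<sqsubseteq> y2"
      using le_trans[OF _ 1 yw(2) yw(1) y(2)] by simp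
    then show ?thesis
      unfolding y(3) using 2 copair_le g' y(1,2) yw by blast
  qed
  ultimately show ?thesis
    using le_antisym F' x by blast
qed

end

text \<open>The trace is a parameter, determined only on well-typed arguments, so that the trace of partial
  functions, which is defined by another formula, is an instance.\<close>

locale iteration_trace = iteration_category C K le iter
  for C :: "('o, 'm) category" (structure) and K :: "('o, 'm) coproducts"
    and le :: "'m \<Rightarrow> 'm \<Rightarrow> bool"  (infix \<open>\<sqsubseteq>\<close> 50) and iter :: "'m \<Rightarrow> 'm"  (\<open>(_\<^sup>\<dagger>)\<close> [1000] 999) +
  fixes Tr :: "'o \<Rightarrow> 'o \<Rightarrow> 'o \<Rightarrow> 'm \<Rightarrow> 'm"
  assumes trace_eq: "\<lbrakk>A \<in> Obj C; B \<in> Obj C; U \<in> Obj C; f \<in> Hom C (Sum K A U) (Sum K B U)\<rbrakk>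
    \<Longrightarrow> Tr A B U f = \<langle>Id C B, (f \<cdot> Inj2 K A U)\<^sup>\<dagger>\<rangle> \<cdot> (f \<cdot> Inj1 K A U)"
begin

lemma trace_hom:
  assumes "A \<in> Obj C" "B \<in> Obj C" "U \<in> Obj C" "f \<in> Hom C (Sum K A U) (Sum K B U)"
  shows "Tr A B U f \<in> Hom C A B"
  using assms iter_hom[of "f \<cdot> Inj2 K A U" U B] by (simp add: trace_eq Hom_def)

lemma trace_copair:
  assumes "A \<in> Obj C" "B \<in> Obj C" "U \<in> Obj C" "f \<in> Hom C A (Sum K B U)" "g \<in> Hom C U (Sum K B U)"
  shows "Tr A B U \<langle>f, g\<rangle> = \<langle>Id C B, g\<^sup>\<dagger>\<rangle> \<cdot> f"
  using assms by (simp add: trace_eq Hom_def)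

lemma split_sum:
  assumes "f \<in> Hom C (Sum K A U) X" "A \<in> Obj C" "U \<in> Obj C"
  obtains f1 f2 where "f1 \<in> Hom C A X" "f2 \<in> Hom C U X" "f = \<langle>f1, f2\<rangle>"
  using assms by (intro that[of "f \<cdot> Inj1 K A U" "f \<cdot> Inj2 K A U"]) (simp_all add: Hom_def)

lemma trace_natural:
  assumes U: "U \<in> Obj C" and f: "f \<in> Hom C A' A" and g: "g \<in> Hom C B B'"
    and k: "k \<in> Hom C (Sum K A U) (Sum K B U)"
  shows "Tr A' B' U (TMor M g (Id C U) \<cdot> k \<cdot> TMor M f (Id C U)) = g \<cdot> Tr A B U k \<cdot> f"
proof -
  note obj = U Hom_Obj[OF f] Hom_Obj[OF g]
  obtain k1 k2 where k12: "k1 \<in> Hom C A (Sum K B U)" "k2 \<in> Hom C U (Sum K B U)" "k = \<langle>k1, k2\<rangle>"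
    using split_sum[OF k] obj by blast
  let ?g = "TMor M g (Id C U)"
  have g': "?g \<in> Hom C (Sum K B U) (Sum K B' U)"
    using g obj by (simp add: tensor_eq Hom_def)
  have "?g \<cdot> k \<cdot> TMor M f (Id C U) = \<langle>?g \<cdot> k1 \<cdot> f, ?g \<cdot> k2\<rangle>"
    using obj f g' k12 by (simp add: tensor_eq[of f] Hom_def)
  moreover have "\<langle>Id C B', g \<cdot> k2\<^sup>\<dagger>\<rangle> \<cdot> ?g = g \<cdot> \<langle>Id C B, k2\<^sup>\<dagger>\<rangle>"
    using obj g k12 iter_hom[OF k12(2)] by (simp add: tensor_eq Hom_def)
  ultimately show ?thesis
    using obj f g g' k12 iter_hom[OF k12(2)] iter_natural[OF k12(2) g]
    by (simp add: trace_copair Hom_def del: comp_copair flip: assoc)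
qed

text \<open>Sliding \<open>h\<close> around the loop is uniformity along \<open>h\<close> itself, which intertwines \<open>k2 h\<close> with
  \<open>(B + h) k2\<close>.\<close>

lemma trace_dinatural:
  assumes A: "A \<in> Obj C" and B: "B \<in> Obj C" and h: "h \<in> Hom C U V"
    and k: "k \<in> Hom C (Sum K A V) (Sum K B U)"
  shows "Tr A B V (TMor M (Id C B) h \<cdot> k) = Tr A B U (k \<cdot> TMor M (Id C A) h)"
proof -
  note obj = A B Hom_Obj[OF h]
  obtain k1 k2 where k12: "k1 \<in> Hom C A (Sum K B U)" "k2 \<in> Hom C V (Sum K B U)" "k = \<langle>k1, k2\<rangle>"
    using split_sum[OF k] obj by blast
  let ?h = "TMor M (Id C B) h"
  have h': "?h \<in> Hom C (Sum K B U) (Sum K B V)"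
    using h obj by (simp add: tensor_eq Hom_def)
  have kh: "?h \<cdot> k2 \<in> Hom C V (Sum K B V)" "k2 \<cdot> h \<in> Hom C U (Sum K B U)"
    using h h' k12 by (simp_all add: Hom_def)
  note kh' = iter_hom[OF kh(1)] iter_hom[OF kh(2)]
  have unif: "(k2 \<cdot> h)\<^sup>\<dagger> = (?h \<cdot> k2)\<^sup>\<dagger> \<cdot> h"
    using kh h h' k12 by (intro iter_uniform[OF _ _ h B]) (simp_all add: Hom_def)
  have "k \<cdot> TMor M (Id C A) h = \<langle>k1, k2 \<cdot> h\<rangle>"
    using obj h k12 by (simp add: tensor_eq Hom_def)
  moreover have "?h \<cdot> k = \<langle>?h \<cdot> k1, ?h \<cdot> k2\<rangle>"
    using obj h' k12 by (simp add: Hom_def)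
  moreover have "\<langle>Id C B, (?h \<cdot> k2)\<^sup>\<dagger>\<rangle> \<cdot> ?h = \<langle>Id C B, (?h \<cdot> k2)\<^sup>\<dagger> \<cdot> h\<rangle>"
    using obj h kh' by (simp add: tensor_eq[of _ h] Hom_def)
  ultimately show ?thesis
    using obj h h' k12 kh kh' unif
    by (simp add: trace_copair Hom_def flip: assoc)
qed

text \<open>There is only one map out of the initial object, so the iterate is that map and the loop
  disappears.\<close>

lemma trace_unit:
  assumes A: "A \<in> Obj C" and B: "B \<in> Obj C" and f: "f \<in> Hom C (Sum K A (Zero K)) (Sum K B (Zero K))"
  shows "Tr A B (Zero K) f = RUnit M B \<cdot> f \<cdot> inv_mor M (RUnit M A)"
proof -
  have "(f \<cdot> Inj2 K A (Zero K))\<^sup>\<dagger> = initial_map C K B"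
    using A B f iter_hom[of "f \<cdot> Inj2 K A (Zero K)" "Zero K" B]
    by (intro initial_map_unique) (auto simp: Hom_def)
  then show ?thesis
    using A B f inv_mor_eq[OF runit_inverse[OF A]] by (simp add: trace_eq runit_eq Hom_def)
qed

text \<open>The summand \<open>A'\<close> never enters the loop.  On the others, adding \<open>B'\<close> to the codomain composes the
  loop with \<open>Inj2 + U\<close>, and naturality moves \<open>Inj2\<close> out of the iterate.\<close>

lemma superposing:
  assumes A: "A \<in> Obj C" and B: "B \<in> Obj C" and U: "U \<in> Obj C" and h: "h \<in> Hom C A' B'"
    and k: "k \<in> Hom C (Sum K A U) (Sum K B U)"
  shows "Tr (Sum K A' A) (Sum K B' B) U (inv_mor M (Assoc M B' B U) \<cdot> TMor M h k \<cdot> Assoc M A' A U)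
    = TMor M h (Tr A B U k)"
proof -
  note obj = A B U Hom_Obj[OF h]
  obtain k1 k2 where k12: "k1 \<in> Hom C A (Sum K B U)" "k2 \<in> Hom C U (Sum K B U)" "k = \<langle>k1, k2\<rangle>"
    using split_sum[OF k] obj by blast
  let ?j = "TMor M (Inj2 K B' B) (Id C U)"
  have j: "?j \<in> Hom C (Sum K B U) (Sum K (Sum K B' B) U)"
    using obj by (simp add: Hom_def tensor_eq)
  have "inv_mor M (Assoc M B' B U) \<cdot> TMor M h k \<cdot> Assoc M A' A U
      = \<langle>\<langle>Inj1 K (Sum K B' B) U \<cdot> (Inj1 K B' B \<cdot> h), ?j \<cdot> k1\<rangle>, ?j \<cdot> k2\<rangle>"
    using obj h k12 inv_mor_eq[OF assoc_inverse[of B' B U]]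
    by (simp add: tensor_eq assoc_eq Hom_def)
  moreover have "(?j \<cdot> k2)\<^sup>\<dagger> = Inj2 K B' B \<cdot> k2\<^sup>\<dagger>"
    using obj by (intro iter_natural[OF k12(2)]) (simp add: Hom_def)
  moreover have "\<langle>Id C (Sum K B' B), Inj2 K B' B \<cdot> k2\<^sup>\<dagger>\<rangle> \<cdot> (?j \<cdot> k1)
      = Inj2 K B' B \<cdot> (\<langle>Id C B, k2\<^sup>\<dagger>\<rangle> \<cdot> k1)"
    using obj k12 iter_hom[OF k12(2)] by (simp add: tensor_eq Hom_def flip: assoc)
  ultimately show ?thesis
    using obj h j k12 iter_hom[OF k12(2)] by (simp add: trace_copair tensor_eq[of h] Hom_def)
qed

text \<open>The loop component of the symmetry is the injection of the exit summand, so the loop is left at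
  once.\<close>

lemma yanking:
  assumes U: "U \<in> Obj C"
  shows "Tr U U U (Braid M U U) = Id C U"
proof -
  have i: "Inj1 K U U \<in> Hom C U (Sum K U U)"
    using U by (simp add: Hom_def)
  have "(Inj1 K U U)\<^sup>\<dagger> = Id C U"
    using iter_fixpoint[OF i U U] iter_hom[OF i U U] U by (simp add: Hom_def)
  then show ?thesis
    using U by (simp add: braid_eq trace_copair Hom_def)
qed

text \<open>Up to associativity, the loop over \<open>U + V\<close> is iterated as in \<open>iter_pairing\<close>: first over \<open>V\<close> with
  exits in \<open>B + U\<close>, then over \<open>U\<close>.\<close>

lemma trace_tensor:
  assumes A: "A \<in> Obj C" and B: "B \<in> Obj C" and U: "U \<in> Obj C" and V: "V \<in> Obj C"
    and f: "f \<in> Hom C (Sum K A (Sum K U V)) (Sum K B (Sum K U V))"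
  shows "Tr A B (Sum K U V) f
    = Tr A B U (Tr (Sum K A U) (Sum K B U) V (inv_mor M (Assoc M B U V) \<cdot> f \<cdot> Assoc M A U V))"
proof -
  note obj = A B U V
  let ?a = "Assoc M B U V" and ?b = "inv_mor C (Assoc M B U V)"
  have ab: "inverse_pair C ?a ?b"
    using inv_mor_eq[OF assoc_inverse[of B U V]] assoc_inverse[of B U V] obj by simp
  have a: "?a \<in> Hom C (Sum K (Sum K B U) V) (Sum K B (Sum K U V))"
    using obj by (simp add: assoc_eq Hom_def)
  then have b: "?b \<in> Hom C (Sum K B (Sum K U V)) (Sum K (Sum K B U) V)"
    using ab by (simp add: inverse_pair_def Hom_def)
  obtain f1 f2 where f12: "f1 \<in> Hom C A (Sum K B (Sum K U V))"
      "f2 \<in> Hom C (Sum K U V) (Sum K B (Sum K U V))" "f = \<langle>f1, f2\<rangle>"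
    using split_sum[OF f] obj by auto
  then obtain f3 f4 where f34: "f3 \<in> Hom C U (Sum K B (Sum K U V))"
      "f4 \<in> Hom C V (Sum K B (Sum K U V))" "f2 = \<langle>f3, f4\<rangle>"
    using split_sum[of f2 U V] obj by auto
  define k u w where kuw: "k = ?b \<cdot> f1" "u = ?b \<cdot> f3" "w = ?b \<cdot> f4"
  have k: "k \<in> Hom C A (Sum K (Sum K B U) V)" and u: "u \<in> Hom C U (Sum K (Sum K B U) V)"
    and w: "w \<in> Hom C V (Sum K (Sum K B U) V)"
    using b f12 f34 by (simp_all add: kuw Hom_def)
  have cancel: "?a \<cdot> (?b \<cdot> x) = x" if "x \<in> Hom C X (Sum K B (Sum K U V))" for x X
    using that a b ab by (simp add: inverse_pair_def Hom_def flip: assoc)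
  have f_eq: "f = \<langle>?a \<cdot> k, ?a \<cdot> \<langle>u, w\<rangle>\<rangle>"
    using u w a cancel[OF f12(1)] cancel[OF f34(1)] cancel[OF f34(2)]
    by (simp add: f12(3) f34(3) Hom_def flip: kuw)
  have b_eq: "?b \<cdot> f \<cdot> Assoc M A U V = \<langle>\<langle>k, u\<rangle>, w\<rangle>"
    using obj b f12 f34 by (simp add: kuw Hom_def assoc_eq[of A])
  define g where "g = \<langle>Id C (Sum K B U), w\<^sup>\<dagger>\<rangle> \<cdot> u"
  have w': "w\<^sup>\<dagger> \<in> Hom C V (Sum K B U)"
    using iter_hom[OF w] obj by simp
  have g: "g \<in> Hom C U (Sum K B U)"
    using obj u w' by (simp add: g_def Hom_def)
  have g': "g\<^sup>\<dagger> \<in> Hom C U B"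
    using iter_hom[OF g] obj by simp
  have "Tr A B U (Tr (Sum K A U) (Sum K B U) V (?b \<cdot> f \<cdot> Assoc M A U V))
      = \<langle>Id C B, g\<^sup>\<dagger>\<rangle> \<cdot> (\<langle>Id C (Sum K B U), w\<^sup>\<dagger>\<rangle> \<cdot> k)"
    unfolding b_eq using obj k u w w' g
    by (simp add: trace_copair Hom_def flip: g_def)
  also have "\<dots> = \<langle>Id C B, \<langle>g\<^sup>\<dagger>, \<langle>Id C B, g\<^sup>\<dagger>\<rangle> \<cdot> w\<^sup>\<dagger>\<rangle>\<rangle> \<cdot> (?a \<cdot> k)"
    using obj k w' g' by (simp add: assoc_eq Hom_def flip: assoc)
  also have "\<dots> = Tr A B (Sum K U V) f"
    unfolding f_eq using obj k u w a iter_pairing[OF B V u w]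
    by (simp add: trace_copair Hom_def g_def del: comp_copair)
  finally show ?thesis
    unfolding cocartesian_simps by (rule sym)
qed

text \<open>Restricted to the loop summand, the hypothesis on \<open>s\<close> is the square of \<open>iter_uniform\<close>; restricted to
  the other summand, it relates the entries into the two loops.\<close>

lemma strict_morphism:
  assumes s: "s \<in> Mor C"
  shows "strict_morphism M Tr s"
  unfolding strict_morphism_def Let_def cocartesian_simps
proof (intro ballI impI)
  let ?U = "Dom C s" and ?V = "Cod C s"
  fix A B f g
  assume A: "A \<in> Obj C" and B: "B \<in> Obj C"
    and f: "f \<in> Hom C (Sum K A ?U) (Sum K B ?U)" and g: "g \<in> Hom C (Sum K A ?V) (Sum K B ?V)"
    and sq: "TMor M (Id C B) s \<cdot> f = g \<cdot> TMor M (Id C A) s"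
  have obj: "A \<in> Obj C" "B \<in> Obj C" "?U \<in> Obj C" "?V \<in> Obj C"
    using A B s by auto
  obtain f1 f2 where f12: "f1 \<in> Hom C A (Sum K B ?U)" "f2 \<in> Hom C ?U (Sum K B ?U)" "f = \<langle>f1, f2\<rangle>"
    using split_sum[OF f] obj by blast
  obtain g1 g2 where g12: "g1 \<in> Hom C A (Sum K B ?V)" "g2 \<in> Hom C ?V (Sum K B ?V)" "g = \<langle>g1, g2\<rangle>"
    using split_sum[OF g] obj by blast
  let ?s = "TMor M (Id C B) s"
  have s': "?s \<in> Hom C (Sum K B ?U) (Sum K B ?V)"
    using s obj by (simp add: tensor_eq Hom_def)
  have "\<langle>?s \<cdot> f1, ?s \<cdot> f2\<rangle> = \<langle>g1, g2 \<cdot> s\<rangle>" (is "?a = ?b")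
    using sq s s' obj f12 g12 by (simp add: tensor_eq[of "Id C A"] Hom_def)
  then have "?a \<cdot> Inj1 K A ?U = ?b \<cdot> Inj1 K A ?U" "?a \<cdot> Inj2 K A ?U = ?b \<cdot> Inj2 K A ?U"
    by simp_all
  then have sq1: "?s \<cdot> f1 = g1" and sq2: "?s \<cdot> f2 = g2 \<cdot> s"
    using s s' obj f12 g12 by (simp_all add: Hom_def)
  have unif: "f2\<^sup>\<dagger> = g2\<^sup>\<dagger> \<cdot> s"
    using s sq2 by (intro iter_uniform[OF f12(2) g12(2) _ B]) (simp_all add: Hom_def)
  have "Tr A B ?V g = \<langle>Id C B, g2\<^sup>\<dagger>\<rangle> \<cdot> (?s \<cdot> f1)"
    using obj g12 by (simp add: trace_copair Hom_def sq1)
  also have "\<dots> = \<langle>Id C B, f2\<^sup>\<dagger>\<rangle> \<cdot> f1"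
    unfolding unif using obj s s' f12 iter_hom[OF g12(2)]
    by (simp add: tensor_eq Hom_def flip: assoc)
  finally show "Tr A B ?U f = Tr A B ?V g"
    using obj f12 by (simp add: trace_copair Hom_def)
qed

theorem uniform_traced_category_M: "uniform_traced_category M Tr"
proof -
  interpret M: symmetric_monoidal M
    by (rule symmetric_monoidal_M)
  show ?thesis
  proof unfold_locales
    fix s assume "s \<in> Mor M"
    then show "strict_morphism M Tr s"
      by (simp add: strict_morphism)
  qed (simp_all add: trace_hom trace_natural[simplified] trace_dinatural trace_unit[simplified]
        trace_tensor[simplified] superposing[simplified] yanking del: assoc comp_copair)
qed

end

section \<open>Functors preserving coproducts and iterates\<close>

text \<open>The iterate of the image of \<open>f : U \<rightarrow> B + U\<close> makes sense only after the inverse comparison map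
  \<open>F (B + U) \<rightarrow> F B + F U\<close> has been applied.\<close>

locale iteration_functor =
  source: iteration_trace C K le iter Tr + target: iteration_trace D K' le' iter' Tr' +
  is_functor C D F
  for C :: "('o1, 'm1) category" and K le iter Tr
    and D :: "('o2, 'm2) category" and K' le' iter' Tr'
    and F :: "('o1, 'm1, 'o2, 'm2) cat_functor" +
  assumes sum_iso: "\<lbrakk>A \<in> Obj C; B \<in> Obj C\<rbrakk> \<Longrightarrow> iso D (sum_comparison K D K' F A B)"
    and zero_iso: "iso D (zero_comparison K D K' F)"
    and preserves_iter: "\<lbrakk>f \<in> Hom C U (Sum K B U); B \<in> Obj C; U \<in> Obj C\<rbrakk>
      \<Longrightarrow> FMor F (iter f) = iter' (inv_mor D (sum_comparison K D K' F B U) \<cdot>\<^bsub>D\<^esub> FMor F f)"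
begin

abbreviation "\<phi> \<equiv> sum_comparison K D K' F"
abbreviation "\<phi>0 \<equiv> zero_comparison K D K' F"

lemma FOb_Obj [simp]: "A \<in> Obj C \<Longrightarrow> FOb F A \<in> Obj D"
  by (rule fob)

lemma FMor_Mor [simp]: "f \<in> Mor C \<Longrightarrow> FMor F f \<in> Mor D"
  and Dom_FMor [simp]: "f \<in> Mor C \<Longrightarrow> Dom D (FMor F f) = FOb F (Dom C f)"
  and Cod_FMor [simp]: "f \<in> Mor C \<Longrightarrow> Cod D (FMor F f) = FOb F (Cod C f)"
  using fmor[of f "Dom C f" "Cod C f"] by (auto simp: Hom_def)

lemma FMor_Id [simp]: "A \<in> Obj C \<Longrightarrow> FMor F (Id C A) = Id D (FOb F A)"
  by (rule fid)

lemma FMor_comp: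
  "\<lbrakk>f \<in> Mor C; g \<in> Mor C; Dom C g = Cod C f\<rbrakk> \<Longrightarrow> FMor F (g \<cdot>\<^bsub>C\<^esub> f) = FMor F g \<cdot>\<^bsub>D\<^esub> FMor F f"
  using fcomp[of f "Dom C f" "Cod C f" g "Cod C g"] by (simp add: Hom_def)

lemma \<phi>_eq: "\<phi> A B = copair D K' (FMor F (Inj1 K A B)) (FMor F (Inj2 K A B))"
  by (simp add: sum_comparison_def)

lemma \<phi>_Mor [simp]: "\<lbrakk>A \<in> Obj C; B \<in> Obj C\<rbrakk> \<Longrightarrow> \<phi> A B \<in> Mor D"
  and Dom_\<phi> [simp]: "\<lbrakk>A \<in> Obj C; B \<in> Obj C\<rbrakk> \<Longrightarrow> Dom D (\<phi> A B) = Sum K' (FOb F A) (FOb F B)"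
  and Cod_\<phi> [simp]: "\<lbrakk>A \<in> Obj C; B \<in> Obj C\<rbrakk> \<Longrightarrow> Cod D (\<phi> A B) = FOb F (Sum K A B)"
  by (simp_all add: \<phi>_eq)

lemma FMor_copair_\<phi> [simp]:
  assumes "f \<in> Mor C" "g \<in> Mor C" "Cod C f = Cod C g" "Dom C f = A" "Dom C g = B"
  shows "FMor F (copair C K f g) \<cdot>\<^bsub>D\<^esub> \<phi> A B = copair D K' (FMor F f) (FMor F g)"
proof -
  have "A \<in> Obj C" "B \<in> Obj C"
    using assms by auto
  then show ?thesis
    using assms by (simp add: \<phi>_eq flip: FMor_comp)
qed

lemma \<phi>_Inj1: "\<lbrakk>A \<in> Obj C; B \<in> Obj C\<rbrakk> \<Longrightarrow> \<phi> A B \<cdot>\<^bsub>D\<^esub> Inj1 K' (FOb F A) (FOb F B) = FMor F (Inj1 K A B)"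
  and \<phi>_Inj2: "\<lbrakk>A \<in> Obj C; B \<in> Obj C\<rbrakk> \<Longrightarrow> \<phi> A B \<cdot>\<^bsub>D\<^esub> Inj2 K' (FOb F A) (FOb F B) = FMor F (Inj2 K A B)"
  by (simp_all add: \<phi>_eq)

lemma FMor_copair_\<phi>_comp [simp]:
  assumes "f \<in> Mor C" "g \<in> Mor C" "Cod C f = Cod C g" "Dom C f = A" "Dom C g = B"
    and "x \<in> Mor D" "Cod D x = Sum K' (FOb F A) (FOb F B)"
  shows "FMor F (copair C K f g) \<cdot>\<^bsub>D\<^esub> (\<phi> A B \<cdot>\<^bsub>D\<^esub> x) = copair D K' (FMor F f) (FMor F g) \<cdot>\<^bsub>D\<^esub> x"
proof -
  have "A \<in> Obj C" "B \<in> Obj C"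
    using assms by auto
  then show ?thesis
    using assms FMor_copair_\<phi>[OF assms(1-5)] by (simp del: FMor_copair_\<phi> flip: target.assoc)
qed

lemma FMor_copair_Inj:
  assumes "f \<in> Mor C" "g \<in> Mor C" "Cod C f = Cod C g" "Dom C f = A" "Dom C g = B"
  shows "FMor F (copair C K f g) \<cdot>\<^bsub>D\<^esub> FMor F (Inj1 K A B) = FMor F f"
    and "FMor F (copair C K f g) \<cdot>\<^bsub>D\<^esub> FMor F (Inj2 K A B) = FMor F g"
    and "\<lbrakk>x \<in> Mor D; Cod D x = FOb F A\<rbrakk>
      \<Longrightarrow> FMor F (copair C K f g) \<cdot>\<^bsub>D\<^esub> (FMor F (Inj1 K A B) \<cdot>\<^bsub>D\<^esub> x) = FMor F f \<cdot>\<^bsub>D\<^esub> x"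
proof -
  have obj: "A \<in> Obj C" "B \<in> Obj C"
    using assms by auto
  then show 1: "FMor F (copair C K f g) \<cdot>\<^bsub>D\<^esub> FMor F (Inj1 K A B) = FMor F f"
    and "FMor F (copair C K f g) \<cdot>\<^bsub>D\<^esub> FMor F (Inj2 K A B) = FMor F g"
    using assms by (simp_all flip: FMor_comp)
  show "\<lbrakk>x \<in> Mor D; Cod D x = FOb F A\<rbrakk>
      \<Longrightarrow> FMor F (copair C K f g) \<cdot>\<^bsub>D\<^esub> (FMor F (Inj1 K A B) \<cdot>\<^bsub>D\<^esub> x) = FMor F f \<cdot>\<^bsub>D\<^esub> x"
    using obj assms 1 by (simp flip: target.assoc)
qed

lemma \<phi>_Inj1_comp: "\<lbrakk>A \<in> Obj C; B \<in> Obj C; x \<in> Mor D; Cod D x = FOb F A\<rbrakk>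
    \<Longrightarrow> \<phi> A B \<cdot>\<^bsub>D\<^esub> (Inj1 K' (FOb F A) (FOb F B) \<cdot>\<^bsub>D\<^esub> x) = FMor F (Inj1 K A B) \<cdot>\<^bsub>D\<^esub> x"
  and \<phi>_Inj2_comp: "\<lbrakk>A \<in> Obj C; B \<in> Obj C; x \<in> Mor D; Cod D x = FOb F B\<rbrakk>
    \<Longrightarrow> \<phi> A B \<cdot>\<^bsub>D\<^esub> (Inj2 K' (FOb F A) (FOb F B) \<cdot>\<^bsub>D\<^esub> x) = FMor F (Inj2 K A B) \<cdot>\<^bsub>D\<^esub> x"
  by (simp_all add: \<phi>_eq)

lemmas \<phi>_Inj = \<phi>_Inj1 \<phi>_Inj2 \<phi>_Inj1_comp \<phi>_Inj2_comp

lemma \<phi>0_eq: "\<phi>0 = initial_map D K' (FOb F (Zero K))"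
  by (simp add: zero_comparison_def)

lemma \<phi>_inverse: "\<lbrakk>A \<in> Obj C; B \<in> Obj C\<rbrakk> \<Longrightarrow> inverse_pair D (\<phi> A B) (inv_mor D (\<phi> A B))"
  using sum_iso target.iso_inv_mor by blast

lemma preserves_trace:
  assumes A: "A \<in> Obj C" and B: "B \<in> Obj C" and U: "U \<in> Obj C"
    and f: "f \<in> Hom C (Sum K A U) (Sum K B U)"
  shows "FMor F (Tr A B U f) = Tr' (FOb F A) (FOb F B) (FOb F U)
    (inv_mor D (\<phi> B U) \<cdot>\<^bsub>D\<^esub> (FMor F f \<cdot>\<^bsub>D\<^esub> \<phi> A U))"
proof -
  obtain f1 f2 where f12: "f1 \<in> Hom C A (Sum K B U)" "f2 \<in> Hom C U (Sum K B U)" "f = copair C K f1 f2"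
    using source.split_sum[OF f] A U by blast
  let ?\<psi> = "inv_mor D (\<phi> B U)"
  have \<psi>: "?\<psi> \<in> Mor D" "Dom D ?\<psi> = FOb F (Sum K B U)" "Cod D ?\<psi> = Sum K' (FOb F B) (FOb F U)"
      "\<phi> B U \<cdot>\<^bsub>D\<^esub> ?\<psi> = Id D (FOb F (Sum K B U))"
    using \<phi>_inverse[OF B U] B U by (simp_all add: inverse_pair_def Hom_def)
  have iter: "iter f2 \<in> Hom C U B"
    using source.iter_hom[OF f12(2) B U] .
  let ?k = "copair D K' (Id D (FOb F B)) (FMor F (iter f2))"
  have "FMor F (copair C K (Id C B) (iter f2)) = FMor F (copair C K (Id C B) (iter f2)) \<cdot>\<^bsub>D\<^esub> (\<phi> B U \<cdot>\<^bsub>D\<^esub> ?\<psi>)"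
    using B U iter \<psi>(4) by (simp add: Hom_def)
  also have "\<dots> = ?k \<cdot>\<^bsub>D\<^esub> ?\<psi>"
    using B U iter \<psi>(1-3) by (simp add: Hom_def flip: target.assoc)
  finally have "FMor F (Tr A B U f) = ?k \<cdot>\<^bsub>D\<^esub> (?\<psi> \<cdot>\<^bsub>D\<^esub> FMor F f1)"
    using A B U f12 iter \<psi>(1-3) by (simp add: source.trace_copair Hom_def FMor_comp)
  moreover have "?\<psi> \<cdot>\<^bsub>D\<^esub> (FMor F f \<cdot>\<^bsub>D\<^esub> \<phi> A U) = copair D K' (?\<psi> \<cdot>\<^bsub>D\<^esub> FMor F f1) (?\<psi> \<cdot>\<^bsub>D\<^esub> FMor F f2)"
    using A B U f12 \<psi>(1-3) by (simp add: Hom_def)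
  ultimately show ?thesis
    using A B U f12 \<psi>(1-3) preserves_iter[OF f12(2) B U]
    by (simp add: target.trace_copair Hom_def)
qed

text \<open>The coherence conditions hold because \<open>\<phi>\<close> is the copair of the images of the injections: both
  sides agree on each summand.\<close>

theorem traced_functor_M:
  "traced_functor (cocartesian C K) Tr (cocartesian D K') Tr' F \<phi> \<phi>0"
proof -
  interpret S: uniform_traced_category "cocartesian C K" Tr
    by (rule source.uniform_traced_category_M)
  interpret T: uniform_traced_category "cocartesian D K'" Tr'
    by (rule target.uniform_traced_category_M)
  show ?thesis
    apply unfold_locales
    subgoal by simp
    subgoal by (auto simp: Hom_def)
    subgoal by simp
    subgoal by (auto simp: Hom_def FMor_comp)
    subgoal by (auto simp: Hom_def)
    subgoal by (simp add: sum_iso)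
    subgoal by (auto simp: Hom_def source.tensor_eq target.tensor_eq FMor_comp \<phi>_Inj)
    subgoal by (simp add: \<phi>0_eq Hom_def)
    subgoal by (simp add: zero_iso)
    subgoal by (simp add: source.assoc_eq target.assoc_eq target.tensor_eq FMor_comp FMor_copair_Inj \<phi>_Inj)
    subgoal by (simp add: source.lunit_eq target.lunit_eq target.tensor_eq \<phi>0_eq)
    subgoal by (simp add: source.runit_eq target.runit_eq target.tensor_eq \<phi>0_eq)
    subgoal by (simp add: source.braid_eq target.braid_eq \<phi>_Inj)
    subgoal by (simp add: preserves_trace del: target.assoc)
    done
qed

end

section \<open>The Kleisli category of the maybe monad\<close>

lemma star_simps [simp]:
  "Obj (star C K t) = Obj C" "Dom (star C K t) = src" "Cod (star C K t) = tgt"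
  "Id (star C K t) c = Arr c c (Inj1 K c t)"
  by (auto simp: star_def)

lemma Mor_star: "k \<in> Mor (star C K t) \<longleftrightarrow>
    src k \<in> Obj C \<and> tgt k \<in> Obj C \<and> the_map k \<in> Hom C (src k) (Sum K (tgt k) t)"
  by (cases k) (auto simp: star_def)

lemma Hom_star: "Hom (star C K t) p q =
    {Arr p q a | a. p \<in> Obj C \<and> q \<in> Obj C \<and> a \<in> Hom C p (Sum K q t)}"
  by (auto simp: Hom_def star_def)

context cocartesian_category
begin

text \<open>Multiplication and functorial action of the monad combine to the copair that extends \<open>g\<close> to the
  added point; associativity and units of the Kleisli category become identities between copairs.\<close>

lemma star_comp:
  assumes t: "t \<in> Obj C" and f: "f \<in> Hom (star C K t) p q" and g: "g \<in> Hom (star C K t) q s"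
  shows "g \<cdot>\<^bsub>star C K t\<^esub> f = Arr p s (\<langle>the_map g, Inj2 K s t\<rangle> \<cdot> the_map f)"
proof -
  obtain a b where ab: "f = Arr p q a" "a \<in> Hom C p (Sum K q t)"
      "g = Arr q s b" "b \<in> Hom C q (Sum K s t)" "p \<in> Obj C" "q \<in> Obj C" "s \<in> Obj C"
    using f g by (auto simp: Hom_star)
  moreover have "maybe_mult C K t s \<cdot> maybe_map C K t b = \<langle>b, Inj2 K s t\<rangle>"
    using ab t by (simp add: maybe_mult_def maybe_map_def Hom_def)
  ultimately show ?thesis
    using t by (simp add: star_def Hom_def maybe_mult_def maybe_map_def flip: assoc)
qed

lemma category_star:
  assumes t: "t \<in> Obj C"
  shows "category (star C K t)"
proof
  fix A B f assume f: "f \<in> Hom (star C K t) A B"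
  then have AB: "A \<in> Obj C" "B \<in> Obj C"
    by (auto simp: Hom_star)
  have id: "Id (star C K t) A \<in> Hom (star C K t) A A" if "A \<in> Obj C" for A
    using that t by (simp add: Mor_star Hom_def)
  show "f \<cdot>\<^bsub>star C K t\<^esub> Id (star C K t) A = f" "Id (star C K t) B \<cdot>\<^bsub>star C K t\<^esub> f = f"
    using f AB t star_comp[OF t id f] star_comp[OF t f id] by (cases f; auto simp: Mor_star Hom_def)+
  fix D g assume g: "g \<in> Hom (star C K t) B D"
  show gf: "g \<cdot>\<^bsub>star C K t\<^esub> f \<in> Hom (star C K t) A D"
    using f g t star_comp[OF t f g] by (auto simp: Mor_star Hom_def)
  fix E h assume h: "h \<in> Hom (star C K t) D E"
  have hg: "h \<cdot>\<^bsub>star C K t\<^esub> g \<in> Hom (star C K t) B E"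
    using h g t star_comp[OF t g h] by (auto simp: Mor_star Hom_def)
  obtain a b c where abc: "f = Arr A B a" "a \<in> Hom C A (Sum K B t)"
      "g = Arr B D b" "b \<in> Hom C B (Sum K D t)" "h = Arr D E c" "c \<in> Hom C D (Sum K E t)"
      "A \<in> Obj C" "B \<in> Obj C" "D \<in> Obj C" "E \<in> Obj C"
    using f g h by (auto simp: Hom_star)
  have "\<langle>c, Inj2 K E t\<rangle> \<cdot> (\<langle>b, Inj2 K D t\<rangle> \<cdot> a) = \<langle>\<langle>c, Inj2 K E t\<rangle> \<cdot> b, Inj2 K E t\<rangle> \<cdot> a"
    using abc t by (simp add: Hom_def flip: assoc)
  then show "(h \<cdot>\<^bsub>star C K t\<^esub> g) \<cdot>\<^bsub>star C K t\<^esub> f = h \<cdot>\<^bsub>star C K t\<^esub> (g \<cdot>\<^bsub>star C K t\<^esub> f)"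
    using star_comp[OF t f hg] star_comp[OF t gf h] star_comp[OF t f g] star_comp[OF t g h] abc
    by simp
qed (use t in \<open>auto simp: Hom_star Mor_star Hom_def\<close>)

end


section \<open>Categories of labelled partial functions\<close>

text \<open>A labelled map sends an index to nothing, or to an index together with a morphism of \<open>E\<close>
  between the objects attached to the two indices.\<close>

type_synonym ('i, 'n) labelled_map = "'i \<Rightarrow> ('i \<times> 'n) option"

definition labelled_comp :: "('e, 'n, 'z) category_scheme \<Rightarrow> ('i, 'n) labelled_map
    \<Rightarrow> ('i, 'n) labelled_map \<Rightarrow> ('i, 'n) labelled_map"
  where "labelled_comp E g f i =
    (case f i of None \<Rightarrow> None
      | Some (j, m) \<Rightarrow> (case g j of None \<Rightarrow> None | Some (k, n) \<Rightarrow> Some (k, Comp E n m)))"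

definition labelled_maps :: "('e, 'n, 'z) category_scheme \<Rightarrow> 'i set \<Rightarrow> ('i \<Rightarrow> 'e)
    \<Rightarrow> 'i set \<Rightarrow> ('i \<Rightarrow> 'e) \<Rightarrow> ('i, 'n) labelled_map set"
  where "labelled_maps E I A J B = {f. \<forall>i j m. f i = Some (j, m) \<longrightarrow> i \<in> I \<and> j \<in> J \<and> m \<in> Hom E (A i) (B j)}"

lemma labelled_mapsD:
  assumes "f \<in> labelled_maps E I A J B" "f i = Some (j, m)"
  shows "i \<in> I" "j \<in> J" "m \<in> Hom E (A i) (B j)"
  using assms by (auto simp: labelled_maps_def)

lemma labelled_comp_Some: "labelled_comp E g f i = Some (k, x)
    \<longleftrightarrow> (\<exists>j m n. f i = Some (j, m) \<and> g j = Some (k, n) \<and> x = Comp E n m)"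
  by (auto simp: labelled_comp_def split: option.splits)

text \<open>A finite path of \<open>f\<close> from \<open>i\<close> through values in the range of \<open>r\<close> (the feedback) to a value
  \<open>l j\<close> (the exit), with the composite of its labels.\<close>

inductive exits :: "('e, 'n, 'z) category_scheme \<Rightarrow> ('i \<Rightarrow> 'i) \<Rightarrow> ('i \<Rightarrow> 'i)
    \<Rightarrow> ('i, 'n) labelled_map \<Rightarrow> 'i \<Rightarrow> 'i \<Rightarrow> 'n \<Rightarrow> bool"
  for E l r f where
  exit: "f i = Some (l j, m) \<Longrightarrow> exits E l r f i j m"
| loop: "\<lbrakk>f i = Some (r u, m); exits E l r f u j n\<rbrakk> \<Longrightarrow> exits E l r f i j (Comp E n m)"

definition labelled_iter :: "('e, 'n, 'z) category_scheme \<Rightarrow> ('i \<Rightarrow> 'i) \<Rightarrow> ('i \<Rightarrow> 'i)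
    \<Rightarrow> ('i, 'n) labelled_map \<Rightarrow> ('i, 'n) labelled_map"
  where "labelled_iter E l r f i =
    (if \<exists>j m. exits E l r f i j m then Some (THE (j, m). exits E l r f i j m) else None)"

locale sum_coding =
  fixes l r :: "'i \<Rightarrow> 'i"
  assumes inj_l [simp]: "inj l" and inj_r [simp]: "inj r" and disjoint: "range l \<inter> range r = {}"
begin

lemma l_eq_iff [simp]: "l i = l j \<longleftrightarrow> i = j"
  and r_eq_iff [simp]: "r i = r j \<longleftrightarrow> i = j"
  by (auto simp: inj_eq)

lemma l_neq_r [simp]: "l i \<noteq> r j" "r j \<noteq> l i"
  using disjoint by auto

lemma in_image_l [simp]: "l i \<in> l ` I \<longleftrightarrow> i \<in> I" "r i \<in> l ` I \<longleftrightarrow> False"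
  and in_image_r [simp]: "r i \<in> r ` I \<longleftrightarrow> i \<in> I" "l i \<in> r ` I \<longleftrightarrow> False"
  by auto

lemma exits_deterministic:
  assumes "exits E l r f i j m" "exits E l r f i j' m'"
  shows "j = j' \<and> m = m'"
  using assms
proof (induction arbitrary: j' m')
  case (exit i j m)
  from exit.prems exit.hyps show ?case
    by cases auto
next
  case (loop i u m j n)
  from loop.prems loop.hyps(1) show ?case
    by cases (auto dest: loop.IH)
qed

lemma labelled_iter_Some: "labelled_iter E l r f i = Some (j, m) \<longleftrightarrow> exits E l r f i j m"
proof (cases "\<exists>j m. exits E l r f i j m")
  case True
  then obtain j' m' where e: "exits E l r f i j' m'"
    by blast
  then have "(THE (j, m). exits E l r f i j m) = (j', m')"
    by (intro the_equality) (auto dest: exits_deterministic)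
  then show ?thesis
    using e True by (auto simp: labelled_iter_def dest: exits_deterministic)
next
  case False
  then show ?thesis
    by (auto simp: labelled_iter_def)
qed

end

text \<open>The map \<open>rep\<close> identifies the morphisms of \<open>C\<close> with all well-typed labelled maps; apart from this, the
  objects may be encoded in any way.  Injectivity of \<open>Sum\<close> in its first argument allows the exit
  object \<open>B\<close> of \<open>f : U \<rightarrow> B + U\<close> to be read off from \<open>f\<close>.\<close>

locale labelled_partial_category = E: category E + category C + sum_coding l r
  for E :: "('e, 'n, 'z) category_scheme" and C :: "('o, 'm) category" (structure)
    and l r :: "'i \<Rightarrow> 'i" +
  fixes K :: "('o, 'm) coproducts" and idx :: "'o \<Rightarrow> 'i set" and lab :: "'o \<Rightarrow> 'i \<Rightarrow> 'e"
    and rep :: "'m \<Rightarrow> ('i, 'n) labelled_map"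
  assumes lab_Obj: "\<lbrakk>p \<in> Obj C; i \<in> idx p\<rbrakk> \<Longrightarrow> lab p i \<in> Obj E"
    and rep_bij: "\<lbrakk>p \<in> Obj C; q \<in> Obj C\<rbrakk>
      \<Longrightarrow> bij_betw rep (Hom C p q) (labelled_maps E (idx p) (lab p) (idx q) (lab q))"
    and rep_id: "\<lbrakk>p \<in> Obj C\<rbrakk> \<Longrightarrow> rep (Id C p) = (\<lambda>i. if i \<in> idx p then Some (i, Id E (lab p i)) else None)"
    and rep_comp: "\<lbrakk>f \<in> Hom C p q; g \<in> Hom C q s\<rbrakk> \<Longrightarrow> rep (g \<cdot> f) = labelled_comp E (rep g) (rep f)"
    and zero: "Zero K \<in> Obj C" "idx (Zero K) = {}"
    and sum: "\<lbrakk>p \<in> Obj C; q \<in> Obj C\<rbrakk> \<Longrightarrow> Sum K p q \<in> Obj C"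
    and sum_inject: "\<lbrakk>p \<in> Obj C; q \<in> Obj C; s \<in> Obj C; Sum K p q = Sum K s q\<rbrakk> \<Longrightarrow> p = s"
    and idx_sum: "\<lbrakk>p \<in> Obj C; q \<in> Obj C\<rbrakk> \<Longrightarrow> idx (Sum K p q) = l ` idx p \<union> r ` idx q"
    and inj1: "\<lbrakk>p \<in> Obj C; q \<in> Obj C\<rbrakk> \<Longrightarrow> Inj1 K p q \<in> Hom C p (Sum K p q)"
    and rep_inj1: "\<lbrakk>p \<in> Obj C; q \<in> Obj C\<rbrakk>
      \<Longrightarrow> rep (Inj1 K p q) = (\<lambda>i. if i \<in> idx p then Some (l i, Id E (lab p i)) else None)"
    and inj2: "\<lbrakk>p \<in> Obj C; q \<in> Obj C\<rbrakk> \<Longrightarrow> Inj2 K p q \<in> Hom C q (Sum K p q)"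
    and rep_inj2: "\<lbrakk>p \<in> Obj C; q \<in> Obj C\<rbrakk>
      \<Longrightarrow> rep (Inj2 K p q) = (\<lambda>j. if j \<in> idx q then Some (r j, Id E (lab q j)) else None)"
begin

lemma rep_typed: "f \<in> Hom C p q \<Longrightarrow> rep f \<in> labelled_maps E (idx p) (lab p) (idx q) (lab q)"
  using rep_bij[of p q] Hom_Obj[of f p q] by (auto simp: bij_betw_def)

lemmas rep_SomeD = labelled_mapsD[OF rep_typed]

lemma rep_eqI:
  assumes f: "f \<in> Hom C p q" and g: "g \<in> Hom C p q"
    and le: "\<And>i. i \<in> idx p \<Longrightarrow> rep f i = rep g i"
  shows "f = g"
proof -
  have "rep f i = rep g i" for i
    using le rep_SomeD(1)[OF f, of i] rep_SomeD(1)[OF g, of i]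
    by (cases "rep f i"; cases "rep g i") auto
  then have "rep f = rep g"
    by (rule ext)
  then show ?thesis
    using rep_bij[of p q] f g Hom_Obj[OF f] by (auto simp: bij_betw_def inj_on_def)
qed

definition arrow :: "'o \<Rightarrow> 'o \<Rightarrow> ('i, 'n) labelled_map \<Rightarrow> 'm"
  where "arrow p q x = the_inv_into (Hom C p q) rep x"

lemma arrow:
  assumes "p \<in> Obj C" "q \<in> Obj C" "x \<in> labelled_maps E (idx p) (lab p) (idx q) (lab q)"
  shows arrow_hom: "arrow p q x \<in> Hom C p q" and rep_arrow: "rep (arrow p q x) = x"
  using assms rep_bij[of p q] unfolding arrow_def
  by (metis bij_betw_def order_refl the_inv_into_into, metis bij_betw_def f_the_inv_into_f)

lemma lab_sum_l:
  assumes "p \<in> Obj C" "q \<in> Obj C" "i \<in> idx p"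
  shows "lab (Sum K p q) (l i) = lab p i"
  using rep_SomeD(3)[OF inj1[OF assms(1,2)], of i "l i" "Id E (lab p i)"] assms lab_Obj
  by (auto simp: rep_inj1 Hom_def)

lemma lab_sum_r:
  assumes "p \<in> Obj C" "q \<in> Obj C" "j \<in> idx q"
  shows "lab (Sum K p q) (r j) = lab q j"
  using rep_SomeD(3)[OF inj2[OF assms(1,2)], of j "r j" "Id E (lab q j)"] assms lab_Obj
  by (auto simp: rep_inj2 Hom_def)

text \<open>The labels of the injections are identities, so composing with an injection only renames
  indices.\<close>

lemma rep_comp_Inj1:
  assumes p: "p \<in> Obj C" and q: "q \<in> Obj C" and h: "h \<in> Hom C (Sum K p q) s" and i: "i \<in> idx p"
  shows "rep (h \<cdot> Inj1 K p q) i = rep h (l i)"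
proof (cases "rep h (l i)")
  case None
  then show ?thesis
    using p q i rep_comp[OF inj1[OF p q] h] by (simp add: labelled_comp_def rep_inj1)
next
  case (Some z)
  then show ?thesis
    using p q i rep_comp[OF inj1[OF p q] h] rep_SomeD(3)[OF h, of "l i" "fst z" "snd z"]
    by (cases z) (auto simp: labelled_comp_def rep_inj1 lab_sum_l Hom_def)
qed

lemma rep_comp_Inj2:
  assumes p: "p \<in> Obj C" and q: "q \<in> Obj C" and h: "h \<in> Hom C (Sum K p q) s" and j: "j \<in> idx q"
  shows "rep (h \<cdot> Inj2 K p q) j = rep h (r j)"
proof (cases "rep h (r j)")
  case None
  then show ?thesis
    using p q j rep_comp[OF inj2[OF p q] h] by (simp add: labelled_comp_def rep_inj2)
next
  case (Some z)
  then show ?thesis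
    using p q j rep_comp[OF inj2[OF p q] h] rep_SomeD(3)[OF h, of "r j" "fst z" "snd z"]
    by (cases z) (auto simp: labelled_comp_def rep_inj2 lab_sum_r Hom_def)
qed

lemma initial:
  assumes "q \<in> Obj C"
  shows "\<exists>!f. f \<in> Hom C (Zero K) q"
proof (rule ex_ex1I)
  have "(\<lambda>_. None) \<in> labelled_maps E (idx (Zero K)) (lab (Zero K)) (idx q) (lab q)"
    by (simp add: labelled_maps_def)
  then show "\<exists>f. f \<in> Hom C (Zero K) q"
    using arrow_hom zero(1) assms by blast
qed (use zero(2) in \<open>auto intro: rep_eqI\<close>)

lemma sum_universal:
  assumes f: "f \<in> Hom C p s" and g: "g \<in> Hom C q s"
  shows "\<exists>!h. h \<in> Hom C (Sum K p q) s \<and> h \<cdot> Inj1 K p q = f \<and> h \<cdot> Inj2 K p q = g"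
proof (rule ex_ex1I)
  note obj = Hom_Obj[OF f] Hom_Obj[OF g]
  then have p: "p \<in> Obj C" and q: "q \<in> Obj C" and s: "s \<in> Obj C"
    by auto
  let ?x = "\<lambda>k. if k \<in> range l then rep f (inv l k) else if k \<in> range r then rep g (inv r k) else None"
  have x_simps: "?x (l i) = rep f i" "?x (r j) = rep g j" for i j
    by auto
  have "?x \<in> labelled_maps E (idx (Sum K p q)) (lab (Sum K p q)) (idx s) (lab s)"
    using rep_SomeD[OF f] rep_SomeD[OF g] p q
    by (auto simp: labelled_maps_def idx_sum lab_sum_l lab_sum_r split: if_splits)
  note arrow_x = arrow_hom[OF sum[OF p q] s this] rep_arrow[OF sum[OF p q] s this]
  define h where "h = arrow (Sum K p q) s ?x"
  have h: "h \<in> Hom C (Sum K p q) s" and rep_h: "rep h = ?x"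
    using arrow_x by (simp_all only: h_def)
  have "h \<cdot> Inj1 K p q = f"
    using rep_comp_Inj1[OF p q h] rep_h comp_hom[OF inj1[OF p q] h]
    by (intro rep_eqI[OF _ f]) (auto simp: x_simps)
  moreover have "h \<cdot> Inj2 K p q = g"
    using rep_comp_Inj2[OF p q h] rep_h comp_hom[OF inj2[OF p q] h]
    by (intro rep_eqI[OF _ g]) (auto simp: x_simps)
  ultimately show "\<exists>h. h \<in> Hom C (Sum K p q) s \<and> h \<cdot> Inj1 K p q = f \<and> h \<cdot> Inj2 K p q = g"
    using h by blast
next
  fix h h'
  assume "h \<in> Hom C (Sum K p q) s \<and> h \<cdot> Inj1 K p q = f \<and> h \<cdot> Inj2 K p q = g"
    and "h' \<in> Hom C (Sum K p q) s \<and> h' \<cdot> Inj1 K p q = f \<and> h' \<cdot> Inj2 K p q = g"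
  then have *: "h \<in> Hom C (Sum K p q) s" "h' \<in> Hom C (Sum K p q) s"
    "h \<cdot> Inj1 K p q = h' \<cdot> Inj1 K p q" "h \<cdot> Inj2 K p q = h' \<cdot> Inj2 K p q"
    by auto
  have obj: "p \<in> Obj C" "q \<in> Obj C"
    using Hom_Obj[OF f] Hom_Obj[OF g] by auto
  show "h = h'"
  proof (rule rep_eqI[OF *(1,2)])
    fix i assume "i \<in> idx (Sum K p q)"
    then show "rep h i = rep h' i"
      using * obj rep_comp_Inj1[OF obj, of h s] rep_comp_Inj1[OF obj, of h' s]
        rep_comp_Inj2[OF obj, of h s] rep_comp_Inj2[OF obj, of h' s]
      by (fastforce simp: idx_sum)
  qed
qed

sublocale cocartesian_category C K
  using zero(1) initial sum inj1 inj2 sum_universal by unfold_locales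

lemma rep_copair:
  assumes f: "f \<in> Hom C p s" and g: "g \<in> Hom C q s"
  shows "i \<in> idx p \<Longrightarrow> rep \<langle>f, g\<rangle> (l i) = rep f i"
    and "j \<in> idx q \<Longrightarrow> rep \<langle>f, g\<rangle> (r j) = rep g j"
proof -
  have obj: "p \<in> Obj C" "q \<in> Obj C"
    using Hom_Obj[OF f] Hom_Obj[OF g] by auto
  have "\<langle>f, g\<rangle> \<in> Hom C (Sum K p q) s" "\<langle>f, g\<rangle> \<cdot> Inj1 K p q = f" "\<langle>f, g\<rangle> \<cdot> Inj2 K p q = g"
    using f g by (auto simp: Hom_def)
  then show "i \<in> idx p \<Longrightarrow> rep \<langle>f, g\<rangle> (l i) = rep f i" "j \<in> idx q \<Longrightarrow> rep \<langle>f, g\<rangle> (r j) = rep g j"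
    using rep_comp_Inj1[OF obj, of "\<langle>f, g\<rangle>" s i] rep_comp_Inj2[OF obj, of "\<langle>f, g\<rangle>" s j] by auto
qed

definition le :: "'m \<Rightarrow> 'm \<Rightarrow> bool"
  where "le f g \<longleftrightarrow> rep f \<subseteq>\<^sub>m rep g"

text \<open>The description picks out the exit object; it is unique by \<open>sum_inject\<close>.\<close>

definition iter :: "'m \<Rightarrow> 'm"
  where "iter f = arrow (Dom C f) (THE q. q \<in> Obj C \<and> Cod C f = Sum K q (Dom C f)) (labelled_iter E l r (rep f))"

lemma iter_eq: "\<lbrakk>f \<in> Hom C U (Sum K B U); B \<in> Obj C; U \<in> Obj C\<rbrakk>
    \<Longrightarrow> iter f = arrow U B (labelled_iter E l r (rep f))"
proof -
  assume *: "f \<in> Hom C U (Sum K B U)" "B \<in> Obj C" "U \<in> Obj C"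
  then have "(THE q. q \<in> Obj C \<and> Cod C f = Sum K q (Dom C f)) = B"
    by (intro the_equality) (auto simp: Hom_def intro: sum_inject)
  then show ?thesis
    using * by (simp add: iter_def Hom_def)
qed

lemma exits_typed:
  assumes "exits E l r (rep f) i j m" and f: "f \<in> Hom C U (Sum K B U)" and obj: "B \<in> Obj C" "U \<in> Obj C"
  shows "i \<in> idx U \<and> j \<in> idx B \<and> m \<in> Hom E (lab U i) (lab B j)"
  using assms(1)
proof induction
  case (exit i j m)
  then show ?case
    using rep_SomeD[OF f] obj by (fastforce simp: idx_sum lab_sum_l)
next
  case (loop i u m j n)
  then have "m \<in> Hom E (lab U i) (lab U u)"
    using rep_SomeD[OF f loop.hyps(1)] obj by (auto simp: idx_sum lab_sum_r)
  then show ?case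
    using loop rep_SomeD[OF f loop.hyps(1)] by (auto intro: E.comp_hom)
qed

lemma iter_hom: "\<lbrakk>f \<in> Hom C U (Sum K B U); B \<in> Obj C; U \<in> Obj C\<rbrakk> \<Longrightarrow> iter f \<in> Hom C U B"
  and rep_iter: "\<lbrakk>f \<in> Hom C U (Sum K B U); B \<in> Obj C; U \<in> Obj C\<rbrakk>
    \<Longrightarrow> rep (iter f) i = Some (j, m) \<longleftrightarrow> exits E l r (rep f) i j m"
proof -
  assume *: "f \<in> Hom C U (Sum K B U)" "B \<in> Obj C" "U \<in> Obj C"
  have "labelled_iter E l r (rep f) \<in> labelled_maps E (idx U) (lab U) (idx B) (lab B)"
    unfolding labelled_maps_def mem_Collect_eq labelled_iter_Some using exits_typed[OF _ *] by blast
  then show "iter f \<in> Hom C U B" "rep (iter f) i = Some (j, m) \<longleftrightarrow> exits E l r (rep f) i j m"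
    using * by (simp_all add: iter_eq arrow_hom rep_arrow labelled_iter_Some)
qed

lemma leI: "(\<And>i j m. rep f i = Some (j, m) \<Longrightarrow> rep g i = Some (j, m)) \<Longrightarrow> le f g"
  by (force simp: le_def map_le_def dom_def)

lemma leD: "\<lbrakk>le f g; rep f i = Some (j, m)\<rbrakk> \<Longrightarrow> rep g i = Some (j, m)"
  by (force simp: le_def map_le_def dom_def)

lemma rep_copair_comp:
  assumes f: "f \<in> Hom C p s" and g: "g \<in> Hom C q s" and k: "k \<in> Hom C t (Sum K p q)"
  shows "rep (\<langle>f, g\<rangle> \<cdot> k) i = Some (j, m) \<longleftrightarrow>
    (\<exists>u n n'. rep k i = Some (l u, n) \<and> rep f u = Some (j, n') \<and> m = n' \<cdot>\<^bsub>E\<^esub> n) \<or>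
    (\<exists>u n n'. rep k i = Some (r u, n) \<and> rep g u = Some (j, n') \<and> m = n' \<cdot>\<^bsub>E\<^esub> n)"
    (is "?L \<longleftrightarrow> ?R")
proof -
  have fg: "\<langle>f, g\<rangle> \<in> Hom C (Sum K p q) s"
    using f g by (auto simp: Hom_def)
  have obj: "p \<in> Obj C" "q \<in> Obj C"
    using Hom_Obj[OF f] Hom_Obj[OF g] by auto
  show ?thesis
  proof
    assume ?L
    then obtain v n n' where v: "rep k i = Some (v, n)" "rep \<langle>f, g\<rangle> v = Some (j, n')" "m = n' \<cdot>\<^bsub>E\<^esub> n"
      by (auto simp: rep_comp[OF k fg] labelled_comp_Some)
    from rep_SomeD(2)[OF k v(1)] obj
    consider u where "u \<in> idx p" "v = l u" | u where "u \<in> idx q" "v = r u"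
      by (auto simp: idx_sum)
    then show ?R
      using v rep_copair[OF f g] by cases auto
  next
    have l: "rep \<langle>f, g\<rangle> (l u) = Some (j, n')" if "rep f u = Some (j, n')" for u n'
      using that rep_copair(1)[OF f g] rep_SomeD(1)[OF f that] by simp
    have r: "rep \<langle>f, g\<rangle> (r u) = Some (j, n')" if "rep g u = Some (j, n')" for u n'
      using that rep_copair(2)[OF f g] rep_SomeD(1)[OF g that] by simp
    assume ?R
    then show ?L
      unfolding rep_comp[OF k fg] labelled_comp_Some using l r by blast
  qed
qed

lemma rep_Id_Some: "p \<in> Obj C \<Longrightarrow> rep (Id C p) i = Some (j, m) \<longleftrightarrow> i \<in> idx p \<and> j = i \<and> m = Id E (lab p i)"
  by (auto simp: rep_id)

text \<open>The equation splits a path into its first step and the rest; a path of one step picks up an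
  identity label.\<close>

lemma iter_fixpoint:
  assumes f: "f \<in> Hom C U (Sum K B U)" and obj: "B \<in> Obj C" "U \<in> Obj C"
  shows "\<langle>Id C B, iter f\<rangle> \<cdot> f = iter f"
proof (rule rep_eqI)
  note f' = iter_hom[OF f obj]
  show "\<langle>Id C B, iter f\<rangle> \<cdot> f \<in> Hom C U B" "iter f \<in> Hom C U B"
    using f obj f' by (auto simp: Hom_def)
  fix i
  have "rep (\<langle>Id C B, iter f\<rangle> \<cdot> f) i = Some (j, m) \<longleftrightarrow> rep (iter f) i = Some (j, m)" for j m
  proof -
    have "(\<exists>u n n'. rep f i = Some (l u, n) \<and> rep (Id C B) u = Some (j, n') \<and> m = n' \<cdot>\<^bsub>E\<^esub> n)
        \<longleftrightarrow> rep f i = Some (l j, m)"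
      using obj rep_SomeD[OF f] by (fastforce simp: rep_Id_Some idx_sum lab_sum_l Hom_def)
    then show ?thesis
      unfolding rep_copair_comp[OF id_hom[OF obj(1)] f' f] rep_iter[OF f obj]
      by (subst (2) exits.simps) auto
  qed
  then show "rep (\<langle>Id C B, iter f\<rangle> \<cdot> f) i = rep (iter f) i"
    by (metis option.exhaust surj_pair)
qed

text \<open>By induction on a path of \<open>g\<close> that starts at \<open>s u\<close>.  Since \<open>(B + s) f = g s\<close>, its first step is
  the image of a step of \<open>f\<close> at \<open>u\<close>, and \<open>[h, x] f \<sqsubseteq> x\<close> transfers the value of \<open>x\<close> from the end of that
  step back to \<open>u\<close>.\<close>

lemma iter_induct:
  assumes f: "f \<in> Hom C U (Sum K B U)" and g: "g \<in> Hom C V (Sum K B V)" and s: "s \<in> Hom C U V"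
    and h: "h \<in> Hom C B X" and x: "x \<in> Hom C U X"
    and sq: "TMor M (Id C B) s \<cdot> f = g \<cdot> s" and le: "le (\<langle>h, x\<rangle> \<cdot> f) x"
  shows "le (h \<cdot> (iter g \<cdot> s)) x"
proof -
  have obj: "B \<in> Obj C" "V \<in> Obj C" "U \<in> Obj C" "X \<in> Obj C"
    using Hom_Obj[OF h] Hom_Obj[OF s] Hom_Obj[OF x] by auto
  note g' = iter_hom[OF g obj(1,2)]
  have gs: "g \<cdot> s \<in> Hom C U (Sum K B V)"
    using g s by (auto simp: Hom_def)
  have injs: "Inj1 K B V \<in> Hom C B (Sum K B V)" "Inj2 K B V \<cdot> s \<in> Hom C U (Sum K B V)"
    using obj s by (auto simp: Hom_def)
  have "TMor M (Id C B) s = \<langle>Inj1 K B V, Inj2 K B V \<cdot> s\<rangle>"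
    using obj s by (simp add: tensor_eq Hom_def)
  then have gs_eq: "g \<cdot> s = \<langle>Inj1 K B V, Inj2 K B V \<cdot> s\<rangle> \<cdot> f"
    using sq by simp
  have rep_Inj1: "rep (Inj1 K B V) b = Some (v, n) \<longleftrightarrow> b \<in> idx B \<and> v = l b \<and> n = Id E (lab B b)" for b v n
    using obj by (auto simp: rep_inj1)
  have rep_Inj2_s: "rep (Inj2 K B V \<cdot> s) u = Some (v, n) \<longleftrightarrow> (\<exists>w. rep s u = Some (w, n) \<and> v = r w)" for u v n
    using obj rep_SomeD[OF s, of u] unfolding rep_comp[OF s inj2[OF obj(1,2)]] labelled_comp_Some
    by (fastforce simp: rep_inj2 Hom_def split: if_splits)
  \<comment> \<open>an exit step of \<open>g s\<close> is an exit step of \<open>f\<close>; a feedback step is a feedback step of \<open>f\<close> followed by \<open>s\<close>\<close>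
  have square_l: "rep f u = Some (l b, n)" if "rep (g \<cdot> s) u = Some (l b, n)" for u b n
    using that obj rep_SomeD(3)[OF f, of u] unfolding gs_eq rep_copair_comp[OF injs f] rep_Inj1 rep_Inj2_s
    by (fastforce simp: lab_sum_l Hom_def)
  have square_r: "\<exists>u' c d. rep f u = Some (r u', c) \<and> rep s u' = Some (v, d) \<and> n = d \<cdot>\<^bsub>E\<^esub> c"
    if "rep (g \<cdot> s) u = Some (r v, n)" for u v n
    using that unfolding gs_eq rep_copair_comp[OF injs f] rep_Inj1 rep_Inj2_s by auto
  have le_step: "rep x u = Some (c, n)" if "rep (\<langle>h, x\<rangle> \<cdot> f) u = Some (c, n)" for u c n
    using leD[OF le that] .
  have main: "rep x u = Some (c, h_lab \<cdot>\<^bsub>E\<^esub> (e \<cdot>\<^bsub>E\<^esub> e0))"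
    if "exits E l r (rep g) v b e" "rep s u = Some (v, e0)" "rep h b = Some (c, h_lab)" for v b e u e0 c h_lab
    using that
  proof (induction arbitrary: u e0)
    case (exit v b e)
    then have "rep (g \<cdot> s) u = Some (l b, e \<cdot>\<^bsub>E\<^esub> e0)"
      by (auto simp: rep_comp[OF s g] labelled_comp_Some)
    then show ?case
      using exit.prems(2) by (intro le_step) (auto simp: rep_copair_comp[OF h x f] dest: square_l)
  next
    case (loop v w m b n)
    then have "rep (g \<cdot> s) u = Some (r w, m \<cdot>\<^bsub>E\<^esub> e0)"
      by (auto simp: rep_comp[OF s g] labelled_comp_Some)
    then obtain u' c' d where u': "rep f u = Some (r u', c')" "rep s u' = Some (w, d)"
        "m \<cdot>\<^bsub>E\<^esub> e0 = d \<cdot>\<^bsub>E\<^esub> c'"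
      using square_r by blast
    have "rep x u' = Some (c, h_lab \<cdot>\<^bsub>E\<^esub> (n \<cdot>\<^bsub>E\<^esub> d))"
      using loop.IH u'(2) loop.prems(2) by blast
    then have "rep x u = Some (c, (h_lab \<cdot>\<^bsub>E\<^esub> (n \<cdot>\<^bsub>E\<^esub> d)) \<cdot>\<^bsub>E\<^esub> c')"
      using u'(1) by (intro le_step) (auto simp: rep_copair_comp[OF h x f])
    \<comment> \<open>the two ways around the square have the same label, \<open>m e0 = d c'\<close>\<close>
    moreover have "(h_lab \<cdot>\<^bsub>E\<^esub> (n \<cdot>\<^bsub>E\<^esub> d)) \<cdot>\<^bsub>E\<^esub> c' = h_lab \<cdot>\<^bsub>E\<^esub> ((n \<cdot>\<^bsub>E\<^esub> m) \<cdot>\<^bsub>E\<^esub> e0)"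
    proof -
      have "e0 \<in> Hom E (lab U u) (lab V v)" "h_lab \<in> Hom E (lab B b) (lab X c)"
          "d \<in> Hom E (lab U u') (lab V w)" "n \<in> Hom E (lab V w) (lab B b)"
        using rep_SomeD(3)[OF s loop.prems(1)] rep_SomeD(3)[OF h loop.prems(2)]
          rep_SomeD(3)[OF s u'(2)] exits_typed[OF loop.hyps(2) g obj(1,2)] by auto
      moreover have "m \<in> Hom E (lab V v) (lab V w)" "c' \<in> Hom E (lab U u) (lab U u')"
        using rep_SomeD[OF g loop.hyps(1)] rep_SomeD[OF f u'(1)] obj
        by (auto simp: idx_sum lab_sum_r)
      ultimately show ?thesis
        using u'(3) by (simp add: Hom_def)
    qed
    ultimately show ?case
      by simp
  qed
  show ?thesis
  proof (rule leI)
    fix i j m assume "rep (h \<cdot> (iter g \<cdot> s)) i = Some (j, m)"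
    then obtain v b e e0 h_lab where "rep s i = Some (v, e0)" "exits E l r (rep g) v b e"
        "rep h b = Some (j, h_lab)" "m = h_lab \<cdot>\<^bsub>E\<^esub> (e \<cdot>\<^bsub>E\<^esub> e0)"
      by (auto simp: rep_comp[OF comp_hom[OF s g'] h] rep_comp[OF s g'] labelled_comp_Some
          rep_iter[OF g obj(1,2)])
    then show "rep x i = Some (j, m)"
      using main by simp
  qed
qed

sublocale iteration_category C K le iter
proof unfold_locales
  show "le f g" if "le f g'" "le g' g" for f g g'
    using that by (auto simp: le_def intro: map_le_trans)
  show "f = g" if "le f g" "le g f" "f \<in> Hom C A B" "g \<in> Hom C A B" for f g A B
    using that map_le_antisym[of "rep f" "rep g"] by (intro rep_eqI[of f A B g]) (auto simp: le_def)
  show "le (\<langle>h, x\<rangle> \<cdot> k) (\<langle>h, y\<rangle> \<cdot> k)"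
    if "le x y" "x \<in> Hom C B X" "y \<in> Hom C B X" "h \<in> Hom C A X" "k \<in> Hom C T (Sum K A B)" for x y h k A B X T
  proof (rule leI)
    fix i j m assume "rep (\<langle>h, x\<rangle> \<cdot> k) i = Some (j, m)"
    then show "rep (\<langle>h, y\<rangle> \<cdot> k) i = Some (j, m)"
      unfolding rep_copair_comp[OF that(4,2,5)] rep_copair_comp[OF that(4,3,5)]
      using leD[OF that(1)] by blast
  qed
  show "le \<langle>f, g\<rangle> \<langle>f', g'\<rangle>"
    if "le f f'" "le g g'" and hom: "f \<in> Hom C A X" "f' \<in> Hom C A X" "g \<in> Hom C B X" "g' \<in> Hom C B X"
    for f g f' g' A B X
  proof (rule leI)
    fix i j m assume i: "rep \<langle>f, g\<rangle> i = Some (j, m)"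
    have obj: "A \<in> Obj C" "B \<in> Obj C" "\<langle>f, g\<rangle> \<in> Hom C (Sum K A B) X"
      using hom by (auto simp: Hom_def)
    from rep_SomeD(1)[OF obj(3) i] obj consider u where "u \<in> idx A" "i = l u" | u where "u \<in> idx B" "i = r u"
      by (auto simp: idx_sum)
    then show "rep \<langle>f', g'\<rangle> i = Some (j, m)"
      using i rep_copair[OF hom(1,3)] rep_copair[OF hom(2,4)] leD[OF that(1)] leD[OF that(2)]
      by cases auto
  qed
qed (use iter_hom iter_fixpoint iter_induct in \<open>auto simp: le_def\<close>)

definition trace :: "'o \<Rightarrow> 'o \<Rightarrow> 'o \<Rightarrow> 'm \<Rightarrow> 'm"
  where "trace A B U f = \<langle>Id C B, iter (f \<cdot> Inj2 K A U)\<rangle> \<cdot> (f \<cdot> Inj1 K A U)"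

sublocale iteration_trace C K le iter trace
  by unfold_locales (simp add: trace_def)

end

section \<open>Opposite, functor and set categories\<close>

lemma opp_simps [simp]:
  "Obj (opp C) = Obj C" "Mor (opp C) = Mor C" "Dom (opp C) = Cod C" "Cod (opp C) = Dom C"
  "Id (opp C) = Id C" "Comp (opp C) g f = Comp C f g" "Hom (opp C) A B = Hom C B A"
  by (auto simp: opp_def Hom_def)

lemma category_opp:
  assumes "category C"
  shows "category (opp C)"
proof -
  interpret category C
    by fact
  show ?thesis
    by unfold_locales (auto simp: Hom_def intro: dom_obj cod_obj)
qed

lemma set_cat_simps [simp]:
  "Obj (set_cat U) = U" "Dom (set_cat U) = src" "Cod (set_cat U) = tgt"
  "Id (set_cat U) A = Arr A A (\<lambda>x \<in> A. x)"
  "Comp (set_cat U) g f = Arr (src f) (tgt g) (compose (src f) (the_map g) (the_map f))"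
  by (simp_all add: set_cat_def)

lemma Mor_set_cat: "f \<in> Mor (set_cat U) \<longleftrightarrow> src f \<in> U \<and> tgt f \<in> U \<and> the_map f \<in> src f \<rightarrow>\<^sub>E tgt f"
  by (cases f) (auto simp: set_cat_def)

lemma Hom_set_cat: "f \<in> Hom (set_cat U) A B \<longleftrightarrow>
    src f = A \<and> tgt f = B \<and> A \<in> U \<and> B \<in> U \<and> the_map f \<in> A \<rightarrow>\<^sub>E B"
  by (auto simp: Hom_def Mor_set_cat)

lemma arr_eqI: "\<lbrakk>src f = src g; tgt f = tgt g; the_map f = the_map g\<rbrakk> \<Longrightarrow> f = g"
  by (rule arr.expand) simp

lemma category_set_cat: "category (set_cat U)"
proof
  fix A B f assume f: "f \<in> Hom (set_cat U) A B"
  show "f \<cdot>\<^bsub>set_cat U\<^esub> Id (set_cat U) A = f" "Id (set_cat U) B \<cdot>\<^bsub>set_cat U\<^esub> f = f"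
    using f Id_compose[of "the_map f" A B] compose_Id[of "the_map f" A B]
    by (cases f; simp add: Hom_set_cat PiE_def)+
  fix D g assume g: "g \<in> Hom (set_cat U) B D"
  show "g \<cdot>\<^bsub>set_cat U\<^esub> f \<in> Hom (set_cat U) A D"
    using f g funcset_compose[of "the_map f" A B "the_map g" D]
    by (simp add: Hom_set_cat PiE_def compose_extensional)
  fix E h assume h: "h \<in> Hom (set_cat U) D E"
  show "(h \<cdot>\<^bsub>set_cat U\<^esub> g) \<cdot>\<^bsub>set_cat U\<^esub> f = h \<cdot>\<^bsub>set_cat U\<^esub> (g \<cdot>\<^bsub>set_cat U\<^esub> f)"
    using f g h compose_assoc[of "the_map f" A B "the_map h" "the_map g"]
    by (simp add: Hom_set_cat PiE_def)
qed (auto simp: Mor_set_cat Hom_set_cat)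

lemma empty_initial_set_cat:
  assumes "{} \<in> U" "A \<in> U"
  shows "\<exists>!f. f \<in> Hom (set_cat U) {} A"
  using assms
  by (intro ex1I[of _ "Arr {} A (\<lambda>x. undefined)"]) (auto simp: Hom_set_cat intro: arr_eqI)

lemma Obj_fun_cat: "F \<in> Obj (fun_cat C D) \<longleftrightarrow>
    is_functor C D F \<and> FOb F \<in> extensional (Obj C) \<and> FMor F \<in> extensional (Mor C)"
  by (simp add: fun_cat_def)

lemma fun_cat_simps [simp]:
  "Dom (fun_cat C D) = src" "Cod (fun_cat C D) = tgt"
  "Id (fun_cat C D) F = Arr F F (\<lambda>A \<in> Obj C. Id D (FOb F A))"
  "Comp (fun_cat C D) \<epsilon> \<eta> = Arr (src \<eta>) (tgt \<epsilon>) (\<lambda>A \<in> Obj C. Comp D (the_map \<epsilon> A) (the_map \<eta> A))"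
  by (simp_all add: fun_cat_def)

lemma Hom_fun_cat: "\<eta> \<in> Hom (fun_cat C D) F G \<longleftrightarrow>
    src \<eta> = F \<and> tgt \<eta> = G \<and> F \<in> Obj (fun_cat C D) \<and> G \<in> Obj (fun_cat C D) \<and>
    the_map \<eta> \<in> extensional (Obj C) \<and>
    (\<forall>A \<in> Obj C. the_map \<eta> A \<in> Hom D (FOb F A) (FOb G A)) \<and>
    (\<forall>f \<in> Mor C. Comp D (the_map \<eta> (Cod C f)) (FMor F f) = Comp D (FMor G f) (the_map \<eta> (Dom C f)))"
  by (cases \<eta>) (auto simp: Hom_def fun_cat_def)

lemma Hom_fun_catD:
  assumes "\<eta> \<in> Hom (fun_cat C D) F G"
  shows "src \<eta> = F" "tgt \<eta> = G" "F \<in> Obj (fun_cat C D)" "G \<in> Obj (fun_cat C D)"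
    and "the_map \<eta> \<in> extensional (Obj C)"
    and "A \<in> Obj C \<Longrightarrow> the_map \<eta> A \<in> Hom D (FOb F A) (FOb G A)"
    and "f \<in> Mor C \<Longrightarrow>
      Comp D (the_map \<eta> (Cod C f)) (FMor F f) = Comp D (FMor G f) (the_map \<eta> (Dom C f))"
  using iffD1[OF Hom_fun_cat assms] by blast+

lemma Mor_fun_cat: "\<eta> \<in> Mor (fun_cat C D) \<longleftrightarrow> \<eta> \<in> Hom (fun_cat C D) (src \<eta>) (tgt \<eta>)"
  by (simp add: Hom_def)

lemma category_fun_cat:
  assumes "category C" "category D"
  shows "category (fun_cat C D)"
proof -
  interpret C: category C
    by fact
  interpret D: category D
    by fact
  have component: "the_map \<eta> A \<in> Mor D \<and> Dom D (the_map \<eta> A) = FOb F A \<and> Cod D (the_map \<eta> A) = FOb G A"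
    if "\<eta> \<in> Hom (fun_cat C D) F G" "A \<in> Obj C" for \<eta> F G A
    using Hom_fun_catD(6)[OF that] by (simp add: Hom_def)
  have on_arrows: "FMor F f \<in> Mor D \<and> Dom D (FMor F f) = FOb F (Dom C f) \<and> Cod D (FMor F f) = FOb F (Cod C f)"
    if F: "F \<in> Obj (fun_cat C D)" and f: "f \<in> Mor C" for F f
  proof -
    have "is_functor C D F"
      using F unfolding Obj_fun_cat by blast
    from is_functor.fmor[OF this, of f "Dom C f" "Cod C f"] f show ?thesis
      by (simp add: Hom_def)
  qed
  show ?thesis
  proof
    fix F G \<eta> assume \<eta>: "\<eta> \<in> Hom (fun_cat C D) F G"
    from Hom_fun_catD(1-5)[OF this]
    have objs: "F \<in> Obj (fun_cat C D)" "G \<in> Obj (fun_cat C D)" and ext: "the_map \<eta> \<in> extensional (Obj C)"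
      and arr: "src \<eta> = F" "tgt \<eta> = G"
      by (simp_all add: Hom_fun_catD)
    show "\<eta> \<cdot>\<^bsub>fun_cat C D\<^esub> Id (fun_cat C D) F = \<eta>" "Id (fun_cat C D) G \<cdot>\<^bsub>fun_cat C D\<^esub> \<eta> = \<eta>"
      using component[OF \<eta>] ext arr by (auto intro!: arr_eqI extensionalityI[of _ "Obj C"])
    fix H \<epsilon> assume \<epsilon>: "\<epsilon> \<in> Hom (fun_cat C D) G H"
    then have H: "H \<in> Obj (fun_cat C D)"
      using Hom_fun_catD(4) by blast
    have "(the_map \<epsilon> (Cod C f) \<cdot>\<^bsub>D\<^esub> the_map \<eta> (Cod C f)) \<cdot>\<^bsub>D\<^esub> FMor F f
        = FMor H f \<cdot>\<^bsub>D\<^esub> (the_map \<epsilon> (Dom C f) \<cdot>\<^bsub>D\<^esub> the_map \<eta> (Dom C f))" if f: "f \<in> Mor C" for f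
    proof -
      note obj = C.dom_obj[OF f] C.cod_obj[OF f]
      note comps = component[OF \<eta> obj(1)] component[OF \<eta> obj(2)] component[OF \<epsilon> obj(1)]
        component[OF \<epsilon> obj(2)] on_arrows[OF objs(1) f] on_arrows[OF objs(2) f] on_arrows[OF H f]
      have sq: "the_map \<eta> (Cod C f) \<cdot>\<^bsub>D\<^esub> FMor F f = FMor G f \<cdot>\<^bsub>D\<^esub> the_map \<eta> (Dom C f)"
          "the_map \<epsilon> (Cod C f) \<cdot>\<^bsub>D\<^esub> FMor G f = FMor H f \<cdot>\<^bsub>D\<^esub> the_map \<epsilon> (Dom C f)"
        using Hom_fun_catD(7)[OF \<eta> f] Hom_fun_catD(7)[OF \<epsilon> f] by auto
      have "(the_map \<epsilon> (Cod C f) \<cdot>\<^bsub>D\<^esub> the_map \<eta> (Cod C f)) \<cdot>\<^bsub>D\<^esub> FMor F f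
          = (the_map \<epsilon> (Cod C f) \<cdot>\<^bsub>D\<^esub> FMor G f) \<cdot>\<^bsub>D\<^esub> the_map \<eta> (Dom C f)"
        using comps by (simp add: sq(1))
      also have "\<dots> = FMor H f \<cdot>\<^bsub>D\<^esub> (the_map \<epsilon> (Dom C f) \<cdot>\<^bsub>D\<^esub> the_map \<eta> (Dom C f))"
        unfolding sq(2) using comps by simp
      finally show ?thesis .
    qed
    then show "\<epsilon> \<cdot>\<^bsub>fun_cat C D\<^esub> \<eta> \<in> Hom (fun_cat C D) F H"
      using Hom_fun_catD[OF \<eta>] Hom_fun_catD[OF \<epsilon>] C.dom_obj C.cod_obj
        D.comp_hom[OF Hom_fun_catD(6)[OF \<eta>] Hom_fun_catD(6)[OF \<epsilon>]]
      by (simp add: Hom_fun_cat del: D.assoc)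
    fix I \<theta> assume \<theta>: "\<theta> \<in> Hom (fun_cat C D) H I"
    show "(\<theta> \<cdot>\<^bsub>fun_cat C D\<^esub> \<epsilon>) \<cdot>\<^bsub>fun_cat C D\<^esub> \<eta> = \<theta> \<cdot>\<^bsub>fun_cat C D\<^esub> (\<epsilon> \<cdot>\<^bsub>fun_cat C D\<^esub> \<eta>)"
      using component[OF \<eta>] component[OF \<epsilon>] component[OF \<theta>] by (auto intro: restrict_ext)
  next
    fix F assume F: "F \<in> Obj (fun_cat C D)"
    then have "is_functor C D F"
      unfolding Obj_fun_cat by blast
    then show "Id (fun_cat C D) F \<in> Hom (fun_cat C D) F F"
      using F on_arrows[OF F] C.dom_obj C.cod_obj is_functor.fob[of C D F] D.id_hom
      by (simp add: Hom_fun_cat)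
  qed (auto simp: Mor_fun_cat Hom_fun_cat)
qed

lemma Obj_LSet: "X \<in> Obj (LSet U L) \<longleftrightarrow> is_functor L (set_cat U) X
    \<and> FOb X \<in> extensional (Obj L) \<and> FMor X \<in> extensional (Mor L)"
  by (simp add: LSet_def Obj_fun_cat)

lemma empty_lset_initial:
  assumes "category L" "{} \<in> U"
  shows "empty_lset L \<in> Obj (LSet U L)"
    and "X \<in> Obj (LSet U L) \<Longrightarrow> \<exists>!f. f \<in> Hom (LSet U L) (empty_lset L) X"
proof -
  interpret L: category L
    by fact
  have "is_functor L (set_cat U) (empty_lset L)"
  proof (intro is_functor.intro is_functor_axioms.intro category_set_cat \<open>category L\<close>)
    fix f A B assume "f \<in> Hom L A B"
    then show "FMor (empty_lset L) f \<in> Hom (set_cat U) (FOb (empty_lset L) A) (FOb (empty_lset L) B)"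
      using assms(2) L.dom_obj L.cod_obj by (auto simp: empty_lset_def Hom_set_cat Hom_def[of L])
  qed (use assms(2) in \<open>auto simp: empty_lset_def Hom_def compose_def intro!: ext\<close>)
  then show 1: "empty_lset L \<in> Obj (LSet U L)"
    by (simp add: Obj_LSet empty_lset_def)
  assume X: "X \<in> Obj (LSet U L)"
  then interpret X: is_functor L "set_cat U" X
    by (simp add: Obj_LSet)
  have *: "f \<in> Hom (set_cat U) (FOb (empty_lset L) A) (FOb X A) \<longleftrightarrow> f = Arr {} (FOb X A) (\<lambda>x. undefined)"
    if "A \<in> Obj L" for f A
    using that assms(2) X.fob[OF that] by (auto simp: empty_lset_def Hom_set_cat intro: arr_eqI)
  show "\<exists>!f. f \<in> Hom (LSet U L) (empty_lset L) X"
  proof (rule ex1I)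
    show "Arr (empty_lset L) X (\<lambda>A \<in> Obj L. Arr {} (FOb X A) (\<lambda>x. undefined))
        \<in> Hom (LSet U L) (empty_lset L) X" (is "?f \<in> _")
    proof -
      have "Arr {} (FOb X (Cod L f)) (\<lambda>x. undefined) \<cdot>\<^bsub>set_cat U\<^esub> FMor (empty_lset L) f
          = FMor X f \<cdot>\<^bsub>set_cat U\<^esub> Arr {} (FOb X (Dom L f)) (\<lambda>x. undefined)" if "f \<in> Mor L" for f
        using that X.fmor[of f "Dom L f" "Cod L f"]
        by (auto simp: empty_lset_def compose_def Hom_def intro!: ext)
      then show ?thesis
        using 1 X L.dom_obj L.cod_obj unfolding LSet_def Hom_fun_cat
        by (auto simp: * simp del: set_cat_simps)
    qed
  next
    fix f assume "f \<in> Hom (LSet U L) (empty_lset L) X"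
    then show "f = Arr (empty_lset L) X (\<lambda>A \<in> Obj L. Arr {} (FOb X A) (\<lambda>x. undefined))"
      by (auto simp: LSet_def Hom_fun_cat * intro!: arr_eqI extensionalityI[of _ "Obj L"])
  qed
qed

section \<open>Free coproduct completions\<close>

lemma Obj_fam_cat: "p \<in> Obj (fam_cat U C) \<longleftrightarrow> fst p \<in> U \<and> snd p \<in> fst p \<rightarrow>\<^sub>E Obj C"
  by (cases p) (simp add: fam_cat_def)

lemma fam_cat_simps [simp]:
  "Dom (fam_cat U C) = src" "Cod (fam_cat U C) = tgt"
  "Id (fam_cat U C) p = Arr p p (\<lambda>i \<in> fst p. i, \<lambda>i \<in> fst p. Id C (snd p i))"
  "Comp (fam_cat U C) b a = Arr (src a) (tgt b)
    (\<lambda>i \<in> fst (src a). fst (the_map b) (fst (the_map a) i),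
     \<lambda>i \<in> fst (src a). Comp C (snd (the_map b) (fst (the_map a) i)) (snd (the_map a) i))"
  by (auto simp: fam_cat_def Let_def split: prod.splits)

lemma Hom_fam_cat: "a \<in> Hom (fam_cat U C) p q \<longleftrightarrow>
    src a = p \<and> tgt a = q \<and> p \<in> Obj (fam_cat U C) \<and> q \<in> Obj (fam_cat U C) \<and>
    fst (the_map a) \<in> fst p \<rightarrow>\<^sub>E fst q \<and> snd (the_map a) \<in> extensional (fst p) \<and>
    (\<forall>i \<in> fst p. snd (the_map a) i \<in> Hom C (snd p i) (snd q (fst (the_map a) i)))"
  by (cases a; cases p; cases q) (auto simp: Hom_def fam_cat_def)

lemma Mor_fam_cat: "a \<in> Mor (fam_cat U C) \<longleftrightarrow> a \<in> Hom (fam_cat U C) (src a) (tgt a)"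
  by (simp add: Hom_def)

lemma Hom_fam_catD:
  assumes "a \<in> Hom (fam_cat U C) p q"
  shows "src a = p" "tgt a = q" "p \<in> Obj (fam_cat U C)" "q \<in> Obj (fam_cat U C)"
    and "i \<in> fst p \<Longrightarrow> fst (the_map a) i \<in> fst q"
    and "i \<in> fst p \<Longrightarrow> snd (the_map a) i \<in> Hom C (snd p i) (snd q (fst (the_map a) i))"
  using iffD1[OF Hom_fam_cat assms] by (auto simp: PiE_iff)

lemma fam_arr_eqI:
  assumes a: "a \<in> Hom (fam_cat U C) p q" and b: "b \<in> Hom (fam_cat U C) p q"
    and fst: "\<And>i. i \<in> fst p \<Longrightarrow> fst (the_map a) i = fst (the_map b) i"
    and snd: "\<And>i. i \<in> fst p \<Longrightarrow> snd (the_map a) i = snd (the_map b) i"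
  shows "a = b"
proof (rule arr_eqI)
  have "fst (the_map a) = fst (the_map b)" "snd (the_map a) = snd (the_map b)"
    using iffD1[OF Hom_fam_cat a] iffD1[OF Hom_fam_cat b] fst snd
    by (auto intro!: extensionalityI[of _ "fst p"] simp: PiE_iff)
  then show "the_map a = the_map b"
    by (rule prod_eqI)
qed (use Hom_fam_catD(1,2)[OF a] Hom_fam_catD(1,2)[OF b] in simp_all)

lemma category_fam_cat:
  assumes "category C"
  shows "category (fam_cat U C)"
proof -
  interpret category C
    by fact
  have comp: "b \<cdot>\<^bsub>fam_cat U C\<^esub> a \<in> Hom (fam_cat U C) p s"
    if a: "a \<in> Hom (fam_cat U C) p q" and b: "b \<in> Hom (fam_cat U C) q s" for a b p q s
    using Hom_fam_catD[OF a] Hom_fam_catD[OF b]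
      comp_hom[OF Hom_fam_catD(6)[OF a] Hom_fam_catD(6)[OF b Hom_fam_catD(5)[OF a]]]
    by (simp add: Hom_fam_cat)
  have id: "Id (fam_cat U C) p \<in> Hom (fam_cat U C) p p" if "p \<in> Obj (fam_cat U C)" for p
    using that by (auto simp: Hom_fam_cat Obj_fam_cat PiE_iff intro: id_hom)
  show ?thesis
  proof
    fix p q a assume a: "a \<in> Hom (fam_cat U C) p q"
    note obj = Hom_fam_catD(3,4)[OF a]
    show "a \<cdot>\<^bsub>fam_cat U C\<^esub> Id (fam_cat U C) p = a"
      by (rule fam_arr_eqI[OF comp[OF id[OF obj(1)] a] a])
        (simp_all add: comp_id_right[OF Hom_fam_catD(6)[OF a]])
    show "Id (fam_cat U C) q \<cdot>\<^bsub>fam_cat U C\<^esub> a = a"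
      by (rule fam_arr_eqI[OF comp[OF a id[OF obj(2)]] a])
        (simp_all add: comp_id_left[OF Hom_fam_catD(6)[OF a]] Hom_fam_catD[OF a])
    fix s b assume b: "b \<in> Hom (fam_cat U C) q s"
    show "b \<cdot>\<^bsub>fam_cat U C\<^esub> a \<in> Hom (fam_cat U C) p s"
      by (rule comp[OF a b])
    fix t c assume c: "c \<in> Hom (fam_cat U C) s t"
    show "(c \<cdot>\<^bsub>fam_cat U C\<^esub> b) \<cdot>\<^bsub>fam_cat U C\<^esub> a = c \<cdot>\<^bsub>fam_cat U C\<^esub> (b \<cdot>\<^bsub>fam_cat U C\<^esub> a)"
      by (rule fam_arr_eqI[OF comp[OF a comp[OF b c]] comp[OF comp[OF a b] c]])
        (simp_all add: Hom_fam_catD[OF a] Hom_fam_catD[OF b]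
          comp_assoc[OF Hom_fam_catD(6)[OF a] Hom_fam_catD(6)[OF b] Hom_fam_catD(6)[OF c]])
  qed (auto simp: Mor_fam_cat simp del: fam_cat_simps(3) intro: Hom_fam_catD(3,4) id)
qed

lemma fst_fam_sum [simp]: "fst (fam_sum l r p q) = l ` fst p \<union> r ` fst q"
  by (simp add: fam_sum_def split: prod.splits)

locale fam_universe = set_universe U l r + category C
  for U :: "'u set set" and l r :: "'u \<Rightarrow> 'u" and C :: "('o, 'm) category" (structure)
begin

sublocale sum_coding l r
  using inj_l inj_r disjoint_ranges by unfold_locales

abbreviation "F \<equiv> fam_cat U C"
abbreviation "K \<equiv> fam_coproducts l r C"

lemma snd_fam_sum [simp]:
  "i \<in> fst p \<Longrightarrow> snd (fam_sum l r p q) (l i) = snd p i"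
  "j \<in> fst q \<Longrightarrow> snd (fam_sum l r p q) (r j) = snd q j"
  by (auto simp: fam_sum_def the_inv_f_f split: prod.splits)

lemma fam_coproducts_simps [simp]:
  "Zero K = ({}, \<lambda>i \<in> {}. undefined)" "Sum K = fam_sum l r"
  "Inj1 K p q = Arr p (fam_sum l r p q) (\<lambda>i \<in> fst p. l i, \<lambda>i \<in> fst p. Id C (snd p i))"
  "Inj2 K p q = Arr q (fam_sum l r p q) (\<lambda>j \<in> fst q. r j, \<lambda>j \<in> fst q. Id C (snd q j))"
  by (auto simp: fam_coproducts_def split: prod.splits)

lemma fam_sum_Obj: "\<lbrakk>p \<in> Obj F; q \<in> Obj F\<rbrakk> \<Longrightarrow> fam_sum l r p q \<in> Obj F"
proof -
  assume *: "p \<in> Obj F" "q \<in> Obj F"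
  then have "snd (fam_sum l r p q) k \<in> Obj C" if "k \<in> l ` fst p \<union> r ` fst q" for k
    using that by (auto simp: Obj_fam_cat PiE_iff)
  moreover have "snd (fam_sum l r p q) \<in> extensional (l ` fst p \<union> r ` fst q)"
    by (simp add: fam_sum_def split: prod.splits)
  ultimately show ?thesis
    using * sum_small[of "fst p" "fst q"] by (auto simp: Obj_fam_cat PiE_iff)
qed

lemma fam_has_coproducts: "has_coproducts F K"
proof -
  interpret F: category F
    using category_axioms by (rule category_fam_cat)
  have inj1: "Inj1 K p q \<in> Hom F p (fam_sum l r p q)" and inj2: "Inj2 K p q \<in> Hom F q (fam_sum l r p q)"
    if "p \<in> Obj F" "q \<in> Obj F" for p q
    using that fam_sum_Obj[OF that] id_hom by (auto simp: Hom_fam_cat Obj_fam_cat[of p] Obj_fam_cat[of q] PiE_iff)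
  show ?thesis
  proof
    show "Zero K \<in> Obj F"
      using empty_small by (simp add: Obj_fam_cat)
    then show "\<exists>!a. a \<in> Hom F (Zero K) q" if "q \<in> Obj F" for q
      using that by (intro ex1I[of _ "Arr (Zero K) q (\<lambda>i. undefined, \<lambda>i. undefined)"])
        (auto simp: Hom_fam_cat intro!: arr_eqI prod_eqI)
    fix p q s a b assume a: "a \<in> Hom F p s" and b: "b \<in> Hom F q s"
    note obj = Hom_fam_catD(3,4)[OF a] Hom_fam_catD(3)[OF b]
    note i1 = inj1[OF obj(1,3)] and i2 = inj2[OF obj(1,3)]
    let ?pq = "fst (fam_sum l r p q)"
    let ?h = "Arr (fam_sum l r p q) s
      (\<lambda>k \<in> ?pq. if k \<in> range l then fst (the_map a) (inv l k) else fst (the_map b) (inv r k),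
       \<lambda>k \<in> ?pq. if k \<in> range l then snd (the_map a) (inv l k) else snd (the_map b) (inv r k))"
    have h: "?h \<in> Hom F (fam_sum l r p q) s"
      using Hom_fam_catD[OF a] Hom_fam_catD[OF b] fam_sum_Obj[OF obj(1,3)] by (auto simp: Hom_fam_cat)
    show "\<exists>!h. h \<in> Hom F (Sum K p q) s \<and> h \<cdot>\<^bsub>F\<^esub> Inj1 K p q = a \<and> h \<cdot>\<^bsub>F\<^esub> Inj2 K p q = b"
    proof (rule ex1I[of _ ?h])
      have "?h \<cdot>\<^bsub>F\<^esub> Inj1 K p q = a"
        by (rule fam_arr_eqI[OF F.comp_hom[OF i1 h] a])
          (simp_all add: comp_id_right[OF Hom_fam_catD(6)[OF a]])
      moreover have "?h \<cdot>\<^bsub>F\<^esub> Inj2 K p q = b"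
        by (rule fam_arr_eqI[OF F.comp_hom[OF i2 h] b])
          (auto simp: comp_id_right[OF Hom_fam_catD(6)[OF b]])
      ultimately show "?h \<in> Hom F (Sum K p q) s \<and> ?h \<cdot>\<^bsub>F\<^esub> Inj1 K p q = a \<and> ?h \<cdot>\<^bsub>F\<^esub> Inj2 K p q = b"
        using h by simp
    next
      fix h' assume "h' \<in> Hom F (Sum K p q) s \<and> h' \<cdot>\<^bsub>F\<^esub> Inj1 K p q = a \<and> h' \<cdot>\<^bsub>F\<^esub> Inj2 K p q = b"
      then have h': "h' \<in> Hom F (fam_sum l r p q) s" and ab: "a = h' \<cdot>\<^bsub>F\<^esub> Inj1 K p q" "b = h' \<cdot>\<^bsub>F\<^esub> Inj2 K p q"
        by auto
      have *: "fst (the_map h') (l i) = fst (the_map a) i \<and> snd (the_map h') (l i) = snd (the_map a) i"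
        if "i \<in> fst p" for i
        using that Hom_fam_catD(6)[OF h', of "l i"] comp_id_right unfolding ab by auto
      have **: "fst (the_map h') (r i) = fst (the_map b) i \<and> snd (the_map h') (r i) = snd (the_map b) i"
        if "i \<in> fst q" for i
        using that Hom_fam_catD(6)[OF h', of "r i"] comp_id_right unfolding ab by auto
      show "h' = ?h"
        by (rule fam_arr_eqI[OF h' h]) (use * ** in auto)
    qed
  qed (use inj1 inj2 fam_sum_Obj in simp_all)
qed

sublocale fam: cocartesian_category F K
  using fam_has_coproducts by (simp add: cocartesian_category_def)

text \<open>Composing with the injections, whose labels are identities, recovers \<open>a\<close> and \<open>b\<close>.\<close>

lemma fam_copair:
  assumes a: "a \<in> Hom F p s" and b: "b \<in> Hom F q s"
  shows "i \<in> fst p \<Longrightarrow> fst (the_map (copair F K a b)) (l i) = fst (the_map a) i"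
    and "i \<in> fst p \<Longrightarrow> snd (the_map (copair F K a b)) (l i) = snd (the_map a) i"
    and "j \<in> fst q \<Longrightarrow> fst (the_map (copair F K a b)) (r j) = fst (the_map b) j"
    and "j \<in> fst q \<Longrightarrow> snd (the_map (copair F K a b)) (r j) = snd (the_map b) j"
proof -
  let ?h = "copair F K a b"
  have h: "?h \<in> Hom F (fam_sum l r p q) s" and eqs: "?h \<cdot>\<^bsub>F\<^esub> Inj1 K p q = a" "?h \<cdot>\<^bsub>F\<^esub> Inj2 K p q = b"
    using fam.copair_universal[of a b] a b by (auto simp: Hom_def)
  have l: "fst (the_map ?h) (l i) = fst (the_map (?h \<cdot>\<^bsub>F\<^esub> Inj1 K p q)) i
      \<and> snd (the_map ?h) (l i) = snd (the_map (?h \<cdot>\<^bsub>F\<^esub> Inj1 K p q)) i" if "i \<in> fst p"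
    using that Hom_fam_catD(6)[OF h, of "l i"] comp_id_right by auto
  have r: "fst (the_map ?h) (r j) = fst (the_map (?h \<cdot>\<^bsub>F\<^esub> Inj2 K p q)) j
      \<and> snd (the_map ?h) (r j) = snd (the_map (?h \<cdot>\<^bsub>F\<^esub> Inj2 K p q)) j" if "j \<in> fst q"
    using that Hom_fam_catD(6)[OF h, of "r j"] comp_id_right by auto
  show "i \<in> fst p \<Longrightarrow> fst (the_map ?h) (l i) = fst (the_map a) i"
    and "i \<in> fst p \<Longrightarrow> snd (the_map ?h) (l i) = snd (the_map a) i"
    and "j \<in> fst q \<Longrightarrow> fst (the_map ?h) (r j) = fst (the_map b) j"
    and "j \<in> fst q \<Longrightarrow> snd (the_map ?h) (r j) = snd (the_map b) j"
    using l r unfolding eqs by auto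
qed

lemma singleton_terminal:
  assumes t: "t \<in> Obj C" and ex1: "\<And>A. A \<in> Obj C \<Longrightarrow> \<exists>!f. f \<in> Hom C A t"
  shows "terminal F (singleton_fam t)"
  unfolding terminal_def
proof (intro conjI ballI)
  show "singleton_fam t \<in> Obj F"
    using t singleton_small by (simp add: singleton_fam_def Obj_fam_cat)
  fix p assume p: "p \<in> Obj F"
  then have *: "\<exists>!f. f \<in> Hom C (snd p i) t" if "i \<in> fst p" for i
    using that ex1 by (auto simp: Obj_fam_cat PiE_iff)
  let ?a = "Arr p (singleton_fam t) (\<lambda>i \<in> fst p. undefined, \<lambda>i \<in> fst p. THE f. f \<in> Hom C (snd p i) t)"
  have a: "?a \<in> Hom F p (singleton_fam t)"
    using p \<open>singleton_fam t \<in> Obj F\<close> theI'[OF *] by (auto simp: Hom_fam_cat singleton_fam_def)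
  show "\<exists>!f. f \<in> Hom F p (singleton_fam t)"
  proof (rule ex1I, rule a, rule fam_arr_eqI[OF _ a])
    fix f i assume f: "f \<in> Hom F p (singleton_fam t)" and i: "i \<in> fst p"
    show "fst (the_map f) i = fst (the_map ?a) i"
      using Hom_fam_catD(5)[OF f i] i by (simp add: singleton_fam_def)
    show "snd (the_map f) i = snd (the_map ?a) i"
      using Hom_fam_catD(5,6)[OF f i] Hom_fam_catD(5,6)[OF a i] *[OF i] i
      by (auto simp: singleton_fam_def)
  qed
qed

end

section \<open>The Kleisli category of a free coproduct completion\<close>

locale fam_star = fam_universe U l r C
  for U :: "'u set set" and l r :: "'u \<Rightarrow> 'u" and C :: "('o, 'm) category" (structure) +
  fixes t :: 'o
  assumes t_Obj: "t \<in> Obj C" and t_terminal: "A \<in> Obj C \<Longrightarrow> \<exists>!f. f \<in> Hom C A t"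
begin

abbreviation "one \<equiv> singleton_fam t :: ('u, 'o) fam"
abbreviation "S \<equiv> star F K one"
abbreviation "SK \<equiv> star_coproducts F K one"

lemma one_Obj: "one \<in> Obj F"
  using singleton_terminal[OF t_Obj t_terminal] by (simp add: terminal_def)

lemma fst_one [simp]: "fst one = {undefined}" and snd_one [simp]: "snd one undefined = t"
  by (simp_all add: singleton_fam_def)

text \<open>The only index of \<open>one\<close> is \<open>undefined\<close>, so an index is sent into the added summand precisely when
  its value is \<open>r undefined\<close>; there the labelled map is undefined and the label is dropped.\<close>

definition kleisli_rep :: "(('u, 'o) fam, ('u, 'o, 'm) fam_arr) arr \<Rightarrow> ('u, 'm) labelled_map"
  where "kleisli_rep k i =
    (let (f, \<phi>) = the_map (the_map k)
     in if i \<in> fst (src k) \<and> f i \<in> range l then Some (inv l (f i), \<phi> i) else None)"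

lemma kleisli_rep_Some: "kleisli_rep k i = Some (j, m) \<longleftrightarrow>
    i \<in> fst (src k) \<and> fst (the_map (the_map k)) i = l j \<and> m = snd (the_map (the_map k)) i"
  by (auto simp: kleisli_rep_def split: prod.splits)

lemma kleisli_rep_None: "kleisli_rep k i = None \<longleftrightarrow>
    i \<notin> fst (src k) \<or> fst (the_map (the_map k)) i \<notin> range l"
  by (auto simp: kleisli_rep_def split: prod.splits)

lemma S_HomD:
  assumes "k \<in> Hom S p q"
  shows "src k = p" "tgt k = q" "p \<in> Obj F" "q \<in> Obj F" "the_map k \<in> Hom F p (fam_sum l r q one)"
  using assms by (auto simp: Hom_star)

lemma kleisli_cases:
  assumes k: "k \<in> Hom S p q" and i: "i \<in> fst p"
  obtains j where "j \<in> fst q" "fst (the_map (the_map k)) i = l j"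
      "snd (the_map (the_map k)) i \<in> Hom C (snd p i) (snd q j)"
  | "fst (the_map (the_map k)) i = r undefined" "snd (the_map (the_map k)) i \<in> Hom C (snd p i) t"
  using Hom_fam_catD(5,6)[OF S_HomD(5)[OF k] i] by fastforce

text \<open>A dropped label is a map to the terminal object \<open>t\<close> and can be recovered.\<close>

lemma kleisli_rep_inj:
  assumes k: "k \<in> Hom S p q" and k': "k' \<in> Hom S p q" and eq: "kleisli_rep k = kleisli_rep k'"
  shows "k = k'"
proof -
  have "fst (the_map (the_map k)) i = fst (the_map (the_map k')) i
      \<and> snd (the_map (the_map k)) i = snd (the_map (the_map k')) i" if i: "i \<in> fst p" for i
  proof (cases "kleisli_rep k i")
    case None
    then have "kleisli_rep k' i = None"
      using eq by simp
    with None have "fst (the_map (the_map k)) i \<notin> range l" "fst (the_map (the_map k')) i \<notin> range l"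
      using i S_HomD(1)[OF k] S_HomD(1)[OF k'] unfolding kleisli_rep_None by auto
    moreover have "\<exists>!f. f \<in> Hom C (snd p i) t"
      using i S_HomD(3)[OF k] by (auto simp: Obj_fam_cat PiE_iff intro!: t_terminal)
    ultimately show ?thesis
      by (cases rule: kleisli_cases[OF k i]; cases rule: kleisli_cases[OF k' i]) auto
  next
    case (Some z)
    then show ?thesis
      using eq by (cases z) (metis kleisli_rep_Some)
  qed
  then have "the_map k = the_map k'"
    by (intro fam_arr_eqI[OF S_HomD(5)[OF k] S_HomD(5)[OF k']]) auto
  then show ?thesis
    using S_HomD(1,2)[OF k] S_HomD(1,2)[OF k'] by (intro arr_eqI) auto
qed

lemma kleisli_rep_surj:
  assumes p: "p \<in> Obj F" and q: "q \<in> Obj F" and x: "x \<in> labelled_maps C (fst p) (snd p) (fst q) (snd q)"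
  shows "\<exists>k \<in> Hom S p q. kleisli_rep k = x"
proof
  let ?f = "\<lambda>i \<in> fst p. case x i of None \<Rightarrow> r undefined | Some (j, m) \<Rightarrow> l j"
  let ?\<phi> = "\<lambda>i \<in> fst p. case x i of None \<Rightarrow> THE f. f \<in> Hom C (snd p i) t | Some (j, m) \<Rightarrow> m"
  let ?a = "Arr p (fam_sum l r q one) (?f, ?\<phi>)"
  have t: "(THE f. f \<in> Hom C (snd p i) t) \<in> Hom C (snd p i) t" if "i \<in> fst p" for i
    using that p by (intro theI'[OF t_terminal]) (auto simp: Obj_fam_cat PiE_iff)
  have "?a \<in> Hom F p (fam_sum l r q one)"
    using p q fam_sum_Obj[OF q one_Obj] t labelled_mapsD[OF x]
    by (auto simp: Hom_fam_cat split: option.splits)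
  then show "Arr p q ?a \<in> Hom S p q"
    using p q by (auto simp: Hom_star)
  show "kleisli_rep (Arr p q ?a) = x"
  proof
    fix i show "kleisli_rep (Arr p q ?a) i = x i"
      using labelled_mapsD(1)[OF x, of i]
      by (cases "x i") (auto simp: kleisli_rep_None kleisli_rep_Some)
  qed
qed

lemma kleisli_rep_typed:
  assumes k: "k \<in> Hom S p q"
  shows "kleisli_rep k \<in> labelled_maps C (fst p) (snd p) (fst q) (snd q)"
  unfolding labelled_maps_def mem_Collect_eq
proof (intro allI impI)
  fix i j m assume "kleisli_rep k i = Some (j, m)"
  then have *: "i \<in> fst p" "fst (the_map (the_map k)) i = l j" "m = snd (the_map (the_map k)) i"
    using S_HomD(1)[OF k] by (auto simp: kleisli_rep_Some)
  from k *(1) show "i \<in> fst p \<and> j \<in> fst q \<and> m \<in> Hom C (snd p i) (snd q j)"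
    by (cases rule: kleisli_cases) (use * in auto)
qed

lemma kleisli_rep_bij:
  assumes "p \<in> Obj F" "q \<in> Obj F"
  shows "bij_betw kleisli_rep (Hom S p q) (labelled_maps C (fst p) (snd p) (fst q) (snd q))"
  unfolding bij_betw_def inj_on_def
  using kleisli_rep_inj kleisli_rep_typed kleisli_rep_surj[OF assms] by blast

lemma kleisli_rep_comp:
  assumes f: "f \<in> Hom S p q" and g: "g \<in> Hom S q s"
  shows "kleisli_rep (g \<cdot>\<^bsub>S\<^esub> f) = labelled_comp C (kleisli_rep g) (kleisli_rep f)"
proof
  fix i
  let ?h = "copair F K (the_map g) (Inj2 K s one)"
  have i2: "Inj2 K s one \<in> Hom F one (fam_sum l r s one)"
    using fam.inj2_hom[OF S_HomD(4)[OF g] one_Obj] by simp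
  have gf: "g \<cdot>\<^bsub>S\<^esub> f = Arr p s (?h \<cdot>\<^bsub>F\<^esub> the_map f)"
    by (rule fam.star_comp[OF one_Obj f g])
  note h = fam_copair[OF S_HomD(5)[OF g] i2]
  show "kleisli_rep (g \<cdot>\<^bsub>S\<^esub> f) i = labelled_comp C (kleisli_rep g) (kleisli_rep f) i"
  proof (cases "i \<in> fst p")
    case False
    then have "kleisli_rep (g \<cdot>\<^bsub>S\<^esub> f) i = None" "kleisli_rep f i = None"
      using S_HomD(1)[OF f] gf by (simp_all add: kleisli_rep_None)
    then show ?thesis
      by (simp add: labelled_comp_def)
  next
    case True
    from f True show ?thesis
    proof (cases rule: kleisli_cases)
      case (1 j)
      then have "kleisli_rep f i = Some (j, snd (the_map (the_map f)) i)"
        using True S_HomD(1)[OF f] by (simp add: kleisli_rep_Some)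
      then show ?thesis
        using True 1 h(1,2)[of j] S_HomD(1)[OF g] Hom_fam_catD(1)[OF S_HomD(5)[OF f]]
        by (cases "fst (the_map (the_map g)) j \<in> range l")
          (auto simp: gf labelled_comp_def kleisli_rep_def split: prod.splits)
    next
      case 2
      then have "kleisli_rep (g \<cdot>\<^bsub>S\<^esub> f) i = None"
        using True h(3)[of undefined] Hom_fam_catD(1)[OF S_HomD(5)[OF f]]
        by (auto simp: gf kleisli_rep_None)
      moreover have "kleisli_rep f i = None"
        using 2 by (auto simp: kleisli_rep_None)
      ultimately show ?thesis
        by (simp add: labelled_comp_def)
    qed
  qed
qed

lemma fam_sum_inject:
  assumes p: "p \<in> Obj F" and q: "q \<in> Obj F" and eq: "fam_sum l r p s = fam_sum l r q s"
  shows "p = q"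
proof (rule prod_eqI)
  have "l ` fst p \<union> r ` fst s = l ` fst q \<union> r ` fst s"
    using arg_cong[OF eq, of fst] by simp
  then have "l i \<in> l ` fst p \<union> r ` fst s \<longleftrightarrow> l i \<in> l ` fst q \<union> r ` fst s" for i
    by simp
  then show idx: "fst p = fst q"
    by auto
  show "snd p = snd q"
  proof (rule extensionalityI[of _ "fst p"])
    fix i assume "i \<in> fst p"
    then show "snd p i = snd q i"
      using idx snd_fam_sum(1)[of i p s] snd_fam_sum(1)[of i q s] eq by simp
  qed (use p q idx in \<open>auto simp: Obj_fam_cat PiE_iff\<close>)
qed

lemma star_coproducts_simps [simp]:
  "Zero SK = Zero K" "Sum SK = fam_sum l r"
  "Inj1 SK p q = Arr p (fam_sum l r p q) (Inj1 K (fam_sum l r p q) one \<cdot>\<^bsub>F\<^esub> Inj1 K p q)"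
  "Inj2 SK p q = Arr q (fam_sum l r p q) (Inj1 K (fam_sum l r p q) one \<cdot>\<^bsub>F\<^esub> Inj2 K p q)"
  by (simp_all add: star_coproducts_def)

lemma star_injections:
  assumes p: "p \<in> Obj F" and q: "q \<in> Obj F"
  shows "Inj1 SK p q \<in> Hom S p (fam_sum l r p q)" "Inj2 SK p q \<in> Hom S q (fam_sum l r p q)"
    and "kleisli_rep (Inj1 SK p q) = (\<lambda>i. if i \<in> fst p then Some (l i, Id C (snd p i)) else None)"
    and "kleisli_rep (Inj2 SK p q) = (\<lambda>j. if j \<in> fst q then Some (r j, Id C (snd q j)) else None)"
proof -
  have pq: "fam_sum l r p q \<in> Obj F"
    by (rule fam_sum_Obj[OF p q])
  show "Inj1 SK p q \<in> Hom S p (fam_sum l r p q)" "Inj2 SK p q \<in> Hom S q (fam_sum l r p q)"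
    using p q pq fam.comp_hom[OF fam.inj1_hom[OF p q], of "Inj1 K (fam_sum l r p q) one"]
      fam.comp_hom[OF fam.inj2_hom[OF p q], of "Inj1 K (fam_sum l r p q) one"]
      fam.inj1_hom[OF pq one_Obj]
    by (simp_all add: Hom_star del: fam_cat_simps fam_coproducts_simps(3,4))
  have "Id C (snd p i) \<cdot> Id C (snd p i) = Id C (snd p i)" if "i \<in> fst p" for i
    using that p by (auto simp: Obj_fam_cat PiE_iff)
  then show "kleisli_rep (Inj1 SK p q) = (\<lambda>i. if i \<in> fst p then Some (l i, Id C (snd p i)) else None)"
    by (auto simp: kleisli_rep_def)
  have "Id C (snd q j) \<cdot> Id C (snd q j) = Id C (snd q j)" if "j \<in> fst q" for j
    using that q by (auto simp: Obj_fam_cat PiE_iff)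
  then show "kleisli_rep (Inj2 SK p q) = (\<lambda>j. if j \<in> fst q then Some (r j, Id C (snd q j)) else None)"
    by (auto simp: kleisli_rep_def)
qed

lemma kleisli_labelled: "labelled_partial_category C S l r SK fst snd kleisli_rep"
proof -
  interpret S: category S
    by (rule fam.category_star[OF one_Obj])
  show ?thesis
    apply unfold_locales
    subgoal by (auto simp: Obj_fam_cat PiE_iff)
    subgoal for p q
      by (rule kleisli_rep_bij) simp_all
    subgoal by (auto simp: kleisli_rep_def)
    subgoal by (rule kleisli_rep_comp)
    subgoal using fam.zero_obj by simp
    subgoal by simp
    subgoal by (simp add: fam_sum_Obj)
    subgoal using fam_sum_inject by simp
    subgoal by simp
    subgoal using star_injections(1) by simp
    subgoal using star_injections(3) by simp
    subgoal using star_injections(2) by simp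
    subgoal using star_injections(4) by simp
    done
qed

sublocale kleisli: labelled_partial_category C S l r SK fst snd kleisli_rep
  by (rule kleisli_labelled)

lemma star_uniform_traced_fam: "star_uniform_traced F K one kleisli.trace"
  unfolding star_uniform_traced_def star_monoidal_def
  using fam_has_coproducts singleton_terminal[OF t_Obj t_terminal] kleisli.has_coproducts_axioms
    kleisli.uniform_traced_category_M by blast

end

section \<open>Sets and partial functions\<close>

text \<open>With labels in the one-morphism category, labelled maps are partial functions.\<close>

definition unit_cat :: "(unit, unit) category"
  where "unit_cat = \<lparr>Obj = UNIV, Mor = UNIV, Dom = (\<lambda>_. ()), Cod = (\<lambda>_. ()), Id = (\<lambda>_. ()), Comp = (\<lambda>_ _. ())\<rparr>"

lemma category_unit_cat: "category unit_cat"
  by unfold_locales (auto simp: unit_cat_def Hom_def)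

lemma Hom_unit_cat [simp]: "Hom unit_cat A B = UNIV"
  by (auto simp: unit_cat_def Hom_def)

lemma pset_cat_simps [simp]:
  "Obj (pset_cat V) = V" "Dom (pset_cat V) = src" "Cod (pset_cat V) = tgt"
  "Id (pset_cat V) A = Arr A A (Some |` A)"
  "Comp (pset_cat V) g f = Arr (src f) (tgt g) (the_map g \<circ>\<^sub>m the_map f)"
  by (simp_all add: pset_cat_def)

lemma Hom_pset_cat: "f \<in> Hom (pset_cat V) A B \<longleftrightarrow>
    src f = A \<and> tgt f = B \<and> A \<in> V \<and> B \<in> V \<and> dom (the_map f) \<subseteq> A \<and> ran (the_map f) \<subseteq> B"
  by (cases f) (auto simp: Hom_def pset_cat_def)

lemma Mor_pset_cat: "f \<in> Mor (pset_cat V) \<longleftrightarrow> f \<in> Hom (pset_cat V) (src f) (tgt f)"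
  by (simp add: Hom_def)

lemma Hom_pset_catD:
  assumes "f \<in> Hom (pset_cat V) A B"
  shows "src f = A" "tgt f = B" "A \<in> V" "B \<in> V"
    and "the_map f i = Some j \<Longrightarrow> i \<in> A" "the_map f i = Some j \<Longrightarrow> j \<in> B"
  using iffD1[OF Hom_pset_cat assms] by (auto intro: ranI)

lemma category_pset_cat: "category (pset_cat V)"
proof
  fix A B f assume f: "f \<in> Hom (pset_cat V) A B"
  have "the_map f \<circ>\<^sub>m (Some |` A) = the_map f" "(Some |` B) \<circ>\<^sub>m the_map f = the_map f"
    using Hom_pset_catD(5,6)[OF f]
    by (auto simp: map_comp_def restrict_map_def fun_eq_iff split: option.splits)
       (metis not_None_eq)+
  then show "f \<cdot>\<^bsub>pset_cat V\<^esub> Id (pset_cat V) A = f" "Id (pset_cat V) B \<cdot>\<^bsub>pset_cat V\<^esub> f = f"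
    using Hom_pset_catD(1,2)[OF f] by (cases f; simp)+
  fix D g assume g: "g \<in> Hom (pset_cat V) B D"
  show "g \<cdot>\<^bsub>pset_cat V\<^esub> f \<in> Hom (pset_cat V) A D"
    using Hom_pset_catD[OF f] Hom_pset_catD[OF g]
    by (auto simp: Hom_pset_cat ran_def map_comp_Some_iff)
  fix E h assume h: "h \<in> Hom (pset_cat V) D E"
  show "(h \<cdot>\<^bsub>pset_cat V\<^esub> g) \<cdot>\<^bsub>pset_cat V\<^esub> f = h \<cdot>\<^bsub>pset_cat V\<^esub> (g \<cdot>\<^bsub>pset_cat V\<^esub> f)"
    by (auto simp: map_comp_def fun_eq_iff split: option.splits)
qed (auto simp: Mor_pset_cat Hom_pset_cat ran_def restrict_map_def split: if_splits)

definition pset_rep :: "'u pset_arr \<Rightarrow> ('u, unit) labelled_map"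
  where "pset_rep f i = map_option (\<lambda>j. (j, ())) (the_map f i)"

lemma pset_rep_Some [simp]: "pset_rep f i = Some (j, m) \<longleftrightarrow> the_map f i = Some j"
  by (auto simp: pset_rep_def)

lemma pset_coproducts_simps [simp]:
  "Zero (pset_coproducts l r) = {}" "Sum (pset_coproducts l r) A B = l ` A \<union> r ` B"
  "Inj1 (pset_coproducts l r) A B = Arr A (l ` A \<union> r ` B) ((Some \<circ> l) |` A)"
  "Inj2 (pset_coproducts l r) A B = Arr B (l ` A \<union> r ` B) ((Some \<circ> r) |` B)"
  by (simp_all add: pset_coproducts_def)

lemma map_option_unit: "map_option (\<lambda>z. (fst z, ())) y = y"
  by (cases y) auto

lemma (in set_universe) labelled_pset_cat:
  "labelled_partial_category unit_cat (pset_cat U) l r (pset_coproducts l r) (\<lambda>A. A) (\<lambda>_ _. ()) pset_rep"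
proof -
  interpret E: category unit_cat
    by (rule category_unit_cat)
  interpret P: category "pset_cat U"
    by (rule category_pset_cat)
  interpret sum_coding l r
    using inj_l inj_r disjoint_ranges by unfold_locales
  have bij: "bij_betw pset_rep (Hom (pset_cat U) A B) (labelled_maps unit_cat A (\<lambda>_. ()) B (\<lambda>_. ()))"
    if "A \<in> U" "B \<in> U" for A B
  proof (rule bij_betw_byWitness[where f' = "\<lambda>x. Arr A B (map_option fst \<circ> x)"])
    show "\<forall>f \<in> Hom (pset_cat U) A B. Arr A B (map_option fst \<circ> pset_rep f) = f"
      by (auto intro!: arr_eqI simp: Hom_pset_cat pset_rep_def fun_eq_iff option.map_comp comp_def option.map_ident)
    show "\<forall>x \<in> labelled_maps unit_cat A (\<lambda>_. ()) B (\<lambda>_. ()). pset_rep (Arr A B (map_option fst \<circ> x)) = x"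
      by (auto simp: pset_rep_def fun_eq_iff option.map_comp comp_def map_option_unit)
    show "pset_rep ` Hom (pset_cat U) A B \<subseteq> labelled_maps unit_cat A (\<lambda>_. ()) B (\<lambda>_. ())"
      by (auto simp: labelled_maps_def dest: Hom_pset_catD)
    show "(\<lambda>x. Arr A B (map_option fst \<circ> x)) ` labelled_maps unit_cat A (\<lambda>_. ()) B (\<lambda>_. ())
        \<subseteq> Hom (pset_cat U) A B"
      using that by (auto simp: Hom_pset_cat labelled_maps_def ran_def)
  qed
  have inject: "A = A'" if "l ` A \<union> r ` B = l ` A' \<union> r ` B" for A A' B
  proof -
    have "l i \<in> l ` A \<union> r ` B \<longleftrightarrow> l i \<in> l ` A' \<union> r ` B" for i
      using that by simp
    then show ?thesis
      by auto
  qed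
  show ?thesis
    apply unfold_locales
    subgoal by (simp add: unit_cat_def)
    subgoal using bij by simp
    subgoal by (auto simp: pset_rep_def restrict_map_def)
    subgoal by (auto simp: pset_rep_def labelled_comp_def map_comp_def fun_eq_iff split: option.splits)
    subgoal by (simp add: empty_small)
    subgoal by simp
    subgoal by (simp add: sum_small)
    subgoal for p q s using inject[of p q s] by simp
    subgoal by simp
    subgoal by (auto simp: Hom_pset_cat sum_small ran_def restrict_map_def split: if_splits)
    subgoal by (auto simp: pset_rep_def restrict_map_def)
    subgoal by (auto simp: Hom_pset_cat sum_small ran_def restrict_map_def split: if_splits)
    subgoal by (auto simp: pset_rep_def restrict_map_def)
    done
qed

locale pset_universe = set_universe V l r
  for V :: "'u set set" and l r :: "'u \<Rightarrow> 'u"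
begin

sublocale labelled_partial_category unit_cat "pset_cat V" l r "pset_coproducts l r" "\<lambda>A. A" "\<lambda>_ _. ()" pset_rep
  by (rule labelled_pset_cat)

text \<open>\<open>reaches\<close> iterates \<open>f\<close> itself, from any element of \<open>A + W\<close>, whereas \<open>exits\<close> iterates its restriction
  to \<open>W\<close>; hence the first step is split off.\<close>

lemma reaches_iff_exits:
  assumes f: "f \<in> Hom (pset_cat V) (l ` A \<union> r ` W) (l ` B \<union> r ` W)" and obj: "A \<in> V" "B \<in> V" "W \<in> V"
  defines "f2 \<equiv> f \<cdot>\<^bsub>pset_cat V\<^esub> Inj2 (pset_coproducts l r) A W"
  shows "reaches l r (the_map f) z b \<longleftrightarrow> the_map f z = Some (l b) \<or>
    (\<exists>u. the_map f z = Some (r u) \<and> exits unit_cat l r (pset_rep f2) u b ())"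
proof
  have f2: "the_map f2 u = (if u \<in> W then the_map f (r u) else None)" for u
    by (simp add: f2_def map_comp_def restrict_map_def)
  show "reaches l r (the_map f) z b \<Longrightarrow> the_map f z = Some (l b) \<or>
    (\<exists>u. the_map f z = Some (r u) \<and> exits unit_cat l r (pset_rep f2) u b ())"
  proof (induction rule: reaches.induct)
    case (loop z u b)
    have "u \<in> W"
      using Hom_pset_catD(6)[OF f loop.hyps(1)] by auto
    have "exits unit_cat l r (pset_rep f2) u b ()"
      using loop.IH
    proof
      assume "the_map f (r u) = Some (l b)"
      with \<open>u \<in> W\<close> show ?thesis
        by (intro exits.exit) (simp add: f2)
    next
      assume "\<exists>u'. the_map f (r u) = Some (r u') \<and> exits unit_cat l r (pset_rep f2) u' b ()"
      then obtain u' where "pset_rep f2 u = Some (r u', ())" "exits unit_cat l r (pset_rep f2) u' b ()"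
        using \<open>u \<in> W\<close> by (auto simp: f2)
      then have "exits unit_cat l r (pset_rep f2) u b (Comp unit_cat () ())"
        by (rule exits.loop)
      then show ?thesis
        by simp
    qed
    then show ?case
      using loop.hyps(1) by blast
  qed auto
  have "reaches l r (the_map f) (r u) b" if "exits unit_cat l r (pset_rep f2) u b m" for u m
    using that
    by (induction rule: exits.induct) (auto simp: f2 split: if_splits intro: reaches.intros)
  then show "the_map f z = Some (l b) \<or>
      (\<exists>u. the_map f z = Some (r u) \<and> exits unit_cat l r (pset_rep f2) u b ())
    \<Longrightarrow> reaches l r (the_map f) z b"
    by (auto intro: reaches.intros)
qed

lemma pset_trace_eq:
  assumes f: "f \<in> Hom (pset_cat V) (l ` A \<union> r ` W) (l ` B \<union> r ` W)" and obj: "A \<in> V" "B \<in> V" "W \<in> V"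
  shows "pset_trace l r A B W f = trace A B W f"
proof -
  let ?f1 = "f \<cdot>\<^bsub>pset_cat V\<^esub> Inj1 (pset_coproducts l r) A W"
  let ?f2 = "f \<cdot>\<^bsub>pset_cat V\<^esub> Inj2 (pset_coproducts l r) A W"
  have f1: "?f1 \<in> Hom (pset_cat V) A (Sum (pset_coproducts l r) B W)"
    and f2: "?f2 \<in> Hom (pset_cat V) W (Sum (pset_coproducts l r) B W)"
    using f comp_hom[OF inj1_hom[of A W]] comp_hom[OF inj2_hom[of A W]] obj by simp_all
  have tr: "trace A B W f \<in> Hom (pset_cat V) A B"
    using trace_hom f obj by simp
  have obj': "B \<in> Obj (pset_cat V)" "W \<in> Obj (pset_cat V)"
    using obj by simp_all
  have f1_map: "the_map ?f1 a = (if a \<in> A then the_map f (l a) else None)" for a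
    by (simp add: map_comp_def restrict_map_def)
  have id: "Id (pset_cat V) B \<in> Hom (pset_cat V) B B"
    using obj by (intro id_hom) simp
  have key: "the_map (trace A B W f) a = Some b \<longleftrightarrow> a \<in> A \<and> reaches l r (the_map f) (l a) b" for a b
  proof -
    have "the_map (trace A B W f) a = Some b \<longleftrightarrow> pset_rep (trace A B W f) a = Some (b, ())"
      by simp
    also have "\<dots> \<longleftrightarrow> a \<in> A \<and> reaches l r (the_map f) (l a) b"
      unfolding trace_def rep_copair_comp[OF id iter_hom[OF f2 obj'(1,2)] f1]
        rep_iter[OF f2 obj'(1,2)] rep_Id_Some[OF obj'(1)] reaches_iff_exits[OF f obj]
      using Hom_pset_catD(6)[OF f, of "l a" "l b"] by (auto simp del: pset_cat_simps(5) pset_coproducts_simps(3,4) simp: f1_map split: if_splits)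
    finally show ?thesis .
  qed
  have unique: "b = b'" if "reaches l r (the_map f) (l a) b" "reaches l r (the_map f) (l a) b'" "a \<in> A" for a b b'
    using that key by (metis option.inject)
  have "the_map (pset_trace l r A B W f) a = the_map (trace A B W f) a" for a
  proof (cases "the_map (trace A B W f) a")
    case None
    then have "\<not> (a \<in> A \<and> (\<exists>b. reaches l r (the_map f) (l a) b))"
      using key[of a] by auto
    then show ?thesis
      using None by (simp add: pset_trace_def)
  next
    case (Some b)
    then have "a \<in> A" "reaches l r (the_map f) (l a) b"
      using key by auto
    moreover from this have "(THE b. reaches l r (the_map f) (l a) b) = b"
      using unique by blast
    ultimately show ?thesis
      using Some by (auto simp: pset_trace_def)
  qed
  then show ?thesis
    using Hom_pset_catD(1,2)[OF tr] by (intro arr_eqI ext) (simp_all add: pset_trace_def)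
qed

lemma iteration_trace_pset:
  "iteration_trace (pset_cat V) (pset_coproducts l r) le iter (pset_trace l r)"
proof unfold_locales
  fix A B W f
  assume "A \<in> Obj (pset_cat V)" "B \<in> Obj (pset_cat V)" "W \<in> Obj (pset_cat V)"
    "f \<in> Hom (pset_cat V) (Sum (pset_coproducts l r) A W) (Sum (pset_coproducts l r) B W)"
  then show "pset_trace l r A B W f = copair (pset_cat V) (pset_coproducts l r) (Id (pset_cat V) B)
      (iter (f \<cdot>\<^bsub>pset_cat V\<^esub> Inj2 (pset_coproducts l r) A W))
      \<cdot>\<^bsub>pset_cat V\<^esub> (f \<cdot>\<^bsub>pset_cat V\<^esub> Inj1 (pset_coproducts l r) A W)"
    using pset_trace_eq[of f A W B] unfolding trace_def by simp
qed

end

section \<open>Evaluation functors\<close>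

lemma exp_set_iff [simp]: "(i, \<alpha>) \<in> exp_set D p X \<longleftrightarrow> i \<in> fst p \<and> \<alpha> \<in> Hom D (snd p i) X"
  by (simp add: exp_set_def split: prod.splits)

text \<open>The functor \<open>G\<close> is only known through its values, so that a functor given by any other formula can be
  shown to be an evaluation.  Labels live in \<open>opp D\<close>: the label \<open>m\<close> of \<open>i \<mapsto> j\<close> is a morphism from
  \<open>snd q j\<close> to \<open>snd p i\<close> of \<open>D\<close>, and \<open>\<alpha>\<close> is composed with it on the right.\<close>

locale evaluation = D: category D + fam_star U l r "opp D" t + P: pset_universe V l' r'
  for D :: "('o, 'm) category" and U :: "'u set set" and l r t
    and V :: "('u \<times> 'm) set set" and l' r' +
  fixes X :: 'o and G :: "(('u, 'o) fam, (('u, 'o) fam, ('u, 'o, 'm) fam_arr) arr,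
    ('u \<times> 'm) set, ('u \<times> 'm) pset_arr) cat_functor"
  assumes exp_small: "p \<in> Obj F \<Longrightarrow> exp_set D p X \<in> V"
    and G_ob: "p \<in> Obj F \<Longrightarrow> FOb G p = exp_set D p X"
    and G_src: "k \<in> Hom S p q \<Longrightarrow> src (FMor G k) = exp_set D p X"
    and G_tgt: "k \<in> Hom S p q \<Longrightarrow> tgt (FMor G k) = exp_set D q X"
    and G_map: "k \<in> Hom S p q \<Longrightarrow> the_map (FMor G k) (i, \<alpha>) = Some (j, \<beta>) \<longleftrightarrow>
      (i, \<alpha>) \<in> exp_set D p X \<and> (\<exists>m. kleisli_rep k i = Some (j, m) \<and> \<beta> = Comp D \<alpha> m)"
begin

abbreviation "PV \<equiv> pset_cat V"
abbreviation "PK \<equiv> pset_coproducts l' r'"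

lemma G_hom:
  assumes k: "k \<in> Hom S p q"
  shows "FMor G k \<in> Hom PV (FOb G p) (FOb G q)"
proof -
  have "p \<in> Obj F" "q \<in> Obj F"
    using k by (auto simp: Hom_star)
  moreover have "x \<in> exp_set D p X \<and> y \<in> exp_set D q X" if "the_map (FMor G k) x = Some y" for x y
    using that kleisli.rep_SomeD[OF k] D.comp_hom
    by (cases x; cases y) (fastforce simp: G_map[OF k])
  ultimately show ?thesis
    using exp_small by (auto simp: Hom_pset_cat G_ob G_src[OF k] G_tgt[OF k] ran_def)
qed

lemma pset_eqI:
  assumes f: "f \<in> Hom PV A B" and g: "g \<in> Hom PV A B"
    and eq: "\<And>i \<alpha> j \<beta>. (i, \<alpha>) \<in> A \<Longrightarrow> the_map f (i, \<alpha>) = Some (j, \<beta>) \<longleftrightarrow> the_map g (i, \<alpha>) = Some (j, \<beta>)"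
  shows "f = g"
proof (rule P.rep_eqI[OF f g])
  fix x assume x: "x \<in> A"
  then have "the_map f x = Some y \<longleftrightarrow> the_map g x = Some y" for y
    using eq by (cases x; cases y) auto
  then have "the_map f x = the_map g x"
    by (metis option.exhaust)
  then show "pset_rep f x = pset_rep g x"
    by (simp add: pset_rep_def)
qed

lemma G_functor: "is_functor S PV G"
proof
  show "FOb G p \<in> Obj PV" if "p \<in> Obj S" for p
    using that exp_small by (simp add: G_ob)
  show "FMor G f \<in> Hom PV (FOb G p) (FOb G q)" if "f \<in> Hom S p q" for f p q
    using that by (rule G_hom)
  fix p assume p: "p \<in> Obj S"
  show "FMor G (Id S p) = Id PV (FOb G p)"
  proof (rule pset_eqI)
    show "FMor G (Id S p) \<in> Hom PV (FOb G p) (FOb G p)" "Id PV (FOb G p) \<in> Hom PV (FOb G p) (FOb G p)"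
      using p G_hom[OF kleisli.id_hom[OF p]] P.id_hom[of "FOb G p"] exp_small by (simp_all add: G_ob)
    fix i \<alpha> j \<beta> assume "(i, \<alpha>) \<in> FOb G p"
    then have "i \<in> fst p" "\<alpha> \<in> Hom D (snd p i) X"
      using p by (simp_all add: G_ob)
    then show "the_map (FMor G (Id S p)) (i, \<alpha>) = Some (j, \<beta>)
        \<longleftrightarrow> the_map (Id PV (FOb G p)) (i, \<alpha>) = Some (j, \<beta>)"
      using p D.comp_id_right unfolding G_map[OF kleisli.id_hom[OF p]] kleisli.rep_Id_Some[OF p]
      by (auto simp: G_ob restrict_map_def)
  qed
next
  fix f g p q s assume f: "f \<in> Hom S p q" and g: "g \<in> Hom S q s"
  note gf = kleisli.comp_hom[OF f g]
  show "FMor G (g \<cdot>\<^bsub>S\<^esub> f) = FMor G g \<cdot>\<^bsub>PV\<^esub> FMor G f"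
  proof (rule pset_eqI[OF G_hom[OF gf] P.comp_hom[OF G_hom[OF f] G_hom[OF g]]])
    fix i \<alpha> j \<beta> assume "(i, \<alpha>) \<in> FOb G p"
    then have i: "i \<in> fst p" "\<alpha> \<in> Hom D (snd p i) X"
      using f by (auto simp: G_ob Hom_star)
    have step: "Comp D \<alpha> m \<in> Hom D (snd q u) X \<and> u \<in> fst q \<and>
        (kleisli_rep g u = Some (j, n) \<longrightarrow> Comp D \<alpha> (Comp D m n) = Comp D (Comp D \<alpha> m) n)"
      if "kleisli_rep f i = Some (u, m)" for u m n
      using kleisli.rep_SomeD[OF f that] kleisli.rep_SomeD[OF g, of u j n] i
      by (auto simp: Hom_def)
    show "the_map (FMor G (g \<cdot>\<^bsub>S\<^esub> f)) (i, \<alpha>) = Some (j, \<beta>)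
        \<longleftrightarrow> the_map (FMor G g \<cdot>\<^bsub>PV\<^esub> FMor G f) (i, \<alpha>) = Some (j, \<beta>)" (is "?L \<longleftrightarrow> ?R")
    proof -
      have "?L \<longleftrightarrow> (\<exists>u m n. kleisli_rep f i = Some (u, m) \<and> kleisli_rep g u = Some (j, n)
          \<and> \<beta> = Comp D \<alpha> (Comp D m n))"
        using i unfolding G_map[OF gf] kleisli_rep_comp[OF f g] labelled_comp_Some by auto
      also have "\<dots> \<longleftrightarrow> (\<exists>u \<gamma>. the_map (FMor G f) (i, \<alpha>) = Some (u, \<gamma>) \<and> the_map (FMor G g) (u, \<gamma>) = Some (j, \<beta>))"
        using i step unfolding G_map[OF f] G_map[OF g] exp_set_iff by metis
      also have "\<dots> \<longleftrightarrow> ?R"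
        by (auto simp: map_comp_Some_iff)
      finally show ?thesis .
    qed
  qed
qed

abbreviation "\<phi> \<equiv> sum_comparison SK PV PK G"

text \<open>The inverse of the comparison map: an element of the value of a formal sum at \<open>X\<close> lies over an index of
  one of the two summands.\<close>

definition \<psi> :: "('u, 'o) fam \<Rightarrow> ('u, 'o) fam \<Rightarrow> ('u \<times> 'm) pset_arr"
  where "\<psi> p q = Arr (exp_set D (fam_sum l r p q) X) (l' ` exp_set D p X \<union> r' ` exp_set D q X)
    ((\<lambda>(k, \<alpha>). if k \<in> range l then Some (l' (inv l k, \<alpha>)) else Some (r' (inv r k, \<alpha>)))
      |` exp_set D (fam_sum l r p q) X)"

context
  fixes p q assumes p: "p \<in> Obj F" and q: "q \<in> Obj F"
begin

lemma exp_sum: "x \<in> exp_set D (fam_sum l r p q) X \<longleftrightarrow>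
    (\<exists>i \<alpha>. x = (l i, \<alpha>) \<and> (i, \<alpha>) \<in> exp_set D p X) \<or> (\<exists>j \<alpha>. x = (r j, \<alpha>) \<and> (j, \<alpha>) \<in> exp_set D q X)"
  by (cases x) auto

lemma \<psi>_map: "(i, \<alpha>) \<in> exp_set D p X \<Longrightarrow> the_map (\<psi> p q) (l i, \<alpha>) = Some (l' (i, \<alpha>))"
    "(j, \<alpha>) \<in> exp_set D q X \<Longrightarrow> the_map (\<psi> p q) (r j, \<alpha>) = Some (r' (j, \<alpha>))"
  by (auto simp: \<psi>_def)

lemma \<psi>_hom: "\<psi> p q \<in> Hom PV (FOb G (fam_sum l r p q)) (Sum PK (FOb G p) (FOb G q))"
proof -
  have dom: "x \<in> exp_set D (fam_sum l r p q) X" if "the_map (\<psi> p q) x = Some y" for x y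
    using that by (simp add: \<psi>_def restrict_map_def split: if_splits)
  have ran: "y \<in> l' ` exp_set D p X \<union> r' ` exp_set D q X" if y: "the_map (\<psi> p q) x = Some y" for x y
    using dom[OF y] unfolding exp_sum
  proof (elim disjE exE conjE)
    fix i \<alpha> assume i: "x = (l i, \<alpha>)" "(i, \<alpha>) \<in> exp_set D p X"
    then have "y = l' (i, \<alpha>)"
      using y \<psi>_map(1)[OF i(2)] by simp
    then show ?thesis
      using i(2) by blast
  next
    fix j \<alpha> assume j: "x = (r j, \<alpha>)" "(j, \<alpha>) \<in> exp_set D q X"
    then have "y = r' (j, \<alpha>)"
      using y \<psi>_map(2)[OF j(2)] by simp
    then show ?thesis
      using j(2) by blast
  qed
  have "dom (the_map (\<psi> p q)) \<subseteq> exp_set D (fam_sum l r p q) X"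
      "ran (the_map (\<psi> p q)) \<subseteq> l' ` exp_set D p X \<union> r' ` exp_set D q X"
    unfolding dom_def ran_def using dom ran by blast+
  then show ?thesis
    using exp_small[OF fam_sum_Obj[OF p q]] P.sum_small[OF exp_small[OF p] exp_small[OF q]]
    unfolding Hom_pset_cat G_ob[OF p] G_ob[OF q] G_ob[OF fam_sum_Obj[OF p q]]
    by (simp add: \<psi>_def)
qed

lemma G_injections:
  "FMor G (Inj1 SK p q) \<in> Hom PV (FOb G p) (FOb G (fam_sum l r p q))"
  "FMor G (Inj2 SK p q) \<in> Hom PV (FOb G q) (FOb G (fam_sum l r p q))"
  "(i, \<alpha>) \<in> exp_set D p X \<Longrightarrow> the_map (FMor G (Inj1 SK p q)) (i, \<alpha>) = Some (l i, \<alpha>)"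
  "(j, \<alpha>) \<in> exp_set D q X \<Longrightarrow> the_map (FMor G (Inj2 SK p q)) (j, \<alpha>) = Some (r j, \<alpha>)"
proof -
  note inj = star_injections(1,2)[OF p q]
  show "FMor G (Inj1 SK p q) \<in> Hom PV (FOb G p) (FOb G (fam_sum l r p q))"
    "FMor G (Inj2 SK p q) \<in> Hom PV (FOb G q) (FOb G (fam_sum l r p q))"
    using inj by (auto intro: G_hom)
  show "(i, \<alpha>) \<in> exp_set D p X \<Longrightarrow> the_map (FMor G (Inj1 SK p q)) (i, \<alpha>) = Some (l i, \<alpha>)"
    using D.comp_id_right unfolding G_map[OF inj(1)] star_injections(3)[OF p q] by auto
  show "(j, \<alpha>) \<in> exp_set D q X \<Longrightarrow> the_map (FMor G (Inj2 SK p q)) (j, \<alpha>) = Some (r j, \<alpha>)"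
    using D.comp_id_right unfolding G_map[OF inj(2)] star_injections(4)[OF p q] by auto
qed

lemma \<phi>_hom: "\<phi> p q \<in> Hom PV (Sum PK (FOb G p) (FOb G q)) (FOb G (fam_sum l r p q))"
  unfolding sum_comparison_def by (rule P.copair_hom[OF G_injections(1,2)])

lemma \<phi>_map:
  "(i, \<alpha>) \<in> exp_set D p X \<Longrightarrow> the_map (\<phi> p q) (l' (i, \<alpha>)) = Some (l i, \<alpha>)"
  "(j, \<alpha>) \<in> exp_set D q X \<Longrightarrow> the_map (\<phi> p q) (r' (j, \<alpha>)) = Some (r j, \<alpha>)"
proof -
  assume i: "(i, \<alpha>) \<in> exp_set D p X"
  have "pset_rep (\<phi> p q) (l' (i, \<alpha>)) = pset_rep (FMor G (Inj1 SK p q)) (i, \<alpha>)"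
    unfolding sum_comparison_def
    using P.rep_copair(1)[OF G_injections(1,2), of "(i, \<alpha>)"] i unfolding G_ob[OF p] .
  then show "the_map (\<phi> p q) (l' (i, \<alpha>)) = Some (l i, \<alpha>)"
    using G_injections(3)[OF i] unfolding pset_rep_Some[symmetric, where m = "()"] by (rule trans)
next
  assume j: "(j, \<alpha>) \<in> exp_set D q X"
  have "pset_rep (\<phi> p q) (r' (j, \<alpha>)) = pset_rep (FMor G (Inj2 SK p q)) (j, \<alpha>)"
    unfolding sum_comparison_def
    using P.rep_copair(2)[OF G_injections(1,2), of "(j, \<alpha>)"] j unfolding G_ob[OF q] .
  then show "the_map (\<phi> p q) (r' (j, \<alpha>)) = Some (r j, \<alpha>)"
    using G_injections(4)[OF j] unfolding pset_rep_Some[symmetric, where m = "()"] by (rule trans)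
qed

lemma \<phi>_inverse: "inverse_pair PV (\<phi> p q) (\<psi> p q)"
proof -
  have pq: "FOb G (fam_sum l r p q) = exp_set D (fam_sum l r p q) X" "FOb G (fam_sum l r p q) \<in> Obj PV"
      "Sum PK (FOb G p) (FOb G q) \<in> Obj PV"
    using exp_small[OF fam_sum_Obj[OF p q]] P.sum_small[OF exp_small[OF p] exp_small[OF q]]
    by (simp_all add: G_ob[OF p] G_ob[OF q] G_ob[OF fam_sum_Obj[OF p q]])
  have "\<phi> p q \<cdot>\<^bsub>PV\<^esub> \<psi> p q = Id PV (FOb G (fam_sum l r p q))"
  proof (rule P.rep_eqI[OF P.comp_hom[OF \<psi>_hom \<phi>_hom] P.id_hom[OF pq(2)]])
    fix x assume "x \<in> FOb G (fam_sum l r p q)"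
    then show "pset_rep (\<phi> p q \<cdot>\<^bsub>PV\<^esub> \<psi> p q) x = pset_rep (Id PV (FOb G (fam_sum l r p q))) x"
      unfolding pq(1) exp_sum by (auto simp: pset_rep_def pq(1) \<psi>_map \<phi>_map restrict_map_def exp_sum simp del: exp_set_iff)
  qed
  moreover have "\<psi> p q \<cdot>\<^bsub>PV\<^esub> \<phi> p q = Id PV (Sum PK (FOb G p) (FOb G q))"
  proof (rule P.rep_eqI[OF P.comp_hom[OF \<phi>_hom \<psi>_hom] P.id_hom[OF pq(3)]])
    fix x assume "x \<in> Sum PK (FOb G p) (FOb G q)"
    then consider i \<alpha> where "x = l' (i, \<alpha>)" "(i, \<alpha>) \<in> exp_set D p X"
      | j \<alpha> where "x = r' (j, \<alpha>)" "(j, \<alpha>) \<in> exp_set D q X"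
      using p q by (auto simp: G_ob simp del: exp_set_iff)
    then show "pset_rep (\<psi> p q \<cdot>\<^bsub>PV\<^esub> \<phi> p q) x = pset_rep (Id PV (Sum PK (FOb G p) (FOb G q))) x"
      using p q by cases (auto simp: G_ob pset_rep_def \<psi>_map \<phi>_map simp del: exp_set_iff)
  qed
  ultimately show ?thesis
    using \<phi>_hom \<psi>_hom by (auto simp: inverse_pair_def Hom_def)
qed

end

lemma inv_\<phi>: "\<lbrakk>p \<in> Obj F; q \<in> Obj F\<rbrakk> \<Longrightarrow> inv_mor PV (\<phi> p q) = \<psi> p q"
  by (rule P.inv_mor_eq[OF \<phi>_inverse])

text \<open>A path of \<open>f\<close> from \<open>i\<close> to \<open>j\<close> with label \<open>m\<close> and an \<open>\<alpha>\<close> over \<open>i\<close> amount to a path of the image of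
  \<open>f\<close> from \<open>(i, \<alpha>)\<close> to \<open>(j, \<alpha> m)\<close>; both inclusions are inductions on the path.\<close>

lemma preserves_iter:
  assumes f: "f \<in> Hom S W (fam_sum l r B W)" and B: "B \<in> Obj F" and W: "W \<in> Obj F"
  shows "FMor G (kleisli.iter f) = P.iter (\<psi> B W \<cdot>\<^bsub>PV\<^esub> FMor G f)"
proof -
  let ?g = "\<psi> B W \<cdot>\<^bsub>PV\<^esub> FMor G f"
  have f': "f \<in> Hom S W (Sum SK B W)"
    using f by simp
  have iter: "kleisli.iter f \<in> Hom S W B"
    using kleisli.iter_hom[OF f'] B W by simp
  have g: "?g \<in> Hom PV (FOb G W) (Sum PK (FOb G B) (FOb G W))"
    using P.comp_hom[OF G_hom[OF f] \<psi>_hom[OF B W]] .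
  have obj: "FOb G B \<in> Obj PV" "FOb G W \<in> Obj PV"
    using exp_small B W by (simp_all add: G_ob)
  have Gf: "the_map (FMor G f) (i, \<alpha>) = Some (k, \<beta>) \<longleftrightarrow> (i, \<alpha>) \<in> exp_set D W X \<and>
      (\<exists>m. kleisli_rep f i = Some (k, m) \<and> \<beta> = Comp D \<alpha> m)" for i \<alpha> k \<beta>
    by (rule G_map[OF f])
  have Gf_typed: "(k, \<gamma>) \<in> exp_set D (fam_sum l r B W) X" if "the_map (FMor G f) (i, \<alpha>) = Some (k, \<gamma>)" for i \<alpha> k \<gamma>
    using Hom_pset_catD(6)[OF G_hom[OF f] that] fam_sum_Obj[OF B W] by (simp only: G_ob)
  have g_map: "the_map ?g (i, \<alpha>) = Some y \<longleftrightarrow>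
      (\<exists>k \<gamma>. the_map (FMor G f) (i, \<alpha>) = Some (k, \<gamma>) \<and> the_map (\<psi> B W) (k, \<gamma>) = Some y)" for i \<alpha> y
    by (auto simp: map_comp_Some_iff)
  have \<psi>_iff: "the_map (\<psi> B W) (k, \<gamma>) = Some (l' (j, \<beta>)) \<longleftrightarrow> k = l j \<and> \<gamma> = \<beta>"
      "the_map (\<psi> B W) (k, \<gamma>) = Some (r' (j, \<beta>)) \<longleftrightarrow> k = r j \<and> \<gamma> = \<beta>"
    if "(k, \<gamma>) \<in> exp_set D (fam_sum l r B W) X" for k \<gamma> j \<beta>
    using that unfolding exp_sum[OF B W] by (auto simp: \<psi>_map[OF B W] simp del: exp_set_iff)
  have g_l: "the_map ?g (i, \<alpha>) = Some (l' (j, \<beta>)) \<longleftrightarrow> the_map (FMor G f) (i, \<alpha>) = Some (l j, \<beta>)"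
    for i \<alpha> j \<beta>
    unfolding g_map using \<psi>_iff(1)[OF Gf_typed] by metis
  have g_r: "the_map ?g (i, \<alpha>) = Some (r' (u, \<beta>)) \<longleftrightarrow> the_map (FMor G f) (i, \<alpha>) = Some (r u, \<beta>)"
    for i \<alpha> u \<beta>
    unfolding g_map using \<psi>_iff(2)[OF Gf_typed] by metis
  have obj_S: "B \<in> Obj S" "W \<in> Obj S"
    using B W by simp_all
  show ?thesis
  proof (rule pset_eqI[OF G_hom[OF iter] P.iter_hom[OF g obj]])
    fix i \<alpha> j \<beta> assume i: "(i, \<alpha>) \<in> FOb G W"
    have "the_map (FMor G (kleisli.iter f)) (i, \<alpha>) = Some (j, \<beta>) \<longleftrightarrow>
        (\<exists>m. exits (opp D) l r (kleisli_rep f) i j m \<and> \<beta> = Comp D \<alpha> m)"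
      using i W B unfolding G_map[OF iter] kleisli.rep_iter[OF f' obj_S]
      by (simp add: G_ob)
    also have "\<dots> \<longleftrightarrow> exits unit_cat l' r' (pset_rep ?g) (i, \<alpha>) (j, \<beta>) ()"
    proof
      assume "\<exists>m. exits (opp D) l r (kleisli_rep f) i j m \<and> \<beta> = Comp D \<alpha> m"
      then obtain m where "exits (opp D) l r (kleisli_rep f) i j m" "\<beta> = Comp D \<alpha> m"
        by blast
      moreover have "(i, \<alpha>) \<in> exp_set D W X"
        using i W by (simp add: G_ob)
      ultimately show "exits unit_cat l' r' (pset_rep ?g) (i, \<alpha>) (j, \<beta>) ()"
      proof (induction arbitrary: \<alpha> rule: exits.induct)
        case (exit i j m)
        then have "the_map ?g (i, \<alpha>) = Some (l' (j, \<beta>))"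
          unfolding g_l Gf by blast
        then show ?case
          by (intro exits.exit) simp
      next
        case (loop i u m j n)
        then have step: "the_map (FMor G f) (i, \<alpha>) = Some (r u, Comp D \<alpha> m)"
          unfolding Gf by blast
        then have u: "(u, Comp D \<alpha> m) \<in> exp_set D W X"
          using Gf_typed[OF step] unfolding exp_sum[OF B W] by auto
        have "n \<in> Hom D (snd B j) (snd W u)" "m \<in> Hom D (snd W u) (snd W i)" "\<alpha> \<in> Hom D (snd W i) X"
          using kleisli.exits_typed[OF loop.hyps(2) f' obj_S] kleisli.rep_SomeD[OF f loop.hyps(1)] loop.prems
          by auto
        then have "\<beta> = Comp D (Comp D \<alpha> m) n"
          using loop.prems(1) by (simp add: Hom_def)
        from loop.IH[OF this u]
        have "exits unit_cat l' r' (pset_rep ?g) (i, \<alpha>) (j, \<beta>) (Comp unit_cat () ())"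
          using step[folded g_r] by (intro exits.loop) auto
        then show ?case
          by simp
      qed
    next
      have "\<exists>m. exits (opp D) l r (kleisli_rep f) (fst x) (fst y) m \<and> snd y = Comp D (snd x) m"
        if "exits unit_cat l' r' (pset_rep ?g) x y e" for x y e
        using that
      proof (induction rule: exits.induct)
        case (exit x y e)
        then have "the_map (FMor G f) (fst x, snd x) = Some (l (fst y), snd y)"
          unfolding g_l[symmetric] by simp
        then show ?case
          unfolding Gf by (blast intro: exits.exit)
      next
        case (loop x u e y e')
        then have x: "the_map (FMor G f) (fst x, snd x) = Some (r (fst u), snd u)"
          unfolding g_r[symmetric] by simp
        then obtain m where m: "kleisli_rep f (fst x) = Some (r (fst u), m)" "snd u = Comp D (snd x) m"
            "snd x \<in> Hom D (snd W (fst x)) X"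
          unfolding Gf exp_set_iff by auto
        obtain n where n: "exits (opp D) l r (kleisli_rep f) (fst u) (fst y) n" "snd y = Comp D (snd u) n"
          using loop.IH by blast
        have "n \<in> Hom D (snd B (fst y)) (snd W (fst u))" "m \<in> Hom D (snd W (fst u)) (snd W (fst x))"
          using kleisli.exits_typed[OF n(1) f' obj_S] kleisli.rep_SomeD[OF f m(1)] 
          by auto
        then have "snd y = Comp D (snd x) (Comp (opp D) n m)"
          using n(2) m(2,3) by (simp add: Hom_def)
        then show ?case
          using exits.loop[OF m(1) n(1)] by blast
      qed
      moreover assume "exits unit_cat l' r' (pset_rep ?g) (i, \<alpha>) (j, \<beta>) ()"
      ultimately show "\<exists>m. exits (opp D) l r (kleisli_rep f) i j m \<and> \<beta> = Comp D \<alpha> m"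
        by fastforce
    qed
    also have "\<dots> \<longleftrightarrow> the_map (P.iter ?g) (i, \<alpha>) = Some (j, \<beta>)"
      using P.rep_iter[OF g obj, of "(i, \<alpha>)" "(j, \<beta>)" "()"] by simp
    finally show "the_map (FMor G (kleisli.iter f)) (i, \<alpha>) = Some (j, \<beta>)
        \<longleftrightarrow> the_map (P.iter ?g) (i, \<alpha>) = Some (j, \<beta>)" .
  qed
qed

lemma iteration_functor_G:
  "iteration_functor S SK kleisli.le kleisli.iter kleisli.trace PV PK P.le P.iter (pset_trace l' r') G"
proof -
  interpret T: iteration_trace PV PK P.le P.iter "pset_trace l' r'"
    by (rule P.iteration_trace_pset)
  interpret G: is_functor S PV G
    by (rule G_functor)
  show ?thesis
  proof unfold_locales
    show "iso PV (\<phi> p q)" if "p \<in> Obj S" "q \<in> Obj S" for p q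
      using that \<phi>_inverse[of p q] unfolding iso_def star_simps by blast
    show "FMor G (kleisli.iter f) = P.iter (inv_mor PV (\<phi> B W) \<cdot>\<^bsub>PV\<^esub> FMor G f)"
      if "f \<in> Hom S W (Sum SK B W)" "B \<in> Obj S" "W \<in> Obj S" for f B W
      using preserves_iter[of f W B] inv_\<phi>[of B W] that
      by (simp only: star_simps star_coproducts_simps)
    show "iso PV (zero_comparison SK PV PK G)"
    proof -
      have "FOb G (Zero SK) = {}"
        using G_ob[OF fam.zero_obj] by (auto simp: exp_set_def)
      moreover have "initial_map PV PK {} = Id PV {}"
        by (rule P.initial_map_unique[symmetric]) (use P.empty_small in \<open>auto simp: Mor_pset_cat Hom_pset_cat\<close>)
      moreover have "inverse_pair PV (Id PV {}) (Id PV {})"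
        using P.empty_small by (simp add: inverse_pair_def Mor_pset_cat Hom_pset_cat map_comp_def restrict_map_def)
      ultimately show ?thesis
        unfolding zero_comparison_def iso_def by metis
    qed
  qed
qed

end

section \<open>Transport along isomorphisms of categories\<close>

text \<open>An isomorphism of categories that is the identity on objects; structure on \<open>C\<close> is carried over to
  \<open>C'\<close> along it.\<close>

locale hom_bijection = category C
  for C :: "('o, 'm) category" (structure) +
  fixes C' :: "('o, 'n) category" and \<Psi> :: "'m \<Rightarrow> 'n"
  assumes Obj_eq: "Obj C' = Obj C"
    and Mor_typed: "f' \<in> Mor C' \<Longrightarrow> Dom C' f' \<in> Obj C \<and> Cod C' f' \<in> Obj C"
    and \<Psi>_bij: "\<lbrakk>A \<in> Obj C; B \<in> Obj C\<rbrakk> \<Longrightarrow> bij_betw \<Psi> (Hom C A B) (Hom C' A B)"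
    and \<Psi>_id: "A \<in> Obj C \<Longrightarrow> \<Psi> (Id C A) = Id C' A"
    and \<Psi>_comp: "\<lbrakk>f \<in> Hom C A B; g \<in> Hom C B D\<rbrakk> \<Longrightarrow> \<Psi> (g \<cdot> f) = Comp C' (\<Psi> g) (\<Psi> f)"
begin

lemma \<Psi>_hom: "f \<in> Hom C A B \<Longrightarrow> \<Psi> f \<in> Hom C' A B"
  using \<Psi>_bij[of A B] Hom_Obj[of f A B] by (auto simp: bij_betw_def)

lemma \<Psi>_inj: "\<lbrakk>\<Psi> f = \<Psi> g; f \<in> Hom C A B; g \<in> Hom C A B\<rbrakk> \<Longrightarrow> f = g"
  using \<Psi>_bij[of A B] Hom_Obj[of f A B] by (auto simp: bij_betw_def inj_on_def)

lemma Hom'_Obj: "f' \<in> Hom C' A B \<Longrightarrow> A \<in> Obj C \<and> B \<in> Obj C"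
  using Mor_typed by (auto simp: Hom_def)

lemma \<Psi>_surj:
  assumes "f' \<in> Hom C' A B"
  obtains f where "f \<in> Hom C A B" "f' = \<Psi> f"
  using assms \<Psi>_bij[of A B] Hom'_Obj[OF assms] by (auto simp: bij_betw_def)

lemma category': "category C'"
proof
  fix A assume "A \<in> Obj C'"
  then show "Id C' A \<in> Hom C' A A"
    using \<Psi>_hom[OF id_hom[of A]] by (simp add: Obj_eq \<Psi>_id)
next
  fix A B f' assume f': "f' \<in> Hom C' A B"
  obtain f where f: "f \<in> Hom C A B" "f' = \<Psi> f"
    using \<Psi>_surj[OF f'] .
  have obj: "A \<in> Obj C" "B \<in> Obj C"
    using Hom_Obj[OF f(1)] by auto
  show "f' \<cdot>\<^bsub>C'\<^esub> Id C' A = f'" "Id C' B \<cdot>\<^bsub>C'\<^esub> f' = f'"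
    using \<Psi>_comp[OF id_hom[OF obj(1)] f(1)] \<Psi>_comp[OF f(1) id_hom[OF obj(2)]] obj
      comp_id_right[OF f(1)] comp_id_left[OF f(1)] by (simp_all add: f(2) \<Psi>_id)
  fix D g' assume g': "g' \<in> Hom C' B D"
  obtain g where g: "g \<in> Hom C B D" "g' = \<Psi> g"
    using \<Psi>_surj[OF g'] .
  show "g' \<cdot>\<^bsub>C'\<^esub> f' \<in> Hom C' A D"
    using \<Psi>_hom[OF comp_hom[OF f(1) g(1)]] \<Psi>_comp[OF f(1) g(1)] by (simp add: f(2) g(2))
  fix E h' assume h': "h' \<in> Hom C' D E"
  obtain h where h: "h \<in> Hom C D E" "h' = \<Psi> h"
    using \<Psi>_surj[OF h'] .
  show "(h' \<cdot>\<^bsub>C'\<^esub> g') \<cdot>\<^bsub>C'\<^esub> f' = h' \<cdot>\<^bsub>C'\<^esub> (g' \<cdot>\<^bsub>C'\<^esub> f')"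
    using comp_assoc[OF f(1) g(1) h(1)] \<Psi>_comp[OF f(1) g(1)] \<Psi>_comp[OF g(1) h(1)]
      \<Psi>_comp[OF comp_hom[OF f(1) g(1)] h(1)] \<Psi>_comp[OF f(1) comp_hom[OF g(1) h(1)]]
    by (simp add: f(2) g(2) h(2))
qed (use Mor_typed Obj_eq in auto)

lemma terminal':
  assumes "terminal C t"
  shows "terminal C' t"
  unfolding terminal_def Obj_eq
proof (intro conjI ballI)
  show t: "t \<in> Obj C"
    using assms by (simp add: terminal_def)
  fix A assume A: "A \<in> Obj C"
  then obtain f where f: "f \<in> Hom C A t" and unique: "\<And>g. g \<in> Hom C A t \<Longrightarrow> g = f"
    using assms unfolding terminal_def by metis
  show "\<exists>!f. f \<in> Hom C' A t"
    by (rule ex1I[of _ "\<Psi> f"]) (use f unique \<Psi>_hom \<Psi>_surj in metis)+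
qed

end

locale coproduct_bijection = hom_bijection C C' \<Psi> + cocartesian_category C K
  for C :: "('o, 'm) category" (structure) and C' :: "('o, 'n) category" and \<Psi> K +
  fixes K' :: "('o, 'n) coproducts"
  assumes Zero_eq: "Zero K' = Zero K"
    and Sum_eq: "\<lbrakk>A \<in> Obj C; B \<in> Obj C\<rbrakk> \<Longrightarrow> Sum K' A B = Sum K A B"
    and Inj1_eq: "\<lbrakk>A \<in> Obj C; B \<in> Obj C\<rbrakk> \<Longrightarrow> Inj1 K' A B = \<Psi> (Inj1 K A B)"
    and Inj2_eq: "\<lbrakk>A \<in> Obj C; B \<in> Obj C\<rbrakk> \<Longrightarrow> Inj2 K' A B = \<Psi> (Inj2 K A B)"
begin

lemma has_coproducts': "has_coproducts C' K'"
proof -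
  interpret C': category C'
    by (rule category')
  show ?thesis
  proof
    show "Zero K' \<in> Obj C'"
      by (simp add: Obj_eq Zero_eq)
    show "\<exists>!f. f \<in> Hom C' (Zero K') A" if "A \<in> Obj C'" for A
    proof -
      obtain f where f: "f \<in> Hom C (Zero K) A" and unique: "\<And>g. g \<in> Hom C (Zero K) A \<Longrightarrow> g = f"
        using zero_initial[of A] \<open>A \<in> Obj C'\<close> Obj_eq by auto
      show ?thesis
        unfolding Zero_eq
        by (rule ex1I[of _ "\<Psi> f"]) (use f unique \<Psi>_hom \<Psi>_surj in metis)+
    qed
    show "Sum K' A B \<in> Obj C'" if "A \<in> Obj C'" "B \<in> Obj C'" for A B
      using that by (simp add: Obj_eq Sum_eq)
    show "Inj1 K' A B \<in> Hom C' A (Sum K' A B)" "Inj2 K' A B \<in> Hom C' B (Sum K' A B)"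
      if "A \<in> Obj C'" "B \<in> Obj C'" for A B
      using that \<Psi>_hom[OF inj1_hom[of A B]] \<Psi>_hom[OF inj2_hom[of A B]]
      by (simp_all add: Obj_eq Sum_eq Inj1_eq Inj2_eq)
    fix f' g' A B X assume f': "f' \<in> Hom C' A X" and g': "g' \<in> Hom C' B X"
    obtain f where f: "f \<in> Hom C A X" "f' = \<Psi> f"
      using \<Psi>_surj[OF f'] .
    obtain g where g: "g \<in> Hom C B X" "g' = \<Psi> g"
      using \<Psi>_surj[OF g'] .
    have obj: "A \<in> Obj C" "B \<in> Obj C"
      using Hom_Obj[OF f(1)] Hom_Obj[OF g(1)] by auto
    note i1 = inj1_hom[OF obj] and i2 = inj2_hom[OF obj]
    have transfer: "\<Psi> h \<in> Hom C' (Sum K' A B) X \<and> \<Psi> h \<cdot>\<^bsub>C'\<^esub> Inj1 K' A B = f' \<and> \<Psi> h \<cdot>\<^bsub>C'\<^esub> Inj2 K' A B = g'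
        \<longleftrightarrow> h \<cdot> Inj1 K A B = f \<and> h \<cdot> Inj2 K A B = g" if h: "h \<in> Hom C (Sum K A B) X" for h
      using \<Psi>_hom[OF h] \<Psi>_comp[OF i1 h] \<Psi>_comp[OF i2 h] \<Psi>_inj[OF _ comp_hom[OF i1 h] f(1)]
        \<Psi>_inj[OF _ comp_hom[OF i2 h] g(1)] obj
      unfolding Sum_eq[OF obj] Inj1_eq[OF obj] Inj2_eq[OF obj] f(2) g(2) by metis
    obtain h where h: "h \<in> Hom C (Sum K A B) X" "h \<cdot> Inj1 K A B = f" "h \<cdot> Inj2 K A B = g"
      and unique: "\<And>k. \<lbrakk>k \<in> Hom C (Sum K A B) X; k \<cdot> Inj1 K A B = f; k \<cdot> Inj2 K A B = g\<rbrakk> \<Longrightarrow> k = h"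
      using sum_universal[OF f(1) g(1)] by metis
    show "\<exists>!h. h \<in> Hom C' (Sum K' A B) X \<and> h \<cdot>\<^bsub>C'\<^esub> Inj1 K' A B = f' \<and> h \<cdot>\<^bsub>C'\<^esub> Inj2 K' A B = g'"
    proof (rule ex1I[of _ "\<Psi> h"])
      show "\<Psi> h \<in> Hom C' (Sum K' A B) X \<and> \<Psi> h \<cdot>\<^bsub>C'\<^esub> Inj1 K' A B = f' \<and> \<Psi> h \<cdot>\<^bsub>C'\<^esub> Inj2 K' A B = g'"
        using transfer[OF h(1)] h(2,3) by blast
    next
      fix h' assume h': "h' \<in> Hom C' (Sum K' A B) X \<and> h' \<cdot>\<^bsub>C'\<^esub> Inj1 K' A B = f' \<and> h' \<cdot>\<^bsub>C'\<^esub> Inj2 K' A B = g'"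
      then obtain k where k: "k \<in> Hom C (Sum K A B) X" "h' = \<Psi> k"
        using \<Psi>_surj[of h' "Sum K A B" X] Sum_eq[OF obj] by auto
      then have "k = h"
        using transfer[OF k(1)] h' unique by blast
      then show "h' = \<Psi> h"
        using k(2) by simp
    qed
  qed
qed

lemma copair':
  assumes f: "f \<in> Hom C A X" and g: "g \<in> Hom C B X"
  shows "copair C' K' (\<Psi> f) (\<Psi> g) = \<Psi> \<langle>f, g\<rangle>"
proof -
  interpret C': has_coproducts C' K'
    by (rule has_coproducts')
  have obj: "A \<in> Obj C" "B \<in> Obj C"
    using Hom_Obj[OF f] Hom_Obj[OF g] by auto
  note h = copair_hom[OF f g]
  have eqs: "\<langle>f, g\<rangle> \<cdot> Inj1 K A B = f" "\<langle>f, g\<rangle> \<cdot> Inj2 K A B = g"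
    using f g by (simp_all add: Hom_def)
  have "\<Psi> \<langle>f, g\<rangle> \<cdot>\<^bsub>C'\<^esub> Inj1 K' A B = \<Psi> f" "\<Psi> \<langle>f, g\<rangle> \<cdot>\<^bsub>C'\<^esub> Inj2 K' A B = \<Psi> g"
    using \<Psi>_comp[OF inj1_hom[OF obj] h] \<Psi>_comp[OF inj2_hom[OF obj] h] eqs obj
    by (simp_all add: Inj1_eq Inj2_eq)
  then show ?thesis
    using \<Psi>_hom[OF h] \<Psi>_hom[OF f] \<Psi>_hom[OF g] obj Sum_eq[OF obj]
    by - (rule C'.coproduct_ext[of _ _ A B], simp_all add: Hom_def Obj_eq)
qed

definition star_map :: "('o, 'm) arr \<Rightarrow> ('o, 'n) arr"
  where "star_map k = Arr (src k) (tgt k) (\<Psi> (the_map k))"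

lemma hom_bijection_star:
  assumes t: "t \<in> Obj C"
  shows "hom_bijection (star C K t) (star C' K' t) star_map"
proof -
  interpret S: category "star C K t"
    by (rule category_star[OF t])
  interpret C': cocartesian_category C' K'
    using has_coproducts' by (simp add: cocartesian_category_def)
  show ?thesis
  proof
    fix A B assume obj: "A \<in> Obj (star C K t)" "B \<in> Obj (star C K t)"
    then have obj': "A \<in> Obj C" "B \<in> Obj C" "Sum K B t \<in> Obj C" "Sum K' B t = Sum K B t"
      using t Sum_eq by simp_all
    note bij = \<Psi>_bij[OF obj'(1,3)]
    show "bij_betw star_map (Hom (star C K t) A B) (Hom (star C' K' t) A B)"
      unfolding bij_betw_def
    proof
      show "inj_on star_map (Hom (star C K t) A B)"
        by (rule inj_onI) (auto simp: Hom_star star_map_def dest: \<Psi>_inj)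
      show "star_map ` Hom (star C K t) A B = Hom (star C' K' t) A B"
      proof (rule set_eqI)
        fix k'
        have "k' \<in> star_map ` Hom (star C K t) A B \<longleftrightarrow> (\<exists>b \<in> \<Psi> ` Hom C A (Sum K B t). k' = Arr A B b)"
          using obj' unfolding Hom_star image_iff by (auto simp: star_map_def)
        also have "\<dots> \<longleftrightarrow> k' \<in> Hom (star C' K' t) A B"
          using bij obj' unfolding bij_betw_def Hom_star Obj_eq by auto
        finally show "k' \<in> star_map ` Hom (star C K t) A B \<longleftrightarrow> k' \<in> Hom (star C' K' t) A B" .
      qed
    qed
  next
    fix f g A B D assume f: "f \<in> Hom (star C K t) A B" and g: "g \<in> Hom (star C K t) B D"
    obtain a b where ab: "f = Arr A B a" "a \<in> Hom C A (Sum K B t)" "g = Arr B D b" "b \<in> Hom C B (Sum K D t)"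
        "A \<in> Obj C" "B \<in> Obj C" "D \<in> Obj C"
      using f g by (auto simp: Hom_star)
    have f': "star_map f \<in> Hom (star C' K' t) A B" and g': "star_map g \<in> Hom (star C' K' t) B D"
      using ab t \<Psi>_hom by (auto simp: Hom_star star_map_def Obj_eq Sum_eq)
    have "copair C' K' (\<Psi> b) (Inj2 K' D t) \<cdot>\<^bsub>C'\<^esub> \<Psi> a = \<Psi> (\<langle>b, Inj2 K D t\<rangle> \<cdot> a)"
      using copair'[OF ab(4) inj2_hom[OF ab(7) t]] Inj2_eq[OF ab(7) t]
        \<Psi>_comp[OF ab(2) copair_hom[OF ab(4) inj2_hom[OF ab(7) t]]] by simp
    then show "star_map (g \<cdot>\<^bsub>star C K t\<^esub> f) = star_map g \<cdot>\<^bsub>star C' K' t\<^esub> star_map f"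
      using C'.star_comp[OF _ f' g'] star_comp[OF t f g] t ab by (simp add: star_map_def Obj_eq)
  qed (use t in \<open>auto simp: Obj_eq Mor_star star_map_def Inj1_eq\<close>)
qed

end

text \<open>The representation of \<open>C'\<close> is that of \<open>C\<close>, precomposed with the inverse of \<open>\<Psi>\<close>.\<close>

lemma (in hom_bijection) labelled_transport:
  assumes lab: "labelled_partial_category E C l r K idx lab rep"
    and Zero_eq: "Zero K' = Zero K"
    and Sum_eq: "\<And>A B. \<lbrakk>A \<in> Obj C; B \<in> Obj C\<rbrakk> \<Longrightarrow> Sum K' A B = Sum K A B"
    and Inj1_eq: "\<And>A B. \<lbrakk>A \<in> Obj C; B \<in> Obj C\<rbrakk> \<Longrightarrow> Inj1 K' A B = \<Psi> (Inj1 K A B)"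
    and Inj2_eq: "\<And>A B. \<lbrakk>A \<in> Obj C; B \<in> Obj C\<rbrakk> \<Longrightarrow> Inj2 K' A B = \<Psi> (Inj2 K A B)"
  shows "\<exists>rep'. labelled_partial_category E C' l r K' idx lab rep'"
proof -
  interpret labelled_partial_category E C l r K idx lab rep
    by (rule lab)
  interpret C': category C'
    by (rule category')
  define rep' where "rep' f' = rep (the_inv_into (Hom C (Dom C' f') (Cod C' f')) \<Psi> f')" for f'
  have rep': "rep' (\<Psi> f) = rep f" if "f \<in> Hom C A B" for f A B
    using that \<Psi>_hom[OF that] \<Psi>_bij[of A B] Hom_Obj[OF that]
    by (auto simp: rep'_def Hom_def bij_betw_def the_inv_into_f_f)
  have bij: "bij_betw rep' (Hom C' p q) (labelled_maps E (idx p) (lab p) (idx q) (lab q))"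
    if obj: "p \<in> Obj C" "q \<in> Obj C" for p q
  proof -
    have "bij_betw (rep \<circ> the_inv_into (Hom C p q) \<Psi>) (Hom C' p q)
        (labelled_maps E (idx p) (lab p) (idx q) (lab q))"
      using bij_betw_trans[OF bij_betw_the_inv_into[OF \<Psi>_bij[OF obj]] rep_bij[OF obj]] .
    then show ?thesis
      by (rule bij_betw_cong[THEN iffD1, rotated]) (simp add: rep'_def Hom_def)
  qed
  have comp: "rep' (g' \<cdot>\<^bsub>C'\<^esub> f') = labelled_comp E (rep' g') (rep' f')"
    if f': "f' \<in> Hom C' p q" and g': "g' \<in> Hom C' q s" for f' g' p q s
  proof -
    obtain f where f: "f \<in> Hom C p q" "f' = \<Psi> f"
      using \<Psi>_surj[OF f'] .
    obtain g where g: "g \<in> Hom C q s" "g' = \<Psi> g"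
      using \<Psi>_surj[OF g'] .
    show ?thesis
      using rep'[OF f(1)] rep'[OF g(1)] rep'[OF comp_hom[OF f(1) g(1)]] rep_comp[OF f(1) g(1)]
      by (simp add: f(2) g(2) \<Psi>_comp[OF f(1) g(1)])
  qed
  have "labelled_partial_category E C' l r K' idx lab rep'"
    apply unfold_locales
    subgoal by (simp add: Obj_eq lab_Obj)
    subgoal by (rule bij) (simp_all add: Obj_eq)
    subgoal using rep'[OF id_hom] by (simp add: Obj_eq rep_id flip: \<Psi>_id)
    subgoal by (rule comp)
    subgoal by (simp add: zero Zero_eq Obj_eq)
    subgoal by (simp add: zero Zero_eq)
    subgoal by (simp add: Sum_eq Obj_eq)
    subgoal for p q s using sum_inject[of p q s] by (simp add: Sum_eq Obj_eq)
    subgoal by (simp add: Sum_eq Obj_eq idx_sum)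
    subgoal using \<Psi>_hom[OF inj1] by (simp add: Sum_eq Obj_eq Inj1_eq)
    subgoal using rep'[OF inj1] by (simp add: Obj_eq Inj1_eq rep_inj1)
    subgoal using \<Psi>_hom[OF inj2] by (simp add: Sum_eq Obj_eq Inj2_eq)
    subgoal using rep'[OF inj2] by (simp add: Obj_eq Inj2_eq rep_inj2)
    done
  then show ?thesis
    by blast
qed

lemma (in coproduct_bijection) star_labelled_transport:
  assumes t: "t \<in> Obj C"
    and lab: "labelled_partial_category E (star C K t) l r (star_coproducts C K t) idx lab rep"
  shows "\<exists>rep'. labelled_partial_category E (star C' K' t) l r (star_coproducts C' K' t) idx lab rep'"
proof (rule hom_bijection.labelled_transport[OF hom_bijection_star[OF t] lab])
  fix A B assume "A \<in> Obj (star C K t)" "B \<in> Obj (star C K t)"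
  then have A: "A \<in> Obj C" and B: "B \<in> Obj C"
    by simp_all
  note sum = sum_obj[OF A B]
  show "Inj1 (star_coproducts C' K' t) A B = star_map (Inj1 (star_coproducts C K t) A B)"
    using \<Psi>_comp[OF inj1_hom[OF A B] inj1_hom[OF sum t]]
    by (simp add: star_coproducts_def star_map_def Sum_eq Inj1_eq A B sum t)
  show "Inj2 (star_coproducts C' K' t) A B = star_map (Inj2 (star_coproducts C K t) A B)"
    using \<Psi>_comp[OF inj2_hom[OF A B] inj1_hom[OF sum t]]
    by (simp add: star_coproducts_def star_map_def Sum_eq Inj1_eq Inj2_eq A B sum t)
qed (simp_all add: star_coproducts_def Sum_eq Zero_eq)

section \<open>Sums of representable functors\<close>

text \<open>For a category \<open>C\<close>, the functor \<open>Exp\<close> from families over \<open>opp C\<close> to functors from \<open>C\<close> to sets is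
  fully faithful.\<close>

locale exp_functor = category C
  for C :: "('o, 'm) category" (structure) +
  fixes U :: "'u set set"
begin

lemma exp_ob_simps [simp]:
  "A \<in> Obj C \<Longrightarrow> FOb (exp_ob C p) A = exp_set C p A"
  "h \<in> Mor C \<Longrightarrow> FMor (exp_ob C p) h =
    Arr (exp_set C p (Dom C h)) (exp_set C p (Cod C h)) (\<lambda>(i, \<alpha>) \<in> exp_set C p (Dom C h). (i, h \<cdot> \<alpha>))"
  by (simp_all add: exp_ob_def)

lemma exp_ob_functor: "(exp_ob C (p :: ('u, 'o) fam)) \<in> Obj (fun_cat C (set_cat UNIV))"
proof -
  interpret T: category "set_cat UNIV"
    by (rule category_set_cat)
  have "is_functor C (set_cat UNIV) (exp_ob C p)"
  proof
    fix f A B assume f: "f \<in> Hom C A B"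
    note obj = Hom_Obj[OF f]
    have f': "f \<in> Mor C" "Dom C f = A" "Cod C f = B"
      using f by (auto simp: Hom_def)
    show "FMor (exp_ob C p) f \<in> Hom (set_cat UNIV) (FOb (exp_ob C p) A) (FOb (exp_ob C p) B)"
      using obj f' comp_hom[OF _ f] by (auto simp: Hom_set_cat split: if_splits)
    fix g D assume g: "g \<in> Hom C B D"
    have g': "g \<in> Mor C" "Dom C g = B" "Cod C g = D"
      using g by (auto simp: Hom_def)
    show "FMor (exp_ob C p) (g \<cdot> f) = FMor (exp_ob C p) g \<cdot>\<^bsub>set_cat UNIV\<^esub> FMor (exp_ob C p) f"
      using f' g' comp_hom[OF _ f] comp_assoc[OF _ f g]
      by (auto simp: compose_def fun_eq_iff restrict_def)
  next
    fix A assume "A \<in> Obj C"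
    then show "FMor (exp_ob C p) (Id C A) = Id (set_cat UNIV) (FOb (exp_ob C p) A)"
      using comp_id_left by (auto simp: fun_eq_iff restrict_def)
  qed simp
  then show ?thesis
    by (simp add: Obj_fun_cat) (simp add: exp_ob_def)
qed

lemma exp_mor_simps [simp]:
  "src (exp_mor C a) = exp_ob C (src a)" "tgt (exp_mor C a) = exp_ob C (tgt a)"
  "X \<in> Obj C \<Longrightarrow> the_map (exp_mor C a) X = Arr (exp_set C (src a) X) (exp_set C (tgt a) X)
    (\<lambda>(i, \<alpha>) \<in> exp_set C (src a) X. (fst (the_map a) i, \<alpha> \<cdot> snd (the_map a) i))"
  "the_map (exp_mor C a) \<in> extensional (Obj C)"
  by (simp_all add: exp_mor_def split: prod.splits)

abbreviation "Fam \<equiv> fam_cat U (opp C)"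
abbreviation "Presheaves \<equiv> fun_cat C (set_cat (UNIV :: ('u \<times> 'm) set set))"

lemma Hom_FamD:
  assumes "a \<in> Hom Fam p q"
  shows "src a = p" "tgt a = q" "i \<in> fst p \<Longrightarrow> fst (the_map a) i \<in> fst q"
    and "i \<in> fst p \<Longrightarrow> snd (the_map a) i \<in> Hom C (snd q (fst (the_map a) i)) (snd p i)"
  using Hom_fam_catD[OF assms] by simp_all

lemma exp_mor_hom:
  assumes a: "a \<in> Hom Fam p q"
  shows "exp_mor C a \<in> Hom Presheaves (exp_ob C p) (exp_ob C q)"
proof -
  note arr = Hom_FamD(1,2)[OF a]
  have comp: "\<alpha> \<cdot> snd (the_map a) i \<in> Hom C (snd q (fst (the_map a) i)) X"
    if "i \<in> fst p" "\<alpha> \<in> Hom C (snd p i) X" for i \<alpha> X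
    using Hom_FamD(4)[OF a that(1)] that(2) by (rule comp_hom)
  have "the_map (exp_mor C a) X \<in> Hom (set_cat UNIV) (exp_set C p X) (exp_set C q X)" if "X \<in> Obj C" for X
    using that arr Hom_FamD(3)[OF a] comp by (auto simp: Hom_set_cat)
  moreover have "the_map (exp_mor C a) (Cod C h) \<cdot>\<^bsub>set_cat UNIV\<^esub> FMor (exp_ob C p) h
      = FMor (exp_ob C q) h \<cdot>\<^bsub>set_cat UNIV\<^esub> the_map (exp_mor C a) (Dom C h)" if h: "h \<in> Mor C" for h
  proof -
    have h': "h \<in> Hom C (Dom C h) (Cod C h)"
      using h by (simp add: Hom_def)
    have "(h \<cdot> \<alpha>) \<cdot> snd (the_map a) i = h \<cdot> (\<alpha> \<cdot> snd (the_map a) i)"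
      if "i \<in> fst p" "\<alpha> \<in> Hom C (snd p i) (Dom C h)" for i \<alpha>
      using comp_assoc[OF Hom_FamD(4)[OF a that(1)] that(2) h'] .
    then show ?thesis
      using h h' arr dom_obj cod_obj Hom_FamD(3)[OF a] comp comp_hom[OF _ h']
      by (auto simp: compose_def restrict_def fun_eq_iff)
  qed
  ultimately show ?thesis
    using exp_ob_functor arr by (simp add: Hom_fun_cat del: set_cat_simps)
qed

lemma exp_mor_id:
  assumes p: "p \<in> Obj Fam"
  shows "exp_mor C (Id Fam p) = Id Presheaves (exp_ob C p)"
proof (rule arr_eqI)
  show "the_map (exp_mor C (Id Fam p)) = the_map (Id Presheaves (exp_ob C p))"
  proof (rule extensionalityI[of _ "Obj C"])
    fix X assume "X \<in> Obj C"
    then show "the_map (exp_mor C (Id Fam p)) X = the_map (Id Presheaves (exp_ob C p)) X"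
      using comp_id_right by (auto simp: restrict_def fun_eq_iff)
  qed simp_all
qed simp_all

lemma exp_mor_comp:
  assumes a: "a \<in> Hom Fam p q" and b: "b \<in> Hom Fam q s"
  shows "exp_mor C (b \<cdot>\<^bsub>Fam\<^esub> a) = exp_mor C b \<cdot>\<^bsub>Presheaves\<^esub> exp_mor C a"
proof (rule arr_eqI)
  note arr = Hom_FamD(1,2)[OF a] Hom_FamD(1,2)[OF b]
  show "the_map (exp_mor C (b \<cdot>\<^bsub>Fam\<^esub> a)) = the_map (exp_mor C b \<cdot>\<^bsub>Presheaves\<^esub> exp_mor C a)"
  proof (rule extensionalityI[of _ "Obj C"])
    fix X assume X: "X \<in> Obj C"
    have "\<alpha> \<cdot> (snd (the_map a) i \<cdot> snd (the_map b) (fst (the_map a) i))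
          = (\<alpha> \<cdot> snd (the_map a) i) \<cdot> snd (the_map b) (fst (the_map a) i)"
        and "\<alpha> \<cdot> snd (the_map a) i \<in> Hom C (snd q (fst (the_map a) i)) X"
      if "i \<in> fst p" "\<alpha> \<in> Hom C (snd p i) X" for i \<alpha>
      using comp_assoc[OF Hom_FamD(4)[OF b Hom_FamD(3)[OF a that(1)]] Hom_FamD(4)[OF a that(1)] that(2)]
        comp_hom[OF Hom_FamD(4)[OF a that(1)] that(2)] by simp_all
    then show "the_map (exp_mor C (b \<cdot>\<^bsub>Fam\<^esub> a)) X = the_map (exp_mor C b \<cdot>\<^bsub>Presheaves\<^esub> exp_mor C a) X"
      using X arr Hom_FamD(3)[OF a] by (auto simp: compose_def restrict_def fun_eq_iff)
  qed simp_all
qed (use assms in \<open>simp_all add: Hom_fam_cat\<close>)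

lemma exp_mor_at_id:
  assumes a: "a \<in> Hom Fam p q" and i: "i \<in> fst p"
  shows "the_map (the_map (exp_mor C a) (snd p i)) (i, Id C (snd p i)) = (fst (the_map a) i, snd (the_map a) i)"
  using Hom_FamD(4)[OF a i] Hom_FamD(1)[OF a] i id_hom Hom_Obj[OF Hom_FamD(4)[OF a i]] comp_id_left
  by simp

lemma exp_mor_inj:
  assumes a: "a \<in> Hom Fam p q" and b: "b \<in> Hom Fam p q" and eq: "exp_mor C a = exp_mor C b"
  shows "a = b"
  using exp_mor_at_id[OF a] exp_mor_at_id[OF b] eq by (intro fam_arr_eqI[OF a b]) auto

text \<open>The Yoneda argument: \<open>\<eta>\<close> is determined by its values at the elements \<open>(i, id)\<close>, which name an index
  of \<open>q\<close> and a morphism of \<open>C\<close>.\<close>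

lemma exp_mor_surj:
  assumes p: "p \<in> Obj Fam" and q: "q \<in> Obj Fam" and \<eta>: "\<eta> \<in> Hom Presheaves (exp_ob C p) (exp_ob C q)"
  shows "\<exists>a \<in> Hom Fam p q. exp_mor C a = \<eta>"
proof
  let ?e = "\<lambda>i. the_map (the_map \<eta> (snd p i)) (i, Id C (snd p i))"
  let ?a = "Arr p q (\<lambda>i \<in> fst p. fst (?e i), \<lambda>i \<in> fst p. snd (?e i))"
  have obj: "snd p i \<in> Obj C" if "i \<in> fst p" for i
    using that p by (auto simp: Obj_fam_cat PiE_iff)
  have comp: "src (the_map \<eta> X) = exp_set C p X" "tgt (the_map \<eta> X) = exp_set C q X"
      "the_map (the_map \<eta> X) \<in> exp_set C p X \<rightarrow>\<^sub>E exp_set C q X" if "X \<in> Obj C" for X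
    using Hom_fun_catD(6)[OF \<eta> that] that by (simp_all add: Hom_set_cat)
  have "?e i \<in> exp_set C q (snd p i)" if "i \<in> fst p" for i
    using comp(3)[OF obj[OF that]] that obj[OF that] id_hom by (auto simp: PiE_iff)
  then have e: "fst (?e i) \<in> fst q" "snd (?e i) \<in> Hom C (snd q (fst (?e i))) (snd p i)" if "i \<in> fst p" for i
    using that by (metis exp_set_iff prod.collapse)+
  then show "?a \<in> Hom Fam p q"
    using p q by (simp add: Hom_fam_cat)
  show "exp_mor C ?a = \<eta>"
  proof (rule arr_eqI)
    show "the_map (exp_mor C ?a) = the_map \<eta>"
    proof (rule extensionalityI[of _ "Obj C"])
      fix X assume X: "X \<in> Obj C"
      have natural: "the_map (the_map \<eta> X) (i, \<alpha>) = (fst (?e i), \<alpha> \<cdot> snd (?e i))"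
        if i: "i \<in> fst p" and \<alpha>: "\<alpha> \<in> Hom C (snd p i) X" for i \<alpha>
      proof -
        have \<alpha>': "\<alpha> \<in> Mor C" "Dom C \<alpha> = snd p i" "Cod C \<alpha> = X"
          using \<alpha> by (auto simp: Hom_def)
        let ?T = "set_cat (UNIV :: ('u \<times> 'm) set set)"
        have "the_map \<eta> X \<cdot>\<^bsub>?T\<^esub> FMor (exp_ob C p) \<alpha> = FMor (exp_ob C q) \<alpha> \<cdot>\<^bsub>?T\<^esub> the_map \<eta> (snd p i)"
          using Hom_fun_catD(7)[OF \<eta> \<alpha>'(1)] unfolding \<alpha>'(2,3) .
        then have "the_map (the_map \<eta> X \<cdot>\<^bsub>?T\<^esub> FMor (exp_ob C p) \<alpha>) (i, Id C (snd p i))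
            = the_map (FMor (exp_ob C q) \<alpha> \<cdot>\<^bsub>?T\<^esub> the_map \<eta> (snd p i)) (i, Id C (snd p i))"
          by (simp only:)
        moreover have "\<alpha> \<cdot> Id C (snd p i) = \<alpha>"
          using \<alpha>' by simp
        moreover have "?e i = (fst (?e i), snd (?e i))"
          by simp
        ultimately show ?thesis
          using i \<alpha>' obj[OF i] e[OF i] id_hom comp[OF obj[OF i]]
          by (auto simp: compose_def split: prod.splits)
      qed
      show "the_map (exp_mor C ?a) X = the_map \<eta> X"
        using X comp[OF X] natural
        by (intro arr_eqI) (auto intro!: extensionalityI[of _ "exp_set C p X"] simp: PiE_iff)
    qed (use Hom_fun_catD(5)[OF \<eta>] in simp_all)
  qed (use Hom_fun_catD(1,2)[OF \<eta>] in simp_all)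
qed

lemma exp_mor_bij:
  assumes "p \<in> Obj Fam" "q \<in> Obj Fam"
  shows "bij_betw (exp_mor C) (Hom Fam p q) (Hom Presheaves (exp_ob C p) (exp_ob C q))"
  unfolding bij_betw_def inj_on_def
  using exp_mor_inj exp_mor_hom exp_mor_surj[OF assms] by blast

end

section \<open>Polynomial functors\<close>

lemma poly_cat_simps [simp]:
  "Obj (poly_cat U) = Obj (fam_cat U (opp (set_cat U)))" "Dom (poly_cat U) = src" "Cod (poly_cat U) = tgt"
  "Id (poly_cat U) p = Arr p p (Id (fun_cat (set_cat U) (set_cat UNIV)) (exp_ob (set_cat U) p))"
  "Comp (poly_cat U) \<epsilon> \<eta> = Arr (src \<eta>) (tgt \<epsilon>)
    (Comp (fun_cat (set_cat U) (set_cat UNIV)) (the_map \<epsilon>) (the_map \<eta>))"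
  by (simp_all add: poly_cat_def Let_def)

lemma Hom_poly_cat: "Hom (poly_cat U) p q = {Arr p q \<eta> | \<eta>.
    p \<in> Obj (fam_cat U (opp (set_cat U))) \<and> q \<in> Obj (fam_cat U (opp (set_cat U))) \<and>
    \<eta> \<in> Hom (fun_cat (set_cat U) (set_cat UNIV)) (exp_ob (set_cat U) p) (exp_ob (set_cat U) q)}"
proof -
  have "Mor (poly_cat U) = {Arr p q \<eta> | p q \<eta>.
      p \<in> Obj (fam_cat U (opp (set_cat U))) \<and> q \<in> Obj (fam_cat U (opp (set_cat U))) \<and>
      \<eta> \<in> Hom (fun_cat (set_cat U) (set_cat UNIV)) (exp_ob (set_cat U) p) (exp_ob (set_cat U) q)}"
    by (simp add: poly_cat_def Let_def)
  then show ?thesis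
    unfolding Hom_def[of "poly_cat U"] by (cases p; cases q) auto
qed

lemma Mor_poly_cat: "f \<in> Mor (poly_cat U) \<longleftrightarrow> f \<in> Hom (poly_cat U) (src f) (tgt f)"
  by (simp add: Hom_def)

text \<open>The empty set is terminal in \<open>opp (set_cat U)\<close>, so families over that category have the labelled
  representation.  By full faithfulness of \<open>Exp\<close>, polynomial functors form an isomorphic category, to
  which the representation is transported.\<close>

lemma (in set_universe) poly_uniform_traced:
  "\<exists>Tr. star_uniform_traced (poly_cat U) (poly_coproducts U l r) poly_one Tr"
proof -
  let ?D = "set_cat U" and ?one = "poly_one :: 'a poly_ob"
  let ?F = "fam_cat U (opp ?D)" and ?K = "fam_coproducts l r (opp ?D)"
  let ?\<Psi> = "\<lambda>a. Arr (src a) (tgt a) (exp_mor ?D a)"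
  interpret D: category ?D
    by (rule category_set_cat)
  interpret exp_functor ?D U
    by unfold_locales
  interpret opp: category "opp ?D"
    by (rule category_opp[OF category_set_cat])
  interpret fam_star U l r "opp ?D" "{}"
    using empty_small empty_initial_set_cat[of U] by unfold_locales simp_all
  interpret bij: coproduct_bijection ?F "poly_cat U" ?\<Psi> ?K "poly_coproducts U l r"
  proof unfold_locales
    fix p q assume pq: "p \<in> Obj ?F" "q \<in> Obj ?F"
    show "bij_betw ?\<Psi> (Hom ?F p q) (Hom (poly_cat U) p q)"
      unfolding bij_betw_def
    proof
      show "inj_on ?\<Psi> (Hom ?F p q)"
        using exp_mor_inj by (intro inj_onI) simp
      show "?\<Psi> ` Hom ?F p q = Hom (poly_cat U) p q"
      proof (rule set_eqI)
        fix k
        have "k \<in> ?\<Psi> ` Hom ?F p q \<longleftrightarrow> (\<exists>\<eta> \<in> exp_mor ?D ` Hom ?F p q. k = Arr p q \<eta>)"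
          by (auto simp: image_iff Hom_FamD)
        also have "\<dots> \<longleftrightarrow> k \<in> Hom (poly_cat U) p q"
          using exp_mor_bij[OF pq] pq unfolding bij_betw_def Hom_poly_cat by auto
        finally show "k \<in> ?\<Psi> ` Hom ?F p q \<longleftrightarrow> k \<in> Hom (poly_cat U) p q" .
      qed
    qed
  next
    fix f g p q s assume "f \<in> Hom ?F p q" "g \<in> Hom ?F q s"
    then show "?\<Psi> (g \<cdot>\<^bsub>?F\<^esub> f) = ?\<Psi> g \<cdot>\<^bsub>poly_cat U\<^esub> ?\<Psi> f"
      using exp_mor_comp[of f p q g s] by simp
  next
    fix p assume "p \<in> Obj ?F"
    then show "?\<Psi> (Id ?F p) = Id (poly_cat U) p"
      using exp_mor_id[of p] by simp
  next
    fix f' assume "f' \<in> Mor (poly_cat U)"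
    then show "Dom (poly_cat U) f' \<in> Obj ?F \<and> Cod (poly_cat U) f' \<in> Obj ?F"
      unfolding Mor_poly_cat Hom_poly_cat by auto
  qed (simp_all add: poly_coproducts_def Let_def)
  let ?S = "star (poly_cat U) (poly_coproducts U l r) one"
    and ?SK = "star_coproducts (poly_cat U) (poly_coproducts U l r) one"
  obtain rep' where "labelled_partial_category (opp ?D) ?S l r ?SK fst snd rep'"
    using bij.star_labelled_transport[OF one_Obj kleisli_labelled] by blast
  then interpret poly: labelled_partial_category "opp ?D" ?S l r ?SK fst snd rep' .
  have "star_uniform_traced (poly_cat U) (poly_coproducts U l r) one poly.trace"
    unfolding star_uniform_traced_def star_monoidal_def
    using bij.has_coproducts' bij.terminal'[OF singleton_terminal[OF t_Obj t_terminal]]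
      poly.has_coproducts_axioms poly.uniform_traced_category_M by blast
  then show ?thesis
    unfolding poly_one_def by blast
qed

section \<open>Traces and evaluation\<close>

theorem corollary2p21:
  fixes L :: "('o, 'm) category"
    and U :: "'u set set" and l r :: "'u \<Rightarrow> 'u"
    and V :: "('u \<times> ('o, 'm, 'u) lset_arr) set set"
    and l' r' :: "'u \<times> ('o, 'm, 'u) lset_arr \<Rightarrow> 'u \<times> ('o, 'm, 'u) lset_arr"
  assumes "category L"
    and "set_universe U l r"
    and "set_universe V l' r'"
    and exp_small: "\<And>p X. \<lbrakk>p \<in> Obj (SetL U L); X \<in> Obj (LSet U L)\<rbrakk>
      \<Longrightarrow> FOb (exp_ob (LSet U L) p) X \<in> V"
  shows "(\<exists>Tr. star_uniform_traced (SetL U L) (SetL_coproducts U l r L) (SetL_one L) Tr \<and>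
           (\<forall>X \<in> Obj (LSet U L).
             let C = SetL U L; K = SetL_coproducts U l r L; one = SetL_one L;
                 S = pset_cat V; K' = pset_coproducts l' r';
                 F = eval_star U l r L X
             in traced_functor (star_monoidal C K one) Tr (cocartesian S K') (pset_trace l' r') F
                  (sum_comparison (star_coproducts C K one) S K' F)
                  (zero_comparison (star_coproducts C K one) S K' F)))
       \<and> (\<exists>Tr. star_uniform_traced (poly_cat U) (poly_coproducts U l r) poly_one Tr)"
proof -
  let ?D = "LSet U L"
  interpret U: set_universe U l r
    by fact
  interpret V: pset_universe V l' r'
    using assms(3) by (simp add: pset_universe_def)
  have D: "category ?D"
    unfolding LSet_def by (rule category_fun_cat[OF assms(1) category_set_cat])
  interpret opp: category "opp ?D"
    by (rule category_opp[OF D])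
  interpret fam_star U l r "opp ?D" "empty_lset L"
    using empty_lset_initial[OF assms(1) U.empty_small] by unfold_locales simp_all
  have eqs: "SetL U L = F" "SetL_coproducts U l r L = K" "SetL_one L = one"
    by (simp_all add: SetL_def SetL_coproducts_def SetL_one_def)
  have "traced_functor (star_monoidal F K one) kleisli.trace (cocartesian (pset_cat V) (pset_coproducts l' r'))
      (pset_trace l' r') (eval_star U l r L X)
      (sum_comparison SK (pset_cat V) (pset_coproducts l' r') (eval_star U l r L X))
      (zero_comparison SK (pset_cat V) (pset_coproducts l' r') (eval_star U l r L X))"
    if X: "X \<in> Obj ?D" for X
  proof -
    interpret D: category ?D
      by (rule D)
    interpret exp_functor ?D U
      by unfold_locales
    let ?G = "eval_star U l r L X"
    \<comment> \<open>the partial function of \<open>eval_star\<close> finds the preimage under an injection; it is the one computed by labels\<close>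
    have ev: "evaluation ?D U l r (empty_lset L) V l' r' X ?G"
    proof unfold_locales
      fix p q k i \<alpha> j \<beta>
      show "p \<in> Obj F \<Longrightarrow> exp_set ?D p X \<in> V"
        using exp_small[of p X] X by (simp add: eqs)
      show "p \<in> Obj F \<Longrightarrow> FOb ?G p = exp_set ?D p X"
        using X by (simp add: eval_star_def Let_def)
      assume k: "k \<in> Hom S p q"
      show "src (FMor ?G k) = exp_set ?D p X" "tgt (FMor ?G k) = exp_set ?D q X"
        using X S_HomD(1,2)[OF k] by (simp_all add: eval_star_def Let_def)
      show "the_map (FMor ?G k) (i, \<alpha>) = Some (j, \<beta>) \<longleftrightarrow> (i, \<alpha>) \<in> exp_set ?D p X \<and>
          (\<exists>m. kleisli_rep k i = Some (j, m) \<and> \<beta> = Comp ?D \<alpha> m)" (is "?L \<longleftrightarrow> ?R")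
      proof -
        let ?g = "the_map (the_map (exp_mor ?D (the_map k)) X)"
        let ?\<iota> = "the_map (the_map (exp_mor ?D (Inj1 K q one)) X)"
        have g: "?g (i, \<alpha>) = (fst (the_map (the_map k)) i, Comp ?D \<alpha> (snd (the_map (the_map k)) i))"
          if "(i, \<alpha>) \<in> exp_set ?D p X"
          using that X Hom_fam_catD(1)[OF S_HomD(5)[OF k]] by simp
        have \<iota>: "?\<iota> (u, \<gamma>) = (l u, \<gamma>)" if "(u, \<gamma>) \<in> exp_set ?D q X" for u \<gamma>
          using that X D.comp_id_right by auto
        have G_k: "the_map (FMor ?G k) (i, \<alpha>) = (if (i, \<alpha>) \<in> exp_set ?D p X \<and>
            (\<exists>y \<in> exp_set ?D q X. ?\<iota> y = ?g (i, \<alpha>))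
            then Some (THE y. y \<in> exp_set ?D q X \<and> ?\<iota> y = ?g (i, \<alpha>)) else None)"
          using X S_HomD(1,2)[OF k]
          by (simp add: eval_star_def Let_def eqs del: exp_mor_simps fam_coproducts_simps exp_set_iff)
        have the: "(THE y. y \<in> exp_set ?D q X \<and> ?\<iota> y = ?g (i, \<alpha>)) = y"
          if "y \<in> exp_set ?D q X" "?\<iota> y = ?g (i, \<alpha>)" for y
        proof (rule the_equality)
          fix z assume "z \<in> exp_set ?D q X \<and> ?\<iota> z = ?g (i, \<alpha>)"
          then show "z = y"
            using that \<iota>[of "fst z" "snd z"] \<iota>[of "fst y" "snd y"] by (cases y; cases z) simp
        qed (use that in blast)
        have "?L \<longleftrightarrow> (i, \<alpha>) \<in> exp_set ?D p X \<and> (j, \<beta>) \<in> exp_set ?D q X \<and> ?\<iota> (j, \<beta>) = ?g (i, \<alpha>)"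
          unfolding G_k using the by (auto simp del: exp_set_iff exp_mor_simps fam_coproducts_simps)
        also have "\<dots> \<longleftrightarrow> (i, \<alpha>) \<in> exp_set ?D p X \<and> (j, \<beta>) \<in> exp_set ?D q X
            \<and> (\<exists>m. kleisli_rep k i = Some (j, m) \<and> \<beta> = Comp ?D \<alpha> m)"
          using g \<iota>[of j \<beta>] S_HomD(1)[OF k] unfolding kleisli_rep_Some
          by (auto simp del: exp_mor_simps fam_coproducts_simps)
        also have "\<dots> \<longleftrightarrow> ?R"
          using kleisli.rep_SomeD[OF k] D.comp_hom by fastforce
        finally show ?thesis .
      qed
    qed
    interpret G: iteration_functor S SK kleisli.le kleisli.iter kleisli.trace
        "pset_cat V" "pset_coproducts l' r'" V.le V.iter "pset_trace l' r'" ?G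
      by (rule evaluation.iteration_functor_G[OF ev])
    show ?thesis
      unfolding star_monoidal_def by (rule G.traced_functor_M)
  qed
  then show ?thesis
    using star_uniform_traced_fam U.poly_uniform_traced unfolding Let_def eqs by blast
qed

end
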